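(* Let $n\ge 1$ and let $q$ be a prime power, with $GL(n,q)\neq GL(1,2)$. Let $K$ be the Markov chain on $\mathrm{Irr}(GL(n,q))$ defined from the representation $\eta$ of $GL(n,q)$ whose character is $g\mapsto q^{d(g)}$, where $d(g)$ is the dimension of the fixed space of $g$ on $\mathbb{F}_q^n$. Let $s(r)=\max_{\Lambda\in \mathrm{Irr}(GL(n,q))}\left[1-\frac{K^r(\hat 1,\Lambda)}{\pi(\Lambda)}\right]$ be the separation distance between the distribution of $K$ after $r$ steps started at the trivial representation $\hat 1$ and the Plancherel measure $\pi$. (1) If $0\le r<n$ then $s(r)=1$. If $c\ge 0$ is an integer, then $$ \frac{1}{q^{c+1}}-\frac{4}{q^{2c+3}} \le s(n+c) \le \frac{2}{q^{c+1}}.$$ (2) Let $c\ge 0$ be a fixed integer (and let $q$ be fixed). Then $$ \lim_{n\to\infty} s(n+c) = 1-\prod_{m=1}^{\infty}\left(1-q^{-(c+m)}\right).$$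
   Context: All representations are finite-dimensional complex representations. For a finite group $G$, $\mathrm{Irr}(G)$ is the set of (isomorphism classes of) irreducible representations, $d_\lambda$ is the dimension of $\lambda$, and $m_\rho(V)$ is the multiplicity of the irreducible $\rho$ in the representation $V$. Given a representation $\eta$ of $G$ with real-valued character, the associated Markov chain on $\mathrm{Irr}(G)$ has transition probabilities $$K(\lambda,\rho)=\frac{d_\rho\, m_\rho(\lambda\otimes\eta)}{d_\lambda d_\eta},$$ and $K^r(\lambda,\rho)$ denotes the $r$-step transition probability. It is reversible with respect to the Plancherel measure $\pi(\lambda)=d_\lambda^2/|G|$. The trivial representation is denoted $\hat 1$. Here $G=GL(n,q)$, and $\eta$ is the permutation representation on the $q^n$ vectors of $\mathbb{F}_q^n$; its character at $g$ is the number $q^{d(g)}$ of fixed vectors of $g$, where $d(g)=\dim\ker(g-1)$. *)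

theory Defs
  imports
    "HOL-Analysis.Infinite_Products"
    "HOL-Algebra.Coset"
    "Jordan_Normal_Form.Matrix_Kernel"
begin

text \<open>The group of invertible \<open>n \<times> n\<close> matrices over the field \<open>'f\<close>. It serves both as
  \<open>GL(n,q)\<close> (over a finite field) and, over \<open>complex\<close>, as the target of representations.\<close>

definition GL :: "nat \<Rightarrow> 'f::field mat monoid" where
  "GL n = units_of (ring_mat TYPE('f) n ())"

definition fixed_dim :: "nat \<Rightarrow> 'f::field mat \<Rightarrow> nat" where
  "fixed_dim n g = kernel_dim (g - 1\<^sub>m n)"


text \<open>Finite-dimensional complex representations are given in matrix form. The dimension is read
  off at the identity; values outside the carrier of the group are irrelevant.\<close>

type_synonym 'g rep = "'g \<Rightarrow> complex mat"

definition rep_dim :: "('g, 'm) monoid_scheme \<Rightarrow> 'g rep \<Rightarrow> nat" where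
  "rep_dim G \<rho> = dim_row (\<rho> \<one>\<^bsub>G\<^esub>)"

definition representation :: "('g, 'm) monoid_scheme \<Rightarrow> 'g rep \<Rightarrow> bool" where
  "representation G \<rho> \<longleftrightarrow> \<rho> \<in> hom G (GL (rep_dim G \<rho>))"

definition rep_iso :: "('g, 'm) monoid_scheme \<Rightarrow> 'g rep \<Rightarrow> 'g rep \<Rightarrow> bool" where
  "rep_iso G \<rho> \<sigma> \<longleftrightarrow> rep_dim G \<rho> = rep_dim G \<sigma> \<and>
     (\<exists>P \<in> carrier (GL (rep_dim G \<rho>)). \<forall>g \<in> carrier G. P * \<rho> g = \<sigma> g * P)"

definition irreducible_rep :: "('g, 'm) monoid_scheme \<Rightarrow> 'g rep \<Rightarrow> bool" where
  "irreducible_rep G \<rho> \<longleftrightarrow> representation G \<rho> \<and> rep_dim G \<rho> > 0 \<and>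
     (\<forall>W. VectorSpace.subspace class_ring W (module_vec TYPE(complex) (rep_dim G \<rho>)) \<and>
          (\<forall>g \<in> carrier G. \<forall>w \<in> W. \<rho> g *\<^sub>v w \<in> W) \<longrightarrow>
          W = {0\<^sub>v (rep_dim G \<rho>)} \<or> W = carrier_vec (rep_dim G \<rho>))"

definition character :: "'g rep \<Rightarrow> 'g \<Rightarrow> complex" where
  "character \<rho> g = (\<Sum>i<dim_row (\<rho> g). \<rho> g $$ (i, i))"

definition trivial_rep :: "'g rep" where
  "trivial_rep = (\<lambda>_. 1\<^sub>m 1)"

definition direct_sum_rep :: "'g rep list \<Rightarrow> 'g rep" where
  "direct_sum_rep \<sigma>s = (\<lambda>g. diag_block_mat (map (\<lambda>\<sigma>. \<sigma> g) \<sigma>s))"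

text \<open>Kronecker product: the basis vector \<open>e\<^sub>a \<otimes> e\<^sub>b\<close> has index \<open>a * dim B + b\<close>.\<close>

definition kronecker :: "complex mat \<Rightarrow> complex mat \<Rightarrow> complex mat" where
  "kronecker A B = mat (dim_row A * dim_row B) (dim_col A * dim_col B)
     (\<lambda>(i, j). A $$ (i div dim_row B, j div dim_col B) * B $$ (i mod dim_row B, j mod dim_col B))"

definition tensor_rep :: "'g rep \<Rightarrow> 'g rep \<Rightarrow> 'g rep" where
  "tensor_rep \<rho> \<sigma> = (\<lambda>g. kronecker (\<rho> g) (\<sigma> g))"

text \<open>The multiplicity of the irreducible \<open>\<rho>\<close> in \<open>V\<close>: the number of summands isomorphic to \<open>\<rho>\<close> in
  any decomposition of \<open>V\<close> into irreducibles. For a finite group, such a decomposition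
  exists (Maschke) and the number does not depend on it (Jordan--Hoelder).\<close>

definition multiplicity_rep :: "('g, 'm) monoid_scheme \<Rightarrow> 'g rep \<Rightarrow> 'g rep \<Rightarrow> nat" where
  "multiplicity_rep G \<rho> V = (THE m. \<exists>\<sigma>s. (\<forall>\<sigma> \<in> set \<sigma>s. irreducible_rep G \<sigma>) \<and>
     rep_iso G V (direct_sum_rep \<sigma>s) \<and> m = length (filter (rep_iso G \<rho>) \<sigma>s))"


definition rep_iso_rel :: "('g, 'm) monoid_scheme \<Rightarrow> ('g rep \<times> 'g rep) set" where
  "rep_iso_rel G = {(\<rho>, \<sigma>). irreducible_rep G \<rho> \<and> irreducible_rep G \<sigma> \<and> rep_iso G \<rho> \<sigma>}"

definition Irr :: "('g, 'm) monoid_scheme \<Rightarrow> 'g rep set set" where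
  "Irr G = {\<rho>. irreducible_rep G \<rho>} // rep_iso_rel G"

definition trivial_class :: "('g, 'm) monoid_scheme \<Rightarrow> 'g rep set" where
  "trivial_class G = rep_iso_rel G `` {trivial_rep}"

definition class_rep :: "'g rep set \<Rightarrow> 'g rep" where
  "class_rep \<Lambda> = (SOME \<rho>. \<rho> \<in> \<Lambda>)"

definition class_dim :: "('g, 'm) monoid_scheme \<Rightarrow> 'g rep set \<Rightarrow> nat" where
  "class_dim G \<Lambda> = rep_dim G (class_rep \<Lambda>)"

definition chain_K :: "('g, 'm) monoid_scheme \<Rightarrow> 'g rep \<Rightarrow> 'g rep set \<Rightarrow> 'g rep set \<Rightarrow> real" where
  "chain_K G \<eta> \<Lambda> \<Gamma> =
     real (class_dim G \<Gamma>) *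
     real (multiplicity_rep G (class_rep \<Gamma>) (tensor_rep (class_rep \<Lambda>) \<eta>)) /
     (real (class_dim G \<Lambda>) * real (rep_dim G \<eta>))"

primrec chain_K_pow ::
  "('g, 'm) monoid_scheme \<Rightarrow> 'g rep \<Rightarrow> nat \<Rightarrow> 'g rep set \<Rightarrow> 'g rep set \<Rightarrow> real" where
  "chain_K_pow G \<eta> 0 \<Lambda> \<Gamma> = (if \<Lambda> = \<Gamma> then 1 else 0)"
| "chain_K_pow G \<eta> (Suc r) \<Lambda> \<Gamma> = (\<Sum>M \<in> Irr G. chain_K_pow G \<eta> r \<Lambda> M * chain_K G \<eta> M \<Gamma>)"

definition plancherel :: "('g, 'm) monoid_scheme \<Rightarrow> 'g rep set \<Rightarrow> real" where
  "plancherel G \<Lambda> = (real (class_dim G \<Lambda>))\<^sup>2 / real (Coset.order G)"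

definition separation :: "('g, 'm) monoid_scheme \<Rightarrow> 'g rep \<Rightarrow> nat \<Rightarrow> real" where
  "separation G \<eta> r =
     Max ((\<lambda>\<Lambda>. 1 - chain_K_pow G \<eta> r (trivial_class G) \<Lambda> / plancherel G \<Lambda>) ` Irr G)"


text \<open>The permutation representation of \<open>GL n\<close> on the vectors of length \<open>n\<close> over a finite field,
  with respect to an arbitrary enumeration of these vectors. It has the character that the
  main statement prescribes for \<open>\<eta>\<close>; this determines \<open>\<eta>\<close> up to isomorphism.\<close>

definition vec_enum :: "nat \<Rightarrow> 'f::{field,finite} vec list" where
  "vec_enum n = (SOME xs. distinct xs \<and> set xs = carrier_vec n)"

definition vector_perm_rep :: "nat \<Rightarrow> ('f::{field,finite} mat) rep" where
  "vector_perm_rep n = (\<lambda>g. mat (length (vec_enum n :: 'f vec list)) (length (vec_enum n :: 'f vec list))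
     (\<lambda>(i, j). if vec_enum n ! i = g *\<^sub>v (vec_enum n ! j) then 1 else 0))"

lemma finite_carrier_vec_finite_field: "finite (carrier_vec n :: 'f::{field,finite} vec set)"
proof -
  have "carrier_vec n \<subseteq> (vec_of_list ` {xs :: 'f list. set xs \<subseteq> UNIV \<and> length xs = n})"
  proof
    fix v :: "'f vec" assume "v \<in> carrier_vec n"
    then have "length (list_of_vec v) = n" "vec_of_list (list_of_vec v) = v"
      by (auto simp: vec_list)
    then show "v \<in> vec_of_list ` {xs. set xs \<subseteq> UNIV \<and> length xs = n}"
      by (intro image_eqI[of _ _ "list_of_vec v"]) auto
  qed
  then show ?thesis
    by (rule finite_subset) (intro finite_imageI finite_lists_length_eq finite)
qed

lemma vec_enum:
  "distinct (vec_enum n :: 'f::{field,finite} vec list)"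
  "set (vec_enum n :: 'f::{field,finite} vec list) = carrier_vec n"
proof -
  have "\<exists>xs :: 'f vec list. distinct xs \<and> set xs = carrier_vec n"
    using finite_distinct_list[OF finite_carrier_vec_finite_field] by blast
  from someI_ex[OF this] show "distinct (vec_enum n :: 'f vec list)"
    "set (vec_enum n :: 'f vec list) = carrier_vec n"
    by (auto simp: vec_enum_def)
qed

lemma GL_simps:
  "carrier (GL n) = Units (ring_mat TYPE('f::field) n ())"
  "mult (GL n :: 'f mat monoid) = (*)"
  "one (GL n :: 'f mat monoid) = 1\<^sub>m n"
  by (simp_all add: GL_def units_of_carrier units_of_mult units_of_one ring_mat_simps)

lemma vector_perm_rep_one:
  "vector_perm_rep n (1\<^sub>m n :: 'f::{field,finite} mat) = 1\<^sub>m (length (vec_enum n :: 'f vec list))"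
proof (rule eq_matI)
  fix i j assume ij: "i < dim_row (1\<^sub>m (length (vec_enum n :: 'f vec list)) :: complex mat)"
    "j < dim_col (1\<^sub>m (length (vec_enum n :: 'f vec list)) :: complex mat)"
  have "(vec_enum n ! j :: 'f vec) \<in> carrier_vec n" using ij vec_enum(2) nth_mem by fastforce
  then show "vector_perm_rep n (1\<^sub>m n :: 'f mat) $$ (i, j) =
      1\<^sub>m (length (vec_enum n :: 'f vec list)) $$ (i, j)"
    using ij by (simp add: vector_perm_rep_def nth_eq_iff_index_eq[OF vec_enum(1)])
qed (auto simp: vector_perm_rep_def)

lemma vector_perm_rep_mult:
  assumes g: "g \<in> carrier_mat n n" and h: "h \<in> carrier_mat n n"
  shows "vector_perm_rep n (g * h :: 'f::{field,finite} mat) = vector_perm_rep n g * vector_perm_rep n h"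
proof (rule eq_matI)
  let ?xs = "vec_enum n :: 'f vec list"
  let ?N = "length ?xs"
  fix i j assume "i < dim_row (vector_perm_rep n g * vector_perm_rep n h)"
    "j < dim_col (vector_perm_rep n g * vector_perm_rep n h)"
  then have i: "i < ?N" and j: "j < ?N" by (auto simp: vector_perm_rep_def)
  have xj: "?xs ! j \<in> carrier_vec n" using j vec_enum(2) nth_mem by fastforce
  then have "h *\<^sub>v (?xs ! j) \<in> set ?xs" using h unfolding vec_enum(2) by simp
  then obtain k where k: "k < ?N" "?xs ! k = h *\<^sub>v (?xs ! j)" by (metis in_set_conv_nth)
  have eq: "?xs ! l = h *\<^sub>v (?xs ! j) \<longleftrightarrow> l = k" if "l < ?N" for l
    using that k nth_eq_iff_index_eq[OF vec_enum(1)] by metis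
  have "(vector_perm_rep n g * vector_perm_rep n h) $$ (i, j) =
     (\<Sum>l = 0..<?N. (if ?xs ! i = g *\<^sub>v (?xs ! l) then 1 else 0) *
        (if ?xs ! l = h *\<^sub>v (?xs ! j) then 1 else 0))"
    using i j by (simp add: vector_perm_rep_def scalar_prod_def)
  also have "\<dots> = (\<Sum>l = 0..<?N. if l = k then (if ?xs ! i = g *\<^sub>v (?xs ! k) then 1 else 0) else 0)"
    by (rule sum.cong) (auto simp: eq)
  also have "\<dots> = (if ?xs ! i = g *\<^sub>v (h *\<^sub>v (?xs ! j)) then 1 else 0)"
    using k by simp
  also have "g *\<^sub>v (h *\<^sub>v (?xs ! j)) = (g * h) *\<^sub>v (?xs ! j)"
    using g h xj by simp
  finally show "vector_perm_rep n (g * h) $$ (i, j) =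
      (vector_perm_rep n g * vector_perm_rep n h) $$ (i, j)"
    using i j by (simp add: vector_perm_rep_def)
qed (auto simp: vector_perm_rep_def)

lemma representation_vector_perm_rep:
  "representation (GL n) (vector_perm_rep n :: 'f::{field,finite} mat rep)"
proof -
  let ?N = "length (vec_enum n :: 'f vec list)"
  have dim: "rep_dim (GL n) (vector_perm_rep n :: 'f mat rep) = ?N"
    by (simp add: rep_dim_def vector_perm_rep_def)
  have car: "vector_perm_rep n g \<in> carrier_mat ?N ?N" for g :: "'f mat"
    by (simp add: vector_perm_rep_def)
  have "vector_perm_rep n g \<in> carrier (GL ?N)" if g: "g \<in> carrier (GL n)" for g :: "'f mat"
  proof -
    from g obtain h where h: "g \<in> carrier_mat n n" "h \<in> carrier_mat n n" "h * g = 1\<^sub>m n" "g * h = 1\<^sub>m n"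
      by (auto simp: GL_simps Units_def ring_mat_simps)
    have inv: "vector_perm_rep n g * vector_perm_rep n h = 1\<^sub>m ?N"
      "vector_perm_rep n h * vector_perm_rep n g = 1\<^sub>m ?N"
      by (simp_all only: vector_perm_rep_mult[OF h(1,2), symmetric]
          vector_perm_rep_mult[OF h(2,1), symmetric] h(3,4) vector_perm_rep_one)
    show ?thesis
      unfolding GL_simps Units_def ring_mat_simps mem_Collect_eq
      using car[of g] car[of h] inv by blast
  qed
  moreover have "vector_perm_rep n (g * h) = vector_perm_rep n g * vector_perm_rep n h"
    if "g \<in> carrier (GL n)" "h \<in> carrier (GL n)" for g h :: "'f mat"
    using that by (intro vector_perm_rep_mult) (auto simp: GL_simps(1) Units_def ring_mat_simps)
  ultimately show ?thesis
    unfolding representation_def dim hom_def GL_simps(2) by blast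
qed

lemma card_mat_kernel:
  fixes A :: "'f::{field,finite} mat"
  assumes A: "A \<in> carrier_mat m n"
  shows "card (mat_kernel A) = CARD('f) ^ kernel_dim A"
proof -
  interpret kernel m n A by unfold_locales (rule A)
  have "finite (mat_kernel A)"
    using finite_subset[OF mat_kernel_carrier[OF A] finite_carrier_vec_finite_field] .
  moreover have "span (mat_kernel A) = mat_kernel A"
    using Ker.in_own_span[of "mat_kernel A"] Ker.span_is_subset2[of "mat_kernel A"] by auto
  ultimately have "Ker.fin_dim"
    unfolding Ker.fin_dim_def by auto
  then obtain B where B: "finite B" "basis B"
    using Ker.finite_basis_exists by blast
  have BK: "B \<subseteq> mat_kernel A" using B(2) unfolding Ker.basis_def by auto
  have ex1: "\<exists>!a. a \<in> B \<rightarrow>\<^sub>E UNIV \<and> lincomb a B = v" if "v \<in> mat_kernel A" for v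
    using Ker.basis_criterion[OF B(1)] BK B(2) that by auto
  have "bij_betw (\<lambda>a. lincomb a B) (B \<rightarrow>\<^sub>E UNIV) (mat_kernel A)"
  proof (rule bij_betwI')
    fix a b :: "'f vec \<Rightarrow> 'f" assume ab: "a \<in> B \<rightarrow>\<^sub>E UNIV" "b \<in> B \<rightarrow>\<^sub>E UNIV"
    have "lincomb a B \<in> mat_kernel A" using Ker.lincomb_closed[of B a] BK by auto
    from ex1[OF this] show "lincomb a B = lincomb b B \<longleftrightarrow> a = b"
      using ab by auto
  next
    fix a :: "'f vec \<Rightarrow> 'f"
    show "lincomb a B \<in> mat_kernel A" using Ker.lincomb_closed[of B a] BK by auto
  next
    fix v assume "v \<in> mat_kernel A"
    from ex1[OF this] show "\<exists>a \<in> B \<rightarrow>\<^sub>E UNIV. v = lincomb a B" by blast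
  qed
  then have "card (mat_kernel A) = card (B \<rightarrow>\<^sub>E (UNIV :: 'f set))"
    by (metis bij_betw_same_card)
  also have "\<dots> = CARD('f) ^ card B" using B(1) by (simp add: card_funcsetE)
  also have "card B = kernel_dim A" using Ker.dim_basis[OF B] by simp
  finally show ?thesis .
qed

lemma character_vector_perm_rep:
  assumes "g \<in> carrier (GL n)"
  shows "character (vector_perm_rep n) (g :: 'f::{field,finite} mat) = of_nat (CARD('f) ^ fixed_dim n g)"
proof -
  let ?xs = "vec_enum n :: 'f vec list"
  let ?N = "length ?xs"
  have g: "g \<in> carrier_mat n n" using assms by (auto simp: GL_simps Units_def ring_mat_simps)
  have "character (vector_perm_rep n) g = (\<Sum>i<?N. if ?xs ! i = g *\<^sub>v (?xs ! i) then 1 else 0)"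
    by (simp add: character_def vector_perm_rep_def)
  also have "\<dots> = (\<Sum>v\<in>carrier_vec n. if v = g *\<^sub>v v then 1 else 0)"
    using vec_enum by (intro sum.reindex_bij_betw bij_betw_nth) auto
  also have "\<dots> = of_nat (card {v \<in> carrier_vec n. v = g *\<^sub>v v})"
    using finite_carrier_vec_finite_field[of n, where ?'f = 'f] by (simp add: sum.If_cases Int_def)
  also have "{v \<in> carrier_vec n. v = g *\<^sub>v v} = mat_kernel (g - 1\<^sub>m n)"
  proof -
    have "(g - 1\<^sub>m n) *\<^sub>v v = 0\<^sub>v n \<longleftrightarrow> v = g *\<^sub>v v" if v: "v \<in> carrier_vec n" for v
    proof -
      have "(g - 1\<^sub>m n) *\<^sub>v v = g *\<^sub>v v - v"
        using g v by (simp add: minus_mult_distrib_mat_vec)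
      moreover have "g *\<^sub>v v - v = 0\<^sub>v n \<longleftrightarrow> v = g *\<^sub>v v"
        using g v by (auto simp: vec_eq_iff)
      ultimately show ?thesis by simp
    qed
    then show ?thesis using g by (auto simp: mat_kernel_def)
  qed
  also have "card \<dots> = CARD('f) ^ fixed_dim n g"
    unfolding fixed_dim_def using g by (intro card_mat_kernel[of _ n n] minus_carrier_mat) simp
  finally show ?thesis .
qed

end

theory Submission
  imports Defs "Jordan_Normal_Form.Spectral_Radius" "HOL-Algebra.Algebraic_Closure_Type"
begin

text \<open>
  Write \<open>G = GL(n,q)\<close>, let \<open>\<chi>\<close> be the character of an irreducible \<open>\<Lambda>\<close> of dimension \<open>d\<close> and let \<open>d(g)\<close> be
  the dimension of the fixed space of \<open>g\<close>. Multiplicities are inner products of characters, and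
  one step of the chain is a tensor product with \<open>\<eta>\<close>, so an induction on \<open>r\<close> turns the quotient
  \<open>K\<^sup>r(1,\<Lambda>) / \<pi>(\<Lambda>)\<close> into \<open>1 / (d q\<^bsup>nr\<^esup>)\<close> times the sum of \<open>\<chi>(g\<^sup>-\<^sup>1) q\<^bsup>r d(g)\<^esup>\<close> over \<open>g \<in> G\<close>
  (\<open>chain_K_pow_eq\<close>). This needs Maschke's theorem, Schur's lemma and the orthogonality of
  characters (\<open>maschke\<close>, \<open>schur\<close>, \<open>character_orthogonality\<close>, \<open>multiplicity_rep_eq_char_mult\<close>).

  The idea is to expand \<open>q\<^bsup>r d(g)\<^esup>\<close> in the functions \<open>I\<^sub>k(g) = (q\<^bsup>d(g)\<^esup> - 1) (q\<^bsup>d(g)\<^esup> - q) \<dots> (q\<^bsup>d(g)\<^esup> - q\<^bsup>k-1\<^esup>)\<close>,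
  where the coefficients are Gaussian binomial coefficients (\<open>power_eq_sum_q_binomial\<close>).
  The number \<open>I\<^sub>k(g)\<close> counts the linearly independent \<open>k\<close>-tuples of vectors fixed by \<open>g\<close>. Exchanging
  sums, \<open>\<Sum>\<^sub>g \<chi>(g\<^sup>-\<^sup>1) I\<^sub>k(g)\<close> is a sum of \<open>\<Sum>\<^sub>s \<chi>(s\<^sup>-\<^sup>1)\<close> over stabilizers of \<open>k\<close>-tuples, and each of these
  is the order of the stabilizer times a multiplicity (\<open>sum_character_subgroup\<close>), hence a natural
  number. There are no terms with \<open>k > n\<close>, and \<open>I\<^sub>n\<close> vanishes off the identity, so that the term
  \<open>k = n\<close> contributes the product of \<open>1 - q\<^sup>j / q\<^sup>r\<close> over \<open>j < n\<close> for every \<open>\<Lambda>\<close>. Therefore the quotient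
  is at least this product, with equality if no stabilizer of fewer than \<open>n\<close> vectors fixes
  a nonzero vector of \<open>\<Lambda>\<close>. Once one such \<open>\<Lambda>\<close> is known, the separation distance is 1 minus this product
  for all \<open>r\<close> (\<open>separation_GL\<close>). The product contains a zero factor if \<open>r < n\<close>, and the bounds and
  the limit for \<open>r = n + c\<close> are elementary.

  It remains to find an irreducible of this kind. Cuspidal representations have the property, but
  it is not necessary to construct one. Let \<open>f\<close> be a class function such that for every map given on a
  hyperplane the sum of \<open>f\<close> over all invertible extensions of the map vanishes. Fewer than \<open>n\<close> vectors lie
  in a hyperplane, so the sums of \<open>f\<close> over the cosets of their stabilizer vanish as well. A class function
  acts on each irreducible by a scalar, and if \<open>f \<noteq> 0\<close> then some scalar is nonzero because the regular
  representation is faithful on class functions; the irreducible with this scalar is as required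
  (\<open>exists_irreducible_annihilated\<close>).

  The function \<open>f\<close> imitates the values of a cuspidal character. It is
  \<open>N (1 - q) (1 - q\<^sup>2) \<dots> (1 - q\<^bsup>d(g)-1\<^esup>)\<close> on unipotent elements, it is \<open>-M\<close> on elliptic elements, which act
  irreducibly and are not the identity, and it is 0 elsewhere. Here \<open>N\<close> and \<open>M\<close> are the numbers of
  elliptic and of unipotent companion matrices. Fix a map on a hyperplane and consider the largest
  subspace of the hyperplane that is stable under it. If this core is nonzero, no extension is
  elliptic, and moving a unipotent extension by the vectors of the core shows that the unipotent
  terms cancel (\<open>sum_green_weight_updates\<close>). If the core is zero, a suitable basis identifies the
  extensions with the companion matrices, all unipotent ones have a fixed space of dimension one, and
  the sum is \<open>N M - M N = 0\<close> (\<open>sum_cuspidal_fun_extensions\<close>). Finally \<open>f(1) \<noteq> 0\<close> requires \<open>N > 0\<close>: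
  multiplication by a nonzero generator \<open>z \<noteq> 1\<close> of the field with \<open>q\<^sup>n\<close> elements is elliptic
  (\<open>exists_field_generator\<close>, \<open>exists_elliptic_companion\<close>). This is where \<open>GL(1,2)\<close> is excluded, since
  the field with two elements has no such generator.
\<close>

no_notation Finite_Cartesian_Product.vec_nth (infixl "$" 90)
no_notation fps_nth (infixl "$" 75)
no_notation Inner_Product.real_inner_class.inner (infix "\<bullet>" 70)

section \<open>Traces and the general linear group\<close>

definition mat_trace :: "'a::comm_ring_1 mat \<Rightarrow> 'a" where
  "mat_trace A = (\<Sum>i<dim_row A. A $$ (i, i))"

lemma character_eq_trace: "character \<rho> g = mat_trace (\<rho> g)"
  by (simp add: character_def mat_trace_def)

lemma index_mult_mat_sum:
  assumes "A \<in> carrier_mat m k" "B \<in> carrier_mat k n" "i < m" "j < n"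
  shows "(A * B) $$ (i, j) = (\<Sum>l<k. A $$ (i, l) * B $$ (l, j))"
  using assms by (simp add: scalar_prod_def lessThan_atLeast0)

lemma smult_mat_mult_vec:
  "A \<in> carrier_mat m n \<Longrightarrow> v \<in> carrier_vec n \<Longrightarrow> (k \<cdot>\<^sub>m A) *\<^sub>v v = k \<cdot>\<^sub>v (A *\<^sub>v (v :: 'a::comm_ring_1 vec))"
  by (intro eq_vecI) (auto simp: scalar_prod_def sum_distrib_left mult.assoc)

lemma mult_zero_vec: "A \<in> carrier_mat m n \<Longrightarrow> A *\<^sub>v 0\<^sub>v n = (0\<^sub>v m :: 'a::comm_ring_1 vec)"
  by (intro eq_vecI) auto

lemma index_mult_vec_sum:
  "A \<in> carrier_mat m n \<Longrightarrow> v \<in> carrier_vec n \<Longrightarrow> i < m \<Longrightarrow>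
    (A *\<^sub>v v) $ i = (\<Sum>j<n. A $$ (i, j) * (v :: 'a::comm_ring_1 vec) $ j)"
  by (simp add: scalar_prod_def lessThan_atLeast0)

lemma mult_unit_vec:
  "A \<in> carrier_mat m n \<Longrightarrow> j < n \<Longrightarrow> A *\<^sub>v unit_vec n j = (col A j :: 'a::comm_ring_1 vec)"
  by (intro eq_vecI) auto

lemma mat_trace_commute:
  assumes A: "A \<in> carrier_mat m n" and B: "B \<in> carrier_mat n m"
  shows "mat_trace (A * B) = mat_trace (B * A)"
proof -
  have "mat_trace (A * B) = (\<Sum>i<m. \<Sum>l<n. A $$ (i, l) * B $$ (l, i))"
    using A B by (simp add: mat_trace_def index_mult_mat_sum del: index_mult_mat(1))
  also have "\<dots> = (\<Sum>l<n. \<Sum>i<m. B $$ (l, i) * A $$ (i, l))"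
    by (subst sum.swap) (simp add: mult.commute)
  also have "\<dots> = mat_trace (B * A)"
    using A B by (simp add: mat_trace_def index_mult_mat_sum del: index_mult_mat(1))
  finally show ?thesis .
qed

definition matrix_sum :: "nat \<Rightarrow> nat \<Rightarrow> ('a \<Rightarrow> 'b::comm_ring_1 mat) \<Rightarrow> 'a set \<Rightarrow> 'b mat" where
  "matrix_sum m n f S = mat m n (\<lambda>ij. \<Sum>x\<in>S. f x $$ ij)"

lemma matrix_sum_carrier [simp]: "matrix_sum m n f S \<in> carrier_mat m n"
  by (simp add: matrix_sum_def)

lemma index_matrix_sum [simp]:
  "i < m \<Longrightarrow> j < n \<Longrightarrow> matrix_sum m n f S $$ (i, j) = (\<Sum>x\<in>S. f x $$ (i, j))"
  "dim_row (matrix_sum m n f S) = m" "dim_col (matrix_sum m n f S) = n"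
  by (simp_all add: matrix_sum_def)

lemma matrix_sum_cong:
  "(\<And>x. x \<in> S \<Longrightarrow> f x = g x) \<Longrightarrow> matrix_sum m n f S = matrix_sum m n g S"
  by (auto simp: matrix_sum_def)

lemma matrix_sum_reindex:
  "bij_betw h S Y \<Longrightarrow> matrix_sum m n (\<lambda>x. f (h x)) S = matrix_sum m n f Y"
  by (auto simp: matrix_sum_def intro!: sum.reindex_bij_betw)

lemma mult_matrix_sum:
  assumes "A \<in> carrier_mat k m" "\<And>x. x \<in> S \<Longrightarrow> f x \<in> carrier_mat m n"
  shows "A * matrix_sum m n f S = matrix_sum k n (\<lambda>x. A * f x) S"
proof (rule eq_matI)
  fix i j assume "i < dim_row (matrix_sum k n (\<lambda>x. A * f x) S)" "j < dim_col (matrix_sum k n (\<lambda>x. A * f x) S)"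
  then have ij: "i < k" "j < n" by auto
  have "(A * matrix_sum m n f S) $$ (i, j) = (\<Sum>l<m. \<Sum>x\<in>S. A $$ (i, l) * f x $$ (l, j))"
    using assms ij by (simp add: index_mult_mat_sum[of _ k m _ n] sum_distrib_left del: index_mult_mat(1))
  also have "\<dots> = (\<Sum>x\<in>S. (A * f x) $$ (i, j))"
    using assms ij by (subst sum.swap) (simp add: index_mult_mat_sum[of _ k m _ n] del: index_mult_mat(1))
  finally show "(A * matrix_sum m n f S) $$ (i, j) = matrix_sum k n (\<lambda>x. A * f x) S $$ (i, j)"
    using ij by simp
qed (use assms in auto)

lemma matrix_sum_mult:
  assumes "B \<in> carrier_mat n k" "\<And>x. x \<in> S \<Longrightarrow> f x \<in> carrier_mat m n"
  shows "matrix_sum m n f S * B = matrix_sum m k (\<lambda>x. f x * B) S"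
proof (rule eq_matI)
  fix i j assume "i < dim_row (matrix_sum m k (\<lambda>x. f x * B) S)" "j < dim_col (matrix_sum m k (\<lambda>x. f x * B) S)"
  then have ij: "i < m" "j < k" by auto
  have "(matrix_sum m n f S * B) $$ (i, j) = (\<Sum>l<n. \<Sum>x\<in>S. f x $$ (i, l) * B $$ (l, j))"
    using assms ij by (simp add: index_mult_mat_sum[of _ m n _ k] sum_distrib_right del: index_mult_mat(1))
  also have "\<dots> = (\<Sum>x\<in>S. (f x * B) $$ (i, j))"
    using assms ij by (subst sum.swap) (simp add: index_mult_mat_sum[of _ m n _ k] del: index_mult_mat(1))
  finally show "(matrix_sum m n f S * B) $$ (i, j) = matrix_sum m k (\<lambda>x. f x * B) S $$ (i, j)"
    using ij by simp
qed (use assms in auto)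

lemma mat_trace_matrix_sum:
  assumes "\<And>x. x \<in> S \<Longrightarrow> f x \<in> carrier_mat n n"
  shows "mat_trace (matrix_sum n n f S) = (\<Sum>x\<in>S. mat_trace (f x))"
proof -
  have "mat_trace (matrix_sum n n f S) = (\<Sum>x\<in>S. \<Sum>i<n. f x $$ (i, i))"
    by (simp add: mat_trace_def sum.swap[of _ S])
  also have "\<dots> = (\<Sum>x\<in>S. mat_trace (f x))"
    using assms by (intro sum.cong) (auto simp: mat_trace_def)
  finally show ?thesis .
qed

lemma mat_trace_smult: "A \<in> carrier_mat n n \<Longrightarrow> mat_trace (c \<cdot>\<^sub>m A) = c * mat_trace A"
  by (simp add: mat_trace_def sum_distrib_left)

lemma mat_trace_one [simp]: "mat_trace (1\<^sub>m n) = of_nat n"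
  by (simp add: mat_trace_def)

lemma GL_iff:
  "P \<in> carrier (GL d) \<longleftrightarrow> P \<in> carrier_mat d d \<and> (\<exists>Q\<in>carrier_mat d d. P * Q = 1\<^sub>m d \<and> Q * P = 1\<^sub>m d)"
  by (auto simp: GL_simps Units_def ring_mat_simps)

lemma group_GL: "group (GL d)"
proof -
  interpret R: ring "ring_mat TYPE('a) d ()" by (rule ring_mat)
  show ?thesis unfolding GL_def by (rule R.units_group)
qed

lemma GL_iff_det: "P \<in> carrier (GL d) \<longleftrightarrow> P \<in> carrier_mat d d \<and> det P \<noteq> 0"
  using unit_imp_det_non_zero[of P d "()"] det_non_zero_imp_unit[of P d "()"]
  by (auto simp: GL_simps(1) Units_def ring_mat_simps)

lemma GL_iff_kernel:
  fixes P :: "'a::field mat"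
  assumes "P \<in> carrier_mat d d"
  shows "P \<in> carrier (GL d) \<longleftrightarrow> (\<forall>v\<in>carrier_vec d. P *\<^sub>v v = 0\<^sub>v d \<longrightarrow> v = 0\<^sub>v d)"
  using det_0_iff_vec_prod_zero_field[OF assms] assms by (auto simp: GL_iff_det)

lemma GL_mult: "P \<in> carrier (GL d) \<Longrightarrow> Q \<in> carrier (GL d) \<Longrightarrow> P * Q \<in> carrier (GL d)"
  by (auto simp: GL_iff_det det_mult)

section \<open>Representations and their isomorphisms\<close>

context group begin

lemma representationD:
  assumes "representation G \<rho>"
  shows "g \<in> carrier G \<Longrightarrow> \<rho> g \<in> carrier (GL (rep_dim G \<rho>))"
    "g \<in> carrier G \<Longrightarrow> \<rho> g \<in> carrier_mat (rep_dim G \<rho>) (rep_dim G \<rho>)"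
    "g \<in> carrier G \<Longrightarrow> h \<in> carrier G \<Longrightarrow> \<rho> (g \<otimes> h) = \<rho> g * \<rho> h"
    "\<rho> \<one> = 1\<^sub>m (rep_dim G \<rho>)"
    "g \<in> carrier G \<Longrightarrow> \<rho> g * \<rho> (inv g) = 1\<^sub>m (rep_dim G \<rho>)"
    "g \<in> carrier G \<Longrightarrow> \<rho> (inv g) * \<rho> g = 1\<^sub>m (rep_dim G \<rho>)"
proof -
  let ?d = "rep_dim G \<rho>"
  have h: "\<rho> \<in> hom G (GL ?d)" using assms by (simp add: representation_def)
  show 1: "g \<in> carrier G \<Longrightarrow> \<rho> g \<in> carrier (GL ?d)" for g
    using hom_in_carrier[OF h] by blast
  then show "g \<in> carrier G \<Longrightarrow> \<rho> g \<in> carrier_mat ?d ?d"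
    by (simp add: GL_iff)
  show 2: "g \<in> carrier G \<Longrightarrow> h \<in> carrier G \<Longrightarrow> \<rho> (g \<otimes> h) = \<rho> g * \<rho> h" for g h
    using hom_mult[OF h] by (simp add: GL_simps)
  show 3: "\<rho> \<one> = 1\<^sub>m ?d"
    using hom_one[OF h is_group group_GL] by (simp add: GL_simps)
  show "g \<in> carrier G \<Longrightarrow> \<rho> g * \<rho> (inv g) = 1\<^sub>m ?d" "g \<in> carrier G \<Longrightarrow> \<rho> (inv g) * \<rho> g = 1\<^sub>m ?d"
    using 2[of g "inv g"] 2[of "inv g" g] 3 by simp_all
qed

lemma representationI:
  assumes "\<And>g. g \<in> carrier G \<Longrightarrow> \<rho> g \<in> carrier_mat d d"
    and "\<And>g h. g \<in> carrier G \<Longrightarrow> h \<in> carrier G \<Longrightarrow> \<rho> (g \<otimes> h) = \<rho> g * \<rho> h"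
    and "\<rho> \<one> = 1\<^sub>m d"
  shows "representation G \<rho>" "rep_dim G \<rho> = d"
proof -
  show d: "rep_dim G \<rho> = d" using assms by (simp add: rep_dim_def)
  have "\<rho> g \<in> carrier (GL d)" if "g \<in> carrier G" for g
  proof -
    have "\<rho> g * \<rho> (inv g) = 1\<^sub>m d" "\<rho> (inv g) * \<rho> g = 1\<^sub>m d"
      using assms(2)[of g "inv g"] assms(2)[of "inv g" g] assms(3) that by simp_all
    then show ?thesis using assms(1)[OF that] assms(1)[of "inv g"] that unfolding GL_iff by blast
  qed
  then show "representation G \<rho>"
    unfolding representation_def d hom_def using assms(2) by (auto simp: GL_simps(2))
qed

lemma rep_isoI:
  assumes "rep_dim G \<rho> = d" "rep_dim G \<sigma> = d" "P \<in> carrier (GL d)"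
    "\<And>g. g \<in> carrier G \<Longrightarrow> P * \<rho> g = \<sigma> g * P"
  shows "rep_iso G \<rho> \<sigma>"
  using assms unfolding rep_iso_def by auto

lemma rep_iso_dim: "rep_iso G \<rho> \<sigma> \<Longrightarrow> rep_dim G \<rho> = rep_dim G \<sigma>"
  by (simp add: rep_iso_def)

lemma rep_iso_refl:
  assumes "representation G \<rho>" shows "rep_iso G \<rho> \<rho>"
  by (intro rep_isoI[of _ "rep_dim G \<rho>" _ "1\<^sub>m (rep_dim G \<rho>)"])
    (auto simp: GL_iff_det left_mult_one_mat[OF representationD(2)[OF assms]]
      right_mult_one_mat[OF representationD(2)[OF assms]])

lemma rep_iso_sym:
  assumes "representation G \<rho>" "representation G \<sigma>" "rep_iso G \<rho> \<sigma>"
  shows "rep_iso G \<sigma> \<rho>"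
proof -
  define d where "d = rep_dim G \<rho>"
  have d: "rep_dim G \<rho> = d" "rep_dim G \<sigma> = d" using rep_iso_dim[OF assms(3)] d_def by auto
  obtain P where P: "P \<in> carrier (GL d)" "\<And>g. g \<in> carrier G \<Longrightarrow> P * \<rho> g = \<sigma> g * P"
    using assms(3) unfolding rep_iso_def d by auto
  obtain Q where Q: "Q \<in> carrier_mat d d" "P * Q = 1\<^sub>m d" "Q * P = 1\<^sub>m d"
    using P(1) unfolding GL_iff by auto
  have Pc: "P \<in> carrier_mat d d" using P(1) by (simp add: GL_iff)
  show ?thesis
  proof (rule rep_isoI[OF d(2,1)])
    show "Q \<in> carrier (GL d)" using Q Pc unfolding GL_iff by blast
    fix g assume g: "g \<in> carrier G"
    note c = representationD(2)[OF assms(1) g, unfolded d] representationD(2)[OF assms(2) g, unfolded d]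
    have "Q * \<sigma> g = Q * (\<sigma> g * (P * Q))" using Q c by simp
    also have "\<dots> = Q * ((\<sigma> g * P) * Q)" using Q c Pc by (simp add: assoc_mult_mat[of _ d d _ d _ d])
    also have "\<dots> = Q * ((P * \<rho> g) * Q)" using P(2)[OF g] by simp
    also have "\<dots> = ((Q * P) * \<rho> g) * Q" using Q(1) c Pc by (simp add: assoc_mult_mat[of _ d d _ d _ d])
    also have "\<dots> = \<rho> g * Q" using Q c by simp
    finally show "Q * \<sigma> g = \<rho> g * Q" .
  qed
qed

lemma rep_iso_trans:
  assumes "representation G \<rho>" "representation G \<sigma>" "representation G \<tau>"
    "rep_iso G \<rho> \<sigma>" "rep_iso G \<sigma> \<tau>"
  shows "rep_iso G \<rho> \<tau>"
proof -
  define d where "d = rep_dim G \<rho>"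
  have d: "rep_dim G \<rho> = d" "rep_dim G \<sigma> = d" "rep_dim G \<tau> = d"
    using rep_iso_dim[OF assms(4)] rep_iso_dim[OF assms(5)] d_def by auto
  obtain P where P: "P \<in> carrier (GL d)" "\<And>g. g \<in> carrier G \<Longrightarrow> P * \<rho> g = \<sigma> g * P"
    using assms(4) unfolding rep_iso_def d by auto
  obtain Q where Q: "Q \<in> carrier (GL d)" "\<And>g. g \<in> carrier G \<Longrightarrow> Q * \<sigma> g = \<tau> g * Q"
    using assms(5) unfolding rep_iso_def d by auto
  have c: "P \<in> carrier_mat d d" "Q \<in> carrier_mat d d" using P Q by (auto simp: GL_iff)
  show ?thesis
  proof (rule rep_isoI[OF d(1,3)])
    show "Q * P \<in> carrier (GL d)" using P Q by (intro GL_mult)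
    fix g assume g: "g \<in> carrier G"
    note rc = representationD(2)[OF assms(1) g, unfolded d] representationD(2)[OF assms(2) g, unfolded d]
      representationD(2)[OF assms(3) g, unfolded d]
    show "Q * P * \<rho> g = \<tau> g * (Q * P)"
      by (simp only: assoc_mult_mat[OF c(2,1) rc(1)] P(2)[OF g] Q(2)[OF g]
          assoc_mult_mat[OF c(2) rc(2) c(1), symmetric] assoc_mult_mat[OF rc(3) c(2,1)])
  qed
qed

lemma rep_iso_character:
  assumes "representation G \<rho>" "representation G \<sigma>" "rep_iso G \<rho> \<sigma>" "g \<in> carrier G"
  shows "character \<rho> g = character \<sigma> g"
proof -
  define d where "d = rep_dim G \<rho>"
  have d: "rep_dim G \<rho> = d" "rep_dim G \<sigma> = d" using rep_iso_dim[OF assms(3)] d_def by auto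
  obtain P where P: "P \<in> carrier (GL d)" "P * \<rho> g = \<sigma> g * P"
    using assms(3,4) unfolding rep_iso_def d by auto
  obtain Q where Q: "Q \<in> carrier_mat d d" "P * Q = 1\<^sub>m d" "Q * P = 1\<^sub>m d"
    using P(1) unfolding GL_iff by auto
  have Pc: "P \<in> carrier_mat d d" using P(1) by (simp add: GL_iff)
  note c = representationD(2)[OF assms(1,4), unfolded d] representationD(2)[OF assms(2,4), unfolded d]
  have "mat_trace (\<rho> g) = mat_trace (Q * P * \<rho> g)" using Q c by simp
  also have "Q * P * \<rho> g = Q * (\<sigma> g * P)" using P Q(1) Pc c by (simp add: assoc_mult_mat[of _ d d _ d _ d])
  also have "mat_trace \<dots> = mat_trace (\<sigma> g * P * Q)"
    using Q(1) Pc c by (intro mat_trace_commute) auto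
  also have "\<sigma> g * P * Q = \<sigma> g" using Q Pc c by (simp add: assoc_mult_mat[of _ d d _ d _ d])
  finally show ?thesis by (simp add: character_eq_trace)
qed

lemma character_one: "representation G \<rho> \<Longrightarrow> character \<rho> \<one> = of_nat (rep_dim G \<rho>)"
  by (simp add: character_eq_trace representationD(4))

end

section \<open>Subspaces and adapted bases\<close>

definition lin_subspace :: "nat \<Rightarrow> 'a::field vec set \<Rightarrow> bool" where
  "lin_subspace d W \<longleftrightarrow> W \<subseteq> carrier_vec d \<and> 0\<^sub>v d \<in> W \<and>
     (\<forall>v\<in>W. \<forall>w\<in>W. v + w \<in> W) \<and> (\<forall>c. \<forall>v\<in>W. c \<cdot>\<^sub>v v \<in> W)"

lemma subspace_iff_lin_subspace:
  "VectorSpace.subspace class_ring W (module_vec TYPE('a::field) d) \<longleftrightarrow> lin_subspace d W"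
proof -
  interpret vec_space "TYPE('a)" d .
  show ?thesis
    using vectorspace_axioms module_axioms
    unfolding VectorSpace.subspace_def submodule_def lin_subspace_def
    by (auto simp: module_vec_simps class_ring_simps)
qed

text \<open>A combination of columns from \<open>W\<close>. The remaining columns of \<open>Q\<close> are arbitrary but have coefficient
  0, so that \<open>Q\<close> can be a full basis of which only the first \<open>r\<close> vectors lie in \<open>W\<close>.\<close>

lemma lin_subspace_mult_vec:
  assumes W: "lin_subspace d W" and Q: "Q \<in> carrier_mat d m"
    and col: "\<And>j. j < r \<Longrightarrow> col Q j \<in> W" and r: "r \<le> m"
    and c: "c \<in> carrier_vec m" "\<And>i. r \<le> i \<Longrightarrow> i < m \<Longrightarrow> c $ i = 0"
  shows "Q *\<^sub>v c \<in> W"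
  using col r c
proof (induction r arbitrary: c)
  case 0
  then have "c = 0\<^sub>v m" by (intro eq_vecI) auto
  moreover have "Q *\<^sub>v 0\<^sub>v m = 0\<^sub>v d" using Q by (intro eq_vecI) auto
  ultimately show ?case using W by (simp add: lin_subspace_def)
next
  case (Suc r)
  define c' where "c' = vec m (\<lambda>i. if i = r then 0 else c $ i)"
  have "c = c' + c $ r \<cdot>\<^sub>v unit_vec m r"
    using Suc.prems by (intro eq_vecI) (auto simp: c'_def)
  then have "Q *\<^sub>v c = Q *\<^sub>v (c' + c $ r \<cdot>\<^sub>v unit_vec m r)" by simp
  also have "\<dots> = Q *\<^sub>v c' + Q *\<^sub>v (c $ r \<cdot>\<^sub>v unit_vec m r)"
    using Q by (intro mult_add_distrib_mat_vec[of _ d m]) (auto simp: c'_def)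
  also have "Q *\<^sub>v (c $ r \<cdot>\<^sub>v unit_vec m r) = c $ r \<cdot>\<^sub>v col Q r"
    using Q Suc.prems by (intro eq_vecI) auto
  finally have "Q *\<^sub>v c = Q *\<^sub>v c' + c $ r \<cdot>\<^sub>v col Q r" .
  moreover have "Q *\<^sub>v c' \<in> W"
  proof (rule Suc.IH)
    show "c' $ i = 0" if "r \<le> i" "i < m" for i
      using that Suc.prems(4)[of i] by (cases "i = r") (auto simp: c'_def)
  qed (use Suc.prems in \<open>auto simp: c'_def\<close>)
  ultimately show ?case using W Suc.prems(1)[of r] by (auto simp: lin_subspace_def)
qed

text \<open>The exchange step for bases: \<open>Q\<close> is multiplied by the identity matrix with column \<open>r\<close> replaced by
  \<open>c\<close> and column \<open>i\<close> by the unit vector \<open>e\<^sub>r\<close>, and this matrix has a trivial kernel because \<open>c $ i \<noteq>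
  0\<close>.\<close>

lemma GL_replace_column:
  fixes Q :: "'a::field mat"
  assumes Q: "Q \<in> carrier (GL d)" and c: "c \<in> carrier_vec d" and i: "r \<le> i" "i < d" "c $ i \<noteq> 0"
  obtains Q' where "Q' \<in> carrier (GL d)" "\<And>j. j < r \<Longrightarrow> col Q' j = col Q j" "col Q' r = Q *\<^sub>v c"
proof -
  define E where "E = mat_of_cols d (map (\<lambda>j. if j = r then c else if j = i then unit_vec d r else unit_vec d j) [0..<d])"
  have E: "E \<in> carrier_mat d d" by (auto simp: E_def)
  have colE: "col E j = (if j = r then c else if j = i then unit_vec d r else unit_vec d j)" if "j < d" for j
    using that c i by (auto simp: E_def)
  have entry: "E $$ (k, j) = (if j = r then c $ k else if j = i then (if k = r then 1 else 0) else if k = j then 1 else 0)"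
    if "k < d" "j < d" for k j
  proof -
    have "E $$ (k, j) = col E j $ k" using that E by simp
    then show ?thesis using that c i by (simp add: colE)
  qed
  have "E \<in> carrier (GL d)"
    unfolding GL_iff_kernel[OF E]
  proof (intro ballI impI)
    fix x assume x: "x \<in> carrier_vec d" and Ex: "E *\<^sub>v x = 0\<^sub>v d"
    have Exk: "(\<Sum>j<d. E $$ (k, j) * x $ j) = 0" if "k < d" for k
    proof -
      have "(E *\<^sub>v x) $ k = (\<Sum>j<d. E $$ (k, j) * x $ j)"
        using that E x by (simp add: scalar_prod_def lessThan_atLeast0)
      then show ?thesis using Ex that by simp
    qed
    have rd: "r < d" using i by simp
    have "(\<Sum>j<d. E $$ (i, j) * x $ j) = (\<Sum>j<d. if j = r then c $ i * x $ r else 0)"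
      using i by (intro sum.cong) (auto simp: entry)
    then have xr: "x $ r = 0" using Exk[OF i(2)] i rd by simp
    have xk: "x $ k = 0" if k: "k < d" "k \<noteq> r" "k \<noteq> i" for k
    proof -
      have "(\<Sum>j<d. E $$ (k, j) * x $ j) = (\<Sum>j<d. if j = k then x $ k else 0)"
        using k i xr by (intro sum.cong) (auto simp: entry)
      then show ?thesis using Exk[OF k(1)] k by simp
    qed
    have xi: "x $ i = 0"
    proof (cases "i = r")
      case False
      have "(\<Sum>j<d. E $$ (r, j) * x $ j) = (\<Sum>j<d. if j = i then x $ i else 0)"
        using xk xr False rd by (intro sum.cong) (auto simp: entry)
      then show ?thesis using Exk[OF rd] i by simp
    qed (use xr in simp)
    show "x = 0\<^sub>v d" using x xr xk xi by (intro eq_vecI) auto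
  qed
  with Q have "Q * E \<in> carrier (GL d)" by (rule GL_mult)
  moreover have Qc: "Q \<in> carrier_mat d d" using Q by (simp add: GL_iff)
  have colQE: "col (Q * E) j = Q *\<^sub>v col E j" if "j < d" for j
    by (rule col_mult2[OF Qc E that])
  have "col (Q * E) j = col Q j" if "j < r" for j
  proof -
    have "col (Q * E) j = Q *\<^sub>v unit_vec d j" using that i by (simp add: colQE colE)
    also have "\<dots> = col Q j" using Qc that i by (intro eq_vecI) auto
    finally show ?thesis .
  qed
  moreover have "col (Q * E) r = Q *\<^sub>v c" using i by (simp add: colQE colE)
  ultimately show thesis using that by blast
qed

text \<open>Extension of a basis of \<open>W\<close> to a basis of the whole space, in matrix form. The number \<open>r\<close> of
  columns in \<open>W\<close> is taken maximal. Then every vector of \<open>W\<close> is a combination of these columns, as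
  otherwise it could be exchanged for a further column.\<close>

lemma adapted_basis:
  fixes W :: "'a::field vec set"
  assumes W: "lin_subspace d W"
  obtains Q r where "Q \<in> carrier (GL d)" "r \<le> d" "\<And>j. j < r \<Longrightarrow> col Q j \<in> W"
    "\<And>w. w \<in> W \<Longrightarrow> \<exists>c\<in>carrier_vec d. w = Q *\<^sub>v c \<and> (\<forall>i. r \<le> i \<longrightarrow> i < d \<longrightarrow> c $ i = 0)"
proof -
  define R where "R = {r. r \<le> d \<and> (\<exists>Q\<in>carrier (GL d). \<forall>j<r. col Q j \<in> W)}"
  have "1\<^sub>m d \<in> carrier (GL d :: 'a mat monoid)" by (simp add: GL_iff_det)
  then have "0 \<in> R" unfolding R_def by auto
  moreover have "finite R" by (rule finite_subset[of _ "{..d}"]) (auto simp: R_def)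
  ultimately have Max: "Max R \<in> R" "\<And>r. r \<in> R \<Longrightarrow> r \<le> Max R" by (auto intro!: Max_in)
  define r where "r = Max R"
  from Max(1) obtain Q where Q: "Q \<in> carrier (GL d)" "r \<le> d" "\<And>j. j < r \<Longrightarrow> col Q j \<in> W"
    unfolding R_def r_def by blast
  have "\<exists>c\<in>carrier_vec d. w = Q *\<^sub>v c \<and> (\<forall>i. r \<le> i \<longrightarrow> i < d \<longrightarrow> c $ i = 0)" if w: "w \<in> W" for w
  proof -
    from Q(1) obtain Q' where Q': "Q \<in> carrier_mat d d" "Q' \<in> carrier_mat d d" "Q * Q' = 1\<^sub>m d"
      by (auto simp: GL_iff)
    have wc: "w \<in> carrier_vec d" using W w by (auto simp: lin_subspace_def)
    define c where "c = Q' *\<^sub>v w"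
    have c: "c \<in> carrier_vec d" "Q *\<^sub>v c = w"
      using Q' wc by (auto simp: c_def assoc_mult_mat_vec[symmetric, of Q d d Q' d w])
    have "c $ i = 0" if i: "r \<le> i" "i < d" for i
    proof (rule ccontr)
      assume "c $ i \<noteq> 0"
      from GL_replace_column[OF Q(1) c(1) i this] obtain Q2 where
        Q2: "Q2 \<in> carrier (GL d)" "\<And>j. j < r \<Longrightarrow> col Q2 j = col Q j" "col Q2 r = Q *\<^sub>v c"
        by metis
      have "col Q2 j \<in> W" if "j < Suc r" for j
        using that Q2(2,3) Q(3) c(2) w by (cases "j = r") auto
      with Q2(1) i have "Suc r \<in> R" unfolding R_def by auto
      with Max(2) show False unfolding r_def by fastforce
    qed
    with c show ?thesis by (intro bexI[of _ c]) auto
  qed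
  with Q show thesis using that by blast
qed

context group begin

lemma irreducible_rep_iff:
  "irreducible_rep G \<rho> \<longleftrightarrow> representation G \<rho> \<and> rep_dim G \<rho> > 0 \<and>
     (\<forall>W. lin_subspace (rep_dim G \<rho>) W \<longrightarrow> (\<forall>g \<in> carrier G. \<forall>w \<in> W. \<rho> g *\<^sub>v w \<in> W) \<longrightarrow>
          W = {0\<^sub>v (rep_dim G \<rho>)} \<or> W = carrier_vec (rep_dim G \<rho>))"
  unfolding irreducible_rep_def subspace_iff_lin_subspace by blast

end

section \<open>Direct sums of representations\<close>

text \<open>The binary direct sum, by which the block diagonal matrices of lists are treated recursively.\<close>

definition dsum :: "'g rep \<Rightarrow> 'g rep \<Rightarrow> 'g rep" where
  "dsum \<sigma> \<tau> = (\<lambda>g. four_block_mat (\<sigma> g) (0\<^sub>m (dim_row (\<sigma> g)) (dim_col (\<tau> g)))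
     (0\<^sub>m (dim_row (\<tau> g)) (dim_col (\<sigma> g))) (\<tau> g))"

lemma direct_sum_rep_Nil: "direct_sum_rep [] = (\<lambda>g. 0\<^sub>m 0 0)"
  by (simp add: direct_sum_rep_def)

lemma direct_sum_rep_Cons: "direct_sum_rep (\<sigma> # \<sigma>s) = dsum \<sigma> (direct_sum_rep \<sigma>s)"
  by (simp add: direct_sum_rep_def dsum_def Let_def)

lemma direct_sum_rep_append:
  "direct_sum_rep (\<sigma>s @ \<tau>s) = dsum (direct_sum_rep \<sigma>s) (direct_sum_rep \<tau>s)"
  by (simp add: direct_sum_rep_def dsum_def diag_block_mat_append Let_def)

lemma direct_sum_rep_singleton: "direct_sum_rep [\<sigma>] = \<sigma>"
  by (simp only: direct_sum_rep_def list.map diag_block_mat_singleton)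

context group begin

lemma dsum_eq:
  assumes "representation G \<sigma>" "representation G \<tau>" "g \<in> carrier G"
  shows "dsum \<sigma> \<tau> g = four_block_mat (\<sigma> g) (0\<^sub>m (rep_dim G \<sigma>) (rep_dim G \<tau>))
     (0\<^sub>m (rep_dim G \<tau>) (rep_dim G \<sigma>)) (\<tau> g)"
  by (simp only: dsum_def carrier_matD[OF representationD(2)[OF assms(1,3)]]
      carrier_matD[OF representationD(2)[OF assms(2,3)]])

lemma representation_dsum:
  assumes "representation G \<sigma>" "representation G \<tau>"
  shows "representation G (dsum \<sigma> \<tau>)" "rep_dim G (dsum \<sigma> \<tau>) = rep_dim G \<sigma> + rep_dim G \<tau>"
proof -
  let ?a = "rep_dim G \<sigma>" and ?b = "rep_dim G \<tau>"
  note s = representationD[OF assms(1)] and t = representationD[OF assms(2)]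
  have 1: "dsum \<sigma> \<tau> g \<in> carrier_mat (?a + ?b) (?a + ?b)" if "g \<in> carrier G" for g
    using s(2)[OF that] t(2)[OF that] by (simp add: dsum_eq[OF assms that])
  have 2: "dsum \<sigma> \<tau> (g \<otimes> h) = dsum \<sigma> \<tau> g * dsum \<sigma> \<tau> h" if "g \<in> carrier G" "h \<in> carrier G" for g h
    using s(2)[OF that(1)] t(2)[OF that(1)] s(2)[OF that(2)] t(2)[OF that(2)] that s(3) t(3)
    by (simp add: dsum_eq[OF assms] mult_four_block_mat[of _ ?a ?a _ ?b _ ?b _ _ ?a _ ?b])
  have 3: "dsum \<sigma> \<tau> \<one> = 1\<^sub>m (?a + ?b)"
    by (simp add: dsum_eq[OF assms] s(4) t(4))
  show "representation G (dsum \<sigma> \<tau>)" "rep_dim G (dsum \<sigma> \<tau>) = ?a + ?b"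
    by (rule representationI; use 1 2 3 in blast)+
qed

lemma character_dsum:
  assumes "representation G \<sigma>" "representation G \<tau>" "g \<in> carrier G"
  shows "character (dsum \<sigma> \<tau>) g = character \<sigma> g + character \<tau> g"
proof -
  let ?a = "rep_dim G \<sigma>" and ?b = "rep_dim G \<tau>"
  have s: "dim_row (\<sigma> g) = ?a" "dim_col (\<sigma> g) = ?a" and t: "dim_row (\<tau> g) = ?b" "dim_col (\<tau> g) = ?b"
    using representationD(2)[OF assms(1,3)] representationD(2)[OF assms(2,3)] by auto
  have "character (dsum \<sigma> \<tau>) g = (\<Sum>i<?a + ?b. if i < ?a then \<sigma> g $$ (i, i) else \<tau> g $$ (i - ?a, i - ?a))"
    unfolding character_def dsum_eq[OF assms] by (intro sum.cong) (auto simp: s t)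
  also have "\<dots> = (\<Sum>i<?a. \<sigma> g $$ (i, i)) + (\<Sum>i<?b. \<tau> g $$ (i, i))"
    by (simp add: lessThan_atLeast0 sum.atLeastLessThan_concat[of 0 ?a "?a + ?b", symmetric]
        sum.shift_bounds_nat_ivl[of _ 0 ?a ?b, simplified, symmetric] add.commute[of ?b])
      (subst add.commute, subst sum.shift_bounds_nat_ivl[of _ 0 ?a ?b, simplified], simp)
  finally show ?thesis by (simp add: character_def s t)
qed

lemma dsum_iso_cong:
  assumes r: "representation G \<sigma>" "representation G \<tau>" "representation G \<sigma>'" "representation G \<tau>'"
    and "rep_iso G \<sigma> \<sigma>'" "rep_iso G \<tau> \<tau>'"
  shows "rep_iso G (dsum \<sigma> \<tau>) (dsum \<sigma>' \<tau>')"
proof -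
  define a b where ab: "a = rep_dim G \<sigma>" "b = rep_dim G \<tau>"
  have d: "rep_dim G \<sigma>' = a" "rep_dim G \<tau>' = b"
    using rep_iso_dim assms(5,6) ab by auto
  from assms(5,6) obtain P Q where P: "P \<in> carrier (GL a)" "\<And>g. g \<in> carrier G \<Longrightarrow> P * \<sigma> g = \<sigma>' g * P"
    and Q: "Q \<in> carrier (GL b)" "\<And>g. g \<in> carrier G \<Longrightarrow> Q * \<tau> g = \<tau>' g * Q"
    unfolding rep_iso_def ab by auto
  obtain P' Q' where P': "P \<in> carrier_mat a a" "P' \<in> carrier_mat a a" "P * P' = 1\<^sub>m a" "P' * P = 1\<^sub>m a"
    and Q': "Q \<in> carrier_mat b b" "Q' \<in> carrier_mat b b" "Q * Q' = 1\<^sub>m b" "Q' * Q = 1\<^sub>m b"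
    using P(1) Q(1) unfolding GL_iff by auto
  let ?D = "\<lambda>S Y. four_block_mat S (0\<^sub>m a b) (0\<^sub>m b a) Y"
  have D: "?D S Y * ?D X' Y' = ?D (S * X') (Y * Y')"
    if "S \<in> carrier_mat a a" "X' \<in> carrier_mat a a" "Y \<in> carrier_mat b b" "Y' \<in> carrier_mat b b" for S X' Y Y' :: "complex mat"
    using that by (simp add: mult_four_block_mat[of _ a a _ b _ b _ _ a _ b])
  show ?thesis
  proof (rule rep_isoI)
    show "rep_dim G (dsum \<sigma> \<tau>) = a + b" "rep_dim G (dsum \<sigma>' \<tau>') = a + b"
      using representation_dsum r d ab by auto
    show "?D P Q \<in> carrier (GL (a + b))"
      unfolding GL_iff using P' Q' by (intro conjI bexI[of _ "?D P' Q'"]) (auto simp: D)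
    fix g assume g: "g \<in> carrier G"
    note c = representationD(2)[OF r(1) g] representationD(2)[OF r(2) g] representationD(2)[OF r(3) g] representationD(2)[OF r(4) g]
    show "?D P Q * dsum \<sigma> \<tau> g = dsum \<sigma>' \<tau>' g * ?D P Q"
      using P' Q' c P(2)[OF g] Q(2)[OF g] by (simp add: dsum_eq r g d ab[symmetric] D)
  qed
qed

lemma representation_direct_sum:
  assumes "\<And>\<sigma>. \<sigma> \<in> set \<sigma>s \<Longrightarrow> representation G \<sigma>"
  shows "representation G (direct_sum_rep \<sigma>s)"
  using assms
proof (induction \<sigma>s)
  case Nil
  show ?case unfolding direct_sum_rep_Nil by (rule representationI(1)[of _ 0]) auto
next
  case (Cons \<sigma> \<sigma>s)
  then show ?case by (simp add: direct_sum_rep_Cons representation_dsum)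
qed

lemma character_direct_sum:
  assumes "\<And>\<sigma>. \<sigma> \<in> set \<sigma>s \<Longrightarrow> representation G \<sigma>" "g \<in> carrier G"
  shows "character (direct_sum_rep \<sigma>s) g = (\<Sum>\<sigma>\<leftarrow>\<sigma>s. character \<sigma> g)"
  using assms
proof (induction \<sigma>s)
  case Nil
  show ?case unfolding direct_sum_rep_Nil by (simp add: character_def)
next
  case (Cons \<sigma> \<sigma>s)
  then show ?case by (simp add: direct_sum_rep_Cons character_dsum representation_direct_sum)
qed

end

section \<open>Complete reducibility\<close>

lemma index_mult_unit_vec:
  "A \<in> carrier_mat m n \<Longrightarrow> i < m \<Longrightarrow> j < n \<Longrightarrow> (A *\<^sub>v unit_vec n j) $ i = (A :: 'a::comm_ring_1 mat) $$ (i, j)"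
  by simp

lemma matrix_sum_add:
  assumes "\<And>x. x \<in> S \<Longrightarrow> f x \<in> carrier_mat m n" "\<And>x. x \<in> S \<Longrightarrow> h x \<in> carrier_mat m n"
  shows "matrix_sum m n (\<lambda>x. f x + h x) S = matrix_sum m n f S + matrix_sum m n h S"
proof (rule eq_matI)
  fix i j assume "i < dim_row (matrix_sum m n f S + matrix_sum m n h S)"
    "j < dim_col (matrix_sum m n f S + matrix_sum m n h S)"
  then have ij: "i < m" "j < n" by auto
  have "(\<Sum>x\<in>S. (f x + h x) $$ (i, j)) = (\<Sum>x\<in>S. f x $$ (i, j) + h x $$ (i, j))"
  proof (rule sum.cong[OF refl])
    fix x assume "x \<in> S"
    then show "(f x + h x) $$ (i, j) = f x $$ (i, j) + h x $$ (i, j)"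
      using assms(2)[of x] ij by simp
  qed
  then show "matrix_sum m n (\<lambda>x. f x + h x) S $$ (i, j) = (matrix_sum m n f S + matrix_sum m n h S) $$ (i, j)"
    using ij by (simp add: sum.distrib)
qed auto

lemma matrix_sum_const:
  "A \<in> carrier_mat m n \<Longrightarrow> matrix_sum m n (\<lambda>x. A) S = of_nat (card S) \<cdot>\<^sub>m A"
  by (rule eq_matI) auto

lemma four_block_mat_inject:
  assumes "A \<in> carrier_mat m1 n1" "B \<in> carrier_mat m1 n2" "C \<in> carrier_mat m2 n1" "D \<in> carrier_mat m2 n2"
    "A' \<in> carrier_mat m1 n1" "B' \<in> carrier_mat m1 n2" "C' \<in> carrier_mat m2 n1" "D' \<in> carrier_mat m2 n2"
    and eq: "four_block_mat A B C D = four_block_mat A' B' C' D'"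
  shows "A = A'" "B = B'" "D = D'"
proof -
  have e: "four_block_mat A B C D $$ (i, j) = four_block_mat A' B' C' D' $$ (i, j)" for i j
    using eq by simp
  show "A = A'"
  proof (rule eq_matI)
    fix i j assume "i < dim_row A'" "j < dim_col A'"
    then show "A $$ (i, j) = A' $$ (i, j)" using e[of i j] assms(1-8) by auto
  qed (use assms(1-8) in auto)
  show "B = B'"
  proof (rule eq_matI)
    fix i j assume "i < dim_row B'" "j < dim_col B'"
    then show "B $$ (i, j) = B' $$ (i, j)" using e[of i "j + n1"] assms(1-8) by auto
  qed (use assms(1-8) in auto)
  show "D = D'"
  proof (rule eq_matI)
    fix i j assume "i < dim_row D'" "j < dim_col D'"
    then show "D $$ (i, j) = D' $$ (i, j)" using e[of "i + m1" "j + n1"] assms(1-8) by auto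
  qed (use assms(1-8) in auto)
qed

locale finite_group = group G for G (structure) +
  assumes finite_carrier: "finite (carrier G)"
begin

lemma card_carrier_pos: "card (carrier G) > 0"
  using finite_carrier one_closed by (metis card_gt_0_iff empty_iff)

text \<open>In a basis adapted to an invariant subspace the representation is block upper triangular, with
  diagonal blocks \<open>a(g)\<close>, \<open>c(g)\<close> and corner \<open>b(g)\<close>. It is conjugate to the direct sum of \<open>a\<close> and \<open>c\<close>
  by a unitriangular block matrix with corner \<open>S\<close> as soon as \<open>S c(g) = a(g) S + b(g)\<close> for all \<open>g\<close>.
  The average of \<open>b(h) c(h\<^sup>-\<^sup>1)\<close> over the group is such an \<open>S\<close>. This replaces an invariant inner
  product or an invariant projection.\<close>

lemma reducible_splits:
  assumes rho: "representation G \<rho>" and pos: "rep_dim G \<rho> > 0" and red: "\<not> irreducible_rep G \<rho>"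
  obtains \<sigma> \<tau> where "representation G \<sigma>" "representation G \<tau>"
    "rep_dim G \<sigma> < rep_dim G \<rho>" "rep_dim G \<tau> < rep_dim G \<rho>" "rep_iso G (dsum \<sigma> \<tau>) \<rho>"
proof -
  define d where "d = rep_dim G \<rho>"
  note rd = representationD[OF rho, folded d_def]
  obtain W where W: "lin_subspace d W" "\<And>g w. g \<in> carrier G \<Longrightarrow> w \<in> W \<Longrightarrow> \<rho> g *\<^sub>v w \<in> W"
    "W \<noteq> {0\<^sub>v d}" "W \<noteq> carrier_vec d"
    using red rho pos unfolding irreducible_rep_iff d_def by blast
  obtain Q r where Q: "Q \<in> carrier (GL d)" "r \<le> d" "\<And>j. j < r \<Longrightarrow> col Q j \<in> W"
    "\<And>w. w \<in> W \<Longrightarrow> \<exists>c\<in>carrier_vec d. w = Q *\<^sub>v c \<and> (\<forall>i. r \<le> i \<longrightarrow> i < d \<longrightarrow> c $ i = 0)"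
    using adapted_basis[OF W(1)] by metis
  obtain Q' where Q': "Q \<in> carrier_mat d d" "Q' \<in> carrier_mat d d" "Q * Q' = 1\<^sub>m d" "Q' * Q = 1\<^sub>m d"
    using Q(1) by (auto simp: GL_iff)
  have "r \<noteq> d"
  proof
    assume "r = d"
    have "v \<in> W" if v: "v \<in> carrier_vec d" for v
    proof -
      have "Q *\<^sub>v (Q' *\<^sub>v v) \<in> W"
        by (rule lin_subspace_mult_vec[OF W(1) Q'(1) Q(3)]) (use \<open>r = d\<close> v Q' in auto)
      then show ?thesis using Q' v by (simp add: assoc_mult_mat_vec[symmetric, of Q d d Q' d v])
    qed
    then show False using W(1,4) by (auto simp: lin_subspace_def)
  qed
  moreover have "r \<noteq> 0"
  proof
    assume "r = 0"
    have "w = 0\<^sub>v d" if "w \<in> W" for w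
    proof -
      from Q(4)[OF that] obtain c where c: "c \<in> carrier_vec d" "w = Q *\<^sub>v c" "\<And>i. i < d \<Longrightarrow> c $ i = 0"
        using \<open>r = 0\<close> by auto
      then have "c = 0\<^sub>v d" by (intro eq_vecI) auto
      with c(2) Q'(1) show ?thesis by (intro eq_vecI) auto
    qed
    then show False using W(1,3) by (auto simp: lin_subspace_def)
  qed
  ultimately have r: "0 < r" "r < d" using Q(2) by auto
  define s where "s = d - r"
  have ds: "d = r + s" "0 < s" using r by (auto simp: s_def)
  \<comment> \<open>In the basis \<open>Q\<close> the first \<open>r\<close> coordinates belong to the invariant subspace.\<close>
  define R where "R g = Q' * (\<rho> g * Q)" for g
  have Rc: "R g \<in> carrier_mat d d" if "g \<in> carrier G" for g
    using that Q' rd(2) unfolding R_def by (intro mult_carrier_mat) auto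
  have QR: "Q * R g = \<rho> g * Q" if "g \<in> carrier G" for g
  proof -
    have "\<rho> g * Q \<in> carrier_mat d d" using rd(2)[OF that] Q' by (intro mult_carrier_mat) auto
    then show ?thesis
      by (simp only: R_def assoc_mult_mat[OF Q'(1,2), symmetric] Q'(3) left_mult_one_mat)
  qed
  have R_mult: "R (g \<otimes> h) = R g * R h" if g: "g \<in> carrier G" and h: "h \<in> carrier G" for g h
  proof -
    note c = rd(2)[OF g] rd(2)[OF h]
    have "R g * R h = Q' * (\<rho> g * Q * R h)"
      unfolding R_def[of g] using Q' c Rc[OF h] by (intro assoc_mult_mat[of _ d d _ d _ d]) auto
    also have "\<rho> g * Q * R h = \<rho> g * (Q * R h)"
      using Q' c Rc[OF h] by (intro assoc_mult_mat[of _ d d _ d _ d]) auto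
    also have "\<dots> = \<rho> g * \<rho> h * Q"
      unfolding QR[OF h] using Q' c by (intro assoc_mult_mat[of _ d d _ d _ d, symmetric]) auto
    finally show ?thesis by (simp add: R_def rd(3)[OF g h])
  qed
  have R_one: "R \<one> = 1\<^sub>m d" using Q' by (simp add: R_def rd(4))
  have R0: "R g $$ (i, j) = 0" if g: "g \<in> carrier G" and ij: "r \<le> i" "i < d" "j < r" for g i j
  proof -
    have jd: "j < d" using ij r by simp
    have "\<rho> g *\<^sub>v col Q j \<in> W" using W(2)[OF g Q(3)[OF ij(3)]] .
    then obtain c where c: "c \<in> carrier_vec d" "\<rho> g *\<^sub>v col Q j = Q *\<^sub>v c" "c $ i = 0"
      using Q(4) ij by blast
    have rQ: "\<rho> g * Q \<in> carrier_mat d d" using rd(2)[OF g] Q' by (intro mult_carrier_mat) auto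
    have "col (R g) j = Q' *\<^sub>v (\<rho> g *\<^sub>v col Q j)"
      unfolding R_def by (simp only: col_mult2[OF Q'(2) rQ jd] col_mult2[OF rd(2)[OF g] Q'(1) jd])
    also have "\<dots> = c" using c Q' by (simp add: assoc_mult_mat_vec[symmetric, of Q' d d Q d c])
    finally have "col (R g) j $ i = 0" using c(3) by simp
    then show ?thesis using Rc[OF g] ij jd by simp
  qed
  define a where "a g = mat r r (\<lambda>(i, j). R g $$ (i, j))" for g
  define b where "b g = mat r s (\<lambda>(i, j). R g $$ (i, j + r))" for g
  define c where "c g = mat s s (\<lambda>(i, j). R g $$ (i + r, j + r))" for g
  have abc: "a g \<in> carrier_mat r r" "b g \<in> carrier_mat r s" "c g \<in> carrier_mat s s" for g
    by (auto simp: a_def b_def c_def)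
  have R_eq: "R g = four_block_mat (a g) (b g) (0\<^sub>m s r) (c g)" if g: "g \<in> carrier G" for g
    by (rule eq_matI) (use Rc[OF g] R0[OF g] ds in \<open>auto simp: a_def b_def c_def\<close>)
  have mult: "a (g \<otimes> h) = a g * a h" "b (g \<otimes> h) = a g * b h + b g * c h" "c (g \<otimes> h) = c g * c h"
    if g: "g \<in> carrier G" and h: "h \<in> carrier G" for g h
  proof -
    have "four_block_mat (a (g \<otimes> h)) (b (g \<otimes> h)) (0\<^sub>m s r) (c (g \<otimes> h)) =
      four_block_mat (a g) (b g) (0\<^sub>m s r) (c g) * four_block_mat (a h) (b h) (0\<^sub>m s r) (c h)"
      using R_mult[OF g h] R_eq g h by simp
    also have "\<dots> = four_block_mat (a g * a h + b g * 0\<^sub>m s r) (a g * b h + b g * c h)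
        (0\<^sub>m s r * a h + c g * 0\<^sub>m s r) (0\<^sub>m s r * b h + c g * c h)"
      by (rule mult_four_block_mat[OF abc(1,2) zero_carrier_mat abc(3) abc(1,2) zero_carrier_mat abc(3)])
    also have "\<dots> = four_block_mat (a g * a h) (a g * b h + b g * c h) (0\<^sub>m s r) (c g * c h)"
      using abc[of g] abc[of h] by simp
    finally have eq: "four_block_mat (a (g \<otimes> h)) (b (g \<otimes> h)) (0\<^sub>m s r) (c (g \<otimes> h)) =
      four_block_mat (a g * a h) (a g * b h + b g * c h) (0\<^sub>m s r) (c g * c h)" .
    show "a (g \<otimes> h) = a g * a h" "b (g \<otimes> h) = a g * b h + b g * c h" "c (g \<otimes> h) = c g * c h"
      by (rule four_block_mat_inject[OF _ _ _ _ _ _ _ _ eq];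
          use abc[of g] abc[of h] abc[of "g \<otimes> h"] in auto)+
  qed
  have one: "a \<one> = 1\<^sub>m r" "c \<one> = 1\<^sub>m s"
    by (rule eq_matI; use ds in \<open>auto simp: a_def c_def R_one\<close>)+
  have rep_a: "representation G a" "rep_dim G a = r"
    by (rule representationI[of a r]; use abc mult one in auto)+
  have rep_c: "representation G c" "rep_dim G c = s"
    by (rule representationI[of c s]; use abc mult one in auto)+
  \<comment> \<open>Substituting \<open>h \<mapsto> g h\<close> in the sum and using \<open>b(g h) = a(g) b(h) + b(g) c(h)\<close> gives the equation for \<open>S\<close>, multiplied by the order of the group.\<close>
  define M where "M = matrix_sum r s (\<lambda>h. b h * c (inv h)) (carrier G)"
  define n where "n = (of_nat (card (carrier G)) :: complex)"
  have n0: "n \<noteq> 0" using card_carrier_pos by (simp add: n_def)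
  define S where "S = inverse n \<cdot>\<^sub>m M"
  have Mc: "M \<in> carrier_mat r s" and Sc: "S \<in> carrier_mat r s" by (simp_all add: M_def S_def)
  have M_eq: "M * c g = a g * M + n \<cdot>\<^sub>m b g" if g: "g \<in> carrier G" for g
  proof -
    have "M * c g = matrix_sum r s (\<lambda>h. b h * c (inv h) * c g) (carrier G)"
      unfolding M_def using abc by (intro matrix_sum_mult) (auto intro!: mult_carrier_mat)
    also have "\<dots> = matrix_sum r s (\<lambda>h. b (g \<otimes> h) * c (inv (g \<otimes> h)) * c g) (carrier G)"
      using g by (intro matrix_sum_reindex[symmetric] bij_betwI[of _ _ _ "\<lambda>h. inv g \<otimes> h"])
        (auto simp: m_assoc[symmetric])
    also have "\<dots> = matrix_sum r s (\<lambda>h. a g * (b h * c (inv h)) + b g) (carrier G)"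
    proof (rule matrix_sum_cong)
      fix h assume h: "h \<in> carrier G"
      have c_inv: "c (inv (g \<otimes> h)) * c g = c (inv h)"
        using g h mult(3)[of "inv (g \<otimes> h)" g] by (simp add: inv_mult_group m_assoc)
      have "b (g \<otimes> h) * c (inv (g \<otimes> h)) * c g = b (g \<otimes> h) * c (inv h)"
        by (simp only: assoc_mult_mat[OF abc(2) abc(3) abc(3)] c_inv)
      also have "\<dots> = (a g * b h + b g * c h) * c (inv h)"
        by (simp only: mult(2)[OF g h])
      also have "\<dots> = a g * b h * c (inv h) + b g * c h * c (inv h)"
        by (rule add_mult_distrib_mat[OF mult_carrier_mat[OF abc(1,2)] mult_carrier_mat[OF abc(2,3)] abc(3)])
      also have "b g * c h * c (inv h) = b g * (c h * c (inv h))"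
        by (rule assoc_mult_mat[OF abc(2,3,3)])
      also have "c h * c (inv h) = 1\<^sub>m s" using mult(3)[of h "inv h"] h one by simp
      also have "b g * 1\<^sub>m s = b g" by (rule right_mult_one_mat[OF abc(2)])
      also have "a g * b h * c (inv h) = a g * (b h * c (inv h))"
        by (rule assoc_mult_mat[OF abc(1,2,3)])
      finally show "b (g \<otimes> h) * c (inv (g \<otimes> h)) * c g = a g * (b h * c (inv h)) + b g" .
    qed
    also have "\<dots> = matrix_sum r s (\<lambda>h. a g * (b h * c (inv h))) (carrier G) + matrix_sum r s (\<lambda>h. b g) (carrier G)"
      using abc by (intro matrix_sum_add) (auto intro!: mult_carrier_mat)
    also have "matrix_sum r s (\<lambda>h. a g * (b h * c (inv h))) (carrier G) = a g * M"
      unfolding M_def using abc by (intro mult_matrix_sum[symmetric]) (auto intro!: mult_carrier_mat)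
    also have "matrix_sum r s (\<lambda>h. b g) (carrier G) = n \<cdot>\<^sub>m b g"
      unfolding n_def using abc by (intro matrix_sum_const)
    finally show ?thesis .
  qed
  have S_eq: "S * c g = a g * S + b g" if g: "g \<in> carrier G" for g
  proof -
    have "S * c g = inverse n \<cdot>\<^sub>m (M * c g)"
      unfolding S_def by (rule mult_smult_assoc_mat[OF Mc abc(3)])
    also have "\<dots> = inverse n \<cdot>\<^sub>m (a g * M) + inverse n \<cdot>\<^sub>m (n \<cdot>\<^sub>m b g)"
      unfolding M_eq[OF g]
      by (rule add_smult_distrib_left_mat[OF mult_carrier_mat[OF abc(1) Mc] smult_carrier_mat[OF abc(2)]])
    also have "inverse n \<cdot>\<^sub>m (n \<cdot>\<^sub>m b g) = b g" using n0 by (intro eq_matI) auto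
    also have "inverse n \<cdot>\<^sub>m (a g * M) = a g * S"
      unfolding S_def by (rule mult_smult_distrib[OF abc(1) Mc, symmetric])
    finally show ?thesis .
  qed
  define U where "U = four_block_mat (1\<^sub>m r) S (0\<^sub>m s r) (1\<^sub>m s)"
  define U' where "U' = four_block_mat (1\<^sub>m r) (- S) (0\<^sub>m s r) (1\<^sub>m s)"
  have Uc: "U \<in> carrier_mat d d" "U' \<in> carrier_mat d d" by (simp_all add: U_def U'_def ds)
  have SS: "- S + S = 0\<^sub>m r s" "S + - S = 0\<^sub>m r s"
    "- 0\<^sub>m s s = (0\<^sub>m s s :: complex mat)"
    using Sc by (auto intro!: eq_matI)
  have "U * U' = 1\<^sub>m d" "U' * U = 1\<^sub>m d"
    unfolding U_def U'_def using Sc SS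
    by (simp_all add: mult_four_block_mat[of _ r r _ s _ s _ _ r _ s] ds)
  then have U_GL: "U \<in> carrier (GL d)" using Uc unfolding GL_iff by blast
  have iso: "rep_iso G (dsum a c) \<rho>"
  proof (rule rep_isoI)
    show "rep_dim G (dsum a c) = d" using representation_dsum(2)[OF rep_a(1) rep_c(1)] rep_a rep_c ds by simp
    show "rep_dim G \<rho> = d" by (simp add: d_def)
    show "Q * U \<in> carrier (GL d)" by (intro GL_mult Q U_GL)
    fix g assume g: "g \<in> carrier G"
    have D: "dsum a c g = four_block_mat (a g) (0\<^sub>m r s) (0\<^sub>m s r) (c g)"
      by (simp add: dsum_eq[OF rep_a(1) rep_c(1) g] rep_a rep_c)
    have Dc: "dsum a c g \<in> carrier_mat d d" using abc[of g] by (simp add: D ds)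
    have "U * dsum a c g = four_block_mat (1\<^sub>m r * a g + S * 0\<^sub>m s r) (1\<^sub>m r * 0\<^sub>m r s + S * c g)
        (0\<^sub>m s r * a g + 1\<^sub>m s * 0\<^sub>m s r) (0\<^sub>m s r * 0\<^sub>m r s + 1\<^sub>m s * c g)"
      unfolding D U_def
      by (rule mult_four_block_mat[OF one_carrier_mat Sc zero_carrier_mat one_carrier_mat
            abc(1) zero_carrier_mat zero_carrier_mat abc(3)])
    also have "\<dots> = four_block_mat (a g) (a g * S + b g) (0\<^sub>m s r) (c g)"
      using abc[of g] Sc S_eq[OF g] by simp
    also have "\<dots> = four_block_mat (a g * 1\<^sub>m r + b g * 0\<^sub>m s r) (a g * S + b g * 1\<^sub>m s)
        (0\<^sub>m s r * 1\<^sub>m r + c g * 0\<^sub>m s r) (0\<^sub>m s r * S + c g * 1\<^sub>m s)"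
      using abc[of g] Sc by simp
    also have "\<dots> = R g * U"
      unfolding R_eq[OF g] U_def
      by (rule mult_four_block_mat[OF abc(1,2) zero_carrier_mat abc(3)
            one_carrier_mat Sc zero_carrier_mat one_carrier_mat, symmetric])
    finally have U_eq: "U * dsum a c g = R g * U" .
    show "Q * U * dsum a c g = \<rho> g * (Q * U)"
      by (simp only: assoc_mult_mat[OF Q'(1) Uc(1) Dc] U_eq
          assoc_mult_mat[OF Q'(1) Rc[OF g] Uc(1), symmetric] QR[OF g]
          assoc_mult_mat[OF rd(2)[OF g] Q'(1) Uc(1)])
  qed
  show thesis
    by (rule that[OF rep_a(1) rep_c(1) _ _ iso]) (use rep_a rep_c ds r in \<open>auto simp: d_def[symmetric]\<close>)
qed

lemma irreducible_repD: "irreducible_rep G \<rho> \<Longrightarrow> representation G \<rho>" "irreducible_rep G \<rho> \<Longrightarrow> rep_dim G \<rho> > 0"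
  by (auto simp: irreducible_rep_def)

text \<open>Induction on the dimension. Dimension zero is included and gives the empty list of summands.\<close>

theorem maschke:
  assumes "representation G \<rho>"
  shows "\<exists>\<sigma>s. (\<forall>\<sigma>\<in>set \<sigma>s. irreducible_rep G \<sigma>) \<and> rep_iso G \<rho> (direct_sum_rep \<sigma>s)"
  using assms
proof (induction "rep_dim G \<rho>" arbitrary: \<rho> rule: less_induct)
  case less
  consider "rep_dim G \<rho> = 0" | "irreducible_rep G \<rho>" | "rep_dim G \<rho> > 0" "\<not> irreducible_rep G \<rho>" by blast
  then show ?case
  proof cases
    case 1
    have "rep_iso G \<rho> (direct_sum_rep [])"
    proof (rule rep_isoI)
      show "rep_dim G (direct_sum_rep []) = 0" by (simp add: direct_sum_rep_Nil rep_dim_def)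
      show "1\<^sub>m 0 \<in> carrier (GL 0)" by (simp add: GL_iff_det)
      fix g assume "g \<in> carrier G"
      then have "\<rho> g \<in> carrier_mat 0 0" using representationD(2)[OF less(2)] 1 by simp
      then show "1\<^sub>m 0 * \<rho> g = direct_sum_rep [] g * 1\<^sub>m 0"
        by (intro eq_matI) (auto simp: direct_sum_rep_Nil)
    qed (use 1 in simp)
    then show ?thesis by (intro exI[of _ "[]"]) auto
  next
    case 2
    then show ?thesis
      by (intro exI[of _ "[\<rho>]"]) (auto simp: direct_sum_rep_singleton rep_iso_refl less(2))
  next
    case 3
    obtain \<sigma> \<tau> where st: "representation G \<sigma>" "representation G \<tau>"
      "rep_dim G \<sigma> < rep_dim G \<rho>" "rep_dim G \<tau> < rep_dim G \<rho>" "rep_iso G (dsum \<sigma> \<tau>) \<rho>"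
      by (rule reducible_splits[OF less(2) 3])
    obtain \<sigma>s \<tau>s where s: "\<forall>\<sigma>\<in>set \<sigma>s. irreducible_rep G \<sigma>" "rep_iso G \<sigma> (direct_sum_rep \<sigma>s)"
      and t: "\<forall>\<sigma>\<in>set \<tau>s. irreducible_rep G \<sigma>" "rep_iso G \<tau> (direct_sum_rep \<tau>s)"
      using less(1)[OF st(3,1)] less(1)[OF st(4,2)] by blast
    have r: "representation G (direct_sum_rep \<sigma>s)" "representation G (direct_sum_rep \<tau>s)"
      using s t irreducible_repD by (auto intro!: representation_direct_sum)
    have "rep_iso G \<rho> (dsum (direct_sum_rep \<sigma>s) (direct_sum_rep \<tau>s))"
      using rep_iso_trans[OF less(2) representation_dsum(1)[OF st(1,2)] representation_dsum(1)[OF r]]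
        rep_iso_sym[OF representation_dsum(1)[OF st(1,2)] less(2) st(5)]
        dsum_iso_cong[OF st(1,2) r s(2) t(2)] by blast
    then show ?thesis using s t
      by (intro exI[of _ "\<sigma>s @ \<tau>s"]) (auto simp: direct_sum_rep_append)
  qed
qed

section \<open>Schur's lemma\<close>

text \<open>Kernel and image of \<open>M\<close> are invariant, so \<open>M\<close> is injective and surjective. Preimages of the unit
  vectors give an inverse \<open>N\<close>, and comparing the traces of \<open>M N = 1\<close> and \<open>N M = 1\<close> shows that the
  two dimensions agree.\<close>

lemma schur:
  assumes rho: "irreducible_rep G \<rho>" and sigma: "irreducible_rep G \<sigma>"
    and M: "M \<in> carrier_mat (rep_dim G \<sigma>) (rep_dim G \<rho>)"
    and inter: "\<And>g. g \<in> carrier G \<Longrightarrow> M * \<rho> g = \<sigma> g * M"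
    and M0: "M \<noteq> 0\<^sub>m (rep_dim G \<sigma>) (rep_dim G \<rho>)"
  shows "rep_dim G \<rho> = rep_dim G \<sigma>" "M \<in> carrier (GL (rep_dim G \<sigma>))"
proof -
  define a b where ab: "a = rep_dim G \<rho>" "b = rep_dim G \<sigma>"
  note r = representationD[OF irreducible_repD(1)[OF rho], folded ab]
  note s = representationD[OF irreducible_repD(1)[OF sigma], folded ab]
  note M = M[folded ab] and M0 = M0[folded ab]
  have zero: "M *\<^sub>v 0\<^sub>v a = 0\<^sub>v b" using M by (intro eq_vecI) auto
  have not0: False if "\<And>v. v \<in> carrier_vec a \<Longrightarrow> M *\<^sub>v v = 0\<^sub>v b"
  proof -
    have "M $$ (i, j) = 0" if ij: "i < b" "j < a" for i j
    proof -
      have "M $$ (i, j) = (M *\<^sub>v unit_vec a j) $ i" using M ij by simp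
      then show ?thesis using that \<open>\<And>v. v \<in> carrier_vec a \<Longrightarrow> M *\<^sub>v v = 0\<^sub>v b\<close>[of "unit_vec a j"] by simp
    qed
    then have "M = 0\<^sub>m b a" using M by (intro eq_matI) auto
    with M0 show False by simp
  qed
  define K where "K = {v \<in> carrier_vec a. M *\<^sub>v v = 0\<^sub>v b}"
  have "lin_subspace a K"
    using M zero by (auto simp: lin_subspace_def K_def mult_add_distrib_mat_vec[of M b a] mult_mat_vec[of M b a])
  moreover have "\<rho> g *\<^sub>v v \<in> K" if g: "g \<in> carrier G" and v: "v \<in> K" for g v
  proof -
    have vc: "v \<in> carrier_vec a" "M *\<^sub>v v = 0\<^sub>v b" using v by (auto simp: K_def)
    have "M *\<^sub>v (\<rho> g *\<^sub>v v) = (\<sigma> g * M) *\<^sub>v v"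
      using M r(2)[OF g] vc by (simp add: inter[OF g, symmetric] assoc_mult_mat_vec[of M b a _ a])
    also have "\<dots> = \<sigma> g *\<^sub>v 0\<^sub>v b"
      using M s(2)[OF g] vc by (simp add: assoc_mult_mat_vec[of _ b b M a])
    also have "\<dots> = 0\<^sub>v b" using s(2)[OF g] by (intro eq_vecI) auto
    finally show ?thesis using r(2)[OF g] vc by (auto simp: K_def)
  qed
  ultimately have "K = {0\<^sub>v a} \<or> K = carrier_vec a"
    using rho unfolding irreducible_rep_iff ab[symmetric] by blast
  then have ker: "v = 0\<^sub>v a" if "v \<in> carrier_vec a" "M *\<^sub>v v = 0\<^sub>v b" for v
    using not0 that unfolding K_def by blast
  define I where "I = (\<lambda>v. M *\<^sub>v v) ` carrier_vec a"
  have "lin_subspace b I"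
    unfolding lin_subspace_def
  proof (intro conjI ballI allI)
    show "I \<subseteq> carrier_vec b" using M by (auto simp: I_def)
    show "0\<^sub>v b \<in> I" using zero by (auto simp: I_def intro!: image_eqI[of _ _ "0\<^sub>v a"])
    show "v + w \<in> I" if vw: "v \<in> I" "w \<in> I" for v w
    proof -
      from vw obtain x y where "v = M *\<^sub>v x" "x \<in> carrier_vec a" "w = M *\<^sub>v y" "y \<in> carrier_vec a"
        by (auto simp: I_def)
      then show ?thesis using M
        by (auto simp: I_def mult_add_distrib_mat_vec[of M b a, symmetric])
    qed
    show "c \<cdot>\<^sub>v v \<in> I" if v: "v \<in> I" for c v
    proof -
      from v obtain x where "v = M *\<^sub>v x" "x \<in> carrier_vec a" by (auto simp: I_def)
      then show ?thesis using M
        by (auto simp: I_def mult_mat_vec[of M b a, symmetric])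
    qed
  qed
  moreover have "\<sigma> g *\<^sub>v w \<in> I" if g: "g \<in> carrier G" and w: "w \<in> I" for g w
  proof -
    from w obtain x where x: "w = M *\<^sub>v x" "x \<in> carrier_vec a" by (auto simp: I_def)
    have "\<sigma> g *\<^sub>v w = (M * \<rho> g) *\<^sub>v x"
      using M s(2)[OF g] x by (simp add: inter[OF g] assoc_mult_mat_vec[of _ b b M a])
    also have "\<dots> = M *\<^sub>v (\<rho> g *\<^sub>v x)"
      using M r(2)[OF g] x by (simp add: assoc_mult_mat_vec[of M b a _ a])
    finally show ?thesis using r(2)[OF g] x by (auto simp: I_def)
  qed
  ultimately have "I = {0\<^sub>v b} \<or> I = carrier_vec b"
    using sigma unfolding irreducible_rep_iff ab[symmetric] by blast
  then have surj: "I = carrier_vec b"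
    using not0 unfolding I_def by blast
  have "\<forall>i. i < b \<longrightarrow> (\<exists>v\<in>carrier_vec a. M *\<^sub>v v = unit_vec b i)"
  proof (intro allI impI)
    fix i have "unit_vec b i \<in> I" using surj by simp
    then show "\<exists>v\<in>carrier_vec a. M *\<^sub>v v = unit_vec b i" by (auto simp: I_def)
  qed
  then obtain x where x: "\<And>i. i < b \<Longrightarrow> x i \<in> carrier_vec a" "\<And>i. i < b \<Longrightarrow> M *\<^sub>v x i = unit_vec b i"
    by metis
  define N where "N = mat_of_cols a (map x [0..<b])"
  have N: "N \<in> carrier_mat a b" by (auto simp: N_def)
  have colN: "col N i = x i" if "i < b" for i using that x by (auto simp: N_def)
  have MN: "M * N = 1\<^sub>m b"
  proof (rule eq_matI)
    fix i j assume "i < dim_row (1\<^sub>m b :: complex mat)" "j < dim_col (1\<^sub>m b :: complex mat)"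
    then have ij: "i < b" "j < b" by auto
    have "(M * N) $$ (i, j) = col (M * N) j $ i" using ij M N by simp
    also have "col (M * N) j = unit_vec b j" using col_mult2[OF M N ij(2)] x(2) colN ij by simp
    finally show "(M * N) $$ (i, j) = 1\<^sub>m b $$ (i, j)" using ij by simp
  qed (use M N in auto)
  have NM: "N * M = 1\<^sub>m a"
  proof -
    have NMc: "N * M \<in> carrier_mat a a" using N M by simp
    have "(N * M) *\<^sub>v v = v" if v: "v \<in> carrier_vec a" for v
    proof -
      have w: "(N * M) *\<^sub>v v \<in> carrier_vec a" using NMc v by simp
      have "M *\<^sub>v ((N * M) *\<^sub>v v) = (M * N) *\<^sub>v (M *\<^sub>v v)"
        using M N v by (simp add: assoc_mult_mat_vec[of N a b M a] assoc_mult_mat_vec[of M b a N b])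
      then have "M *\<^sub>v ((N * M) *\<^sub>v v - v) = 0\<^sub>v b"
        using M w v MN by (simp add: mult_minus_distrib_mat_vec[of M b a])
      then have "(N * M) *\<^sub>v v - v = 0\<^sub>v a" using ker w v by simp
      then have "((N * M) *\<^sub>v v - v) $ i = 0" if "i < a" for i using that by simp
      then show ?thesis using w v N by (intro eq_vecI) auto
    qed
    then have "(N * M) $$ (i, j) = 1\<^sub>m a $$ (i, j)" if ij: "i < a" "j < a" for i j
    proof -
      have "(N * M) $$ (i, j) = ((N * M) *\<^sub>v unit_vec a j) $ i"
        by (rule index_mult_unit_vec[OF NMc ij, symmetric])
      also have "\<dots> = unit_vec a j $ i"
        using \<open>\<And>v. v \<in> carrier_vec a \<Longrightarrow> (N * M) *\<^sub>v v = v\<close>[of "unit_vec a j"] by simp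
      finally show ?thesis using ij by simp
    qed
    then show ?thesis using NMc by (intro eq_matI) auto
  qed
  have "(of_nat a :: complex) = of_nat b"
    using mat_trace_commute[OF M N] by (simp add: MN NM)
  then have "a = b" by simp
  with ab show "rep_dim G \<rho> = rep_dim G \<sigma>" by simp
  show "M \<in> carrier (GL (rep_dim G \<sigma>))"
    unfolding ab(2)[symmetric] GL_iff using M N MN NM \<open>a = b\<close> by auto
qed

text \<open>For an eigenvalue \<open>k\<close> of \<open>M\<close> the matrix \<open>M - k 1\<close> commutes with the representation and is
  singular, so it vanishes by Schur's lemma.\<close>

lemma schur_scalar:
  assumes rho: "irreducible_rep G \<rho>" and M: "M \<in> carrier_mat (rep_dim G \<rho>) (rep_dim G \<rho>)"
    and comm: "\<And>g. g \<in> carrier G \<Longrightarrow> M * \<rho> g = \<rho> g * M"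
  obtains c where "M = c \<cdot>\<^sub>m 1\<^sub>m (rep_dim G \<rho>)"
proof -
  define d where "d = rep_dim G \<rho>"
  note r = representationD[OF irreducible_repD(1)[OF rho], folded d_def]
  note M = M[folded d_def]
  have "d > 0" using irreducible_repD(2)[OF rho] d_def by simp
  from spectrum_non_empty[OF M this] obtain k where "eigenvalue M k"
    by (auto simp: spectrum_def)
  then obtain v where v: "v \<in> carrier_vec d" "v \<noteq> 0\<^sub>v d" "M *\<^sub>v v = k \<cdot>\<^sub>v v"
    using M by (auto simp: eigenvalue_def eigenvector_def)
  define N where "N = M - k \<cdot>\<^sub>m 1\<^sub>m d"
  have N: "N \<in> carrier_mat d d" unfolding N_def by (intro minus_carrier_mat) simp
  have Nv: "N *\<^sub>v v = 0\<^sub>v d"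
  proof -
    have "N *\<^sub>v v = M *\<^sub>v v - (k \<cdot>\<^sub>m 1\<^sub>m d) *\<^sub>v v"
      unfolding N_def using M v by (intro minus_mult_distrib_mat_vec) auto
    also have "(k \<cdot>\<^sub>m 1\<^sub>m d) *\<^sub>v v = k \<cdot>\<^sub>v v" using v by (simp add: smult_mat_mult_vec[of _ d d])
    finally show ?thesis using v by simp
  qed
  have "N = 0\<^sub>m d d"
  proof (rule ccontr)
    assume "N \<noteq> 0\<^sub>m d d"
    have "N * \<rho> g = \<rho> g * N" if g: "g \<in> carrier G" for g
    proof -
      have "N * \<rho> g = M * \<rho> g - k \<cdot>\<^sub>m \<rho> g"
        unfolding N_def using M r(2)[OF g] by (simp add: minus_mult_distrib_mat[of _ d d] mult_smult_assoc_mat[of _ d d])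
      moreover have "\<rho> g * N = \<rho> g * M - k \<cdot>\<^sub>m \<rho> g"
        unfolding N_def using M r(2)[OF g] by (simp add: mult_minus_distrib_mat[of _ d d] mult_smult_distrib[OF r(2)[OF g] one_carrier_mat])
      ultimately show ?thesis by (simp add: comm[OF g])
    qed
    then have "N \<in> carrier (GL d)"
      using schur(2)[OF rho rho, of N] N \<open>N \<noteq> 0\<^sub>m d d\<close> by (simp add: d_def)
    then show False using GL_iff_kernel[OF N] Nv v by blast
  qed
  have "M = k \<cdot>\<^sub>m 1\<^sub>m d"
  proof (rule eq_matI)
    fix i j assume "i < dim_row (k \<cdot>\<^sub>m 1\<^sub>m d)" "j < dim_col (k \<cdot>\<^sub>m 1\<^sub>m d)"
    then have ij: "i < d" "j < d" by auto
    have "N $$ (i, j) = 0" using \<open>N = 0\<^sub>m d d\<close> ij by simp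
    then show "M $$ (i, j) = (k \<cdot>\<^sub>m 1\<^sub>m d) $$ (i, j)" using M ij by (simp add: N_def)
  qed (use M in auto)
  then show thesis using that by (simp add: d_def)
qed

end

section \<open>Orthogonality of characters\<close>

text \<open>Multiplying a matrix unit from both sides isolates a product of two entries. Thus sums of products
  of entries of two representations become entries of an average over the group.\<close>

lemma mult_matrix_unit_mult:
  fixes A B :: "'a::comm_ring_1 mat"
  assumes A: "A \<in> carrier_mat m b" and B: "B \<in> carrier_mat a n"
    and k: "k < b" and l: "l < a" and ij: "i < m" "j < n"
  shows "(A * mat b a (\<lambda>(x, y). if x = k \<and> y = l then 1 else 0) * B) $$ (i, j) = A $$ (i, k) * B $$ (l, j)"
proof -
  let ?E = "mat b a (\<lambda>(x, y). if x = k \<and> y = l then 1 else 0) :: 'a mat"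
  have E: "?E \<in> carrier_mat b a" by simp
  have AE: "(A * ?E) $$ (i, y) = (if y = l then A $$ (i, k) else 0)" if "y < a" for y
  proof -
    have "(A * ?E) $$ (i, y) = (\<Sum>x<b. A $$ (i, x) * ?E $$ (x, y))"
      by (rule index_mult_mat_sum[OF A E ij(1) that])
    also have "\<dots> = (\<Sum>x<b. if x = k then (if y = l then A $$ (i, k) else 0) else 0)"
      using that by (intro sum.cong) auto
    finally show ?thesis using k by simp
  qed
  have "(A * ?E * B) $$ (i, j) = (\<Sum>y<a. (A * ?E) $$ (i, y) * B $$ (y, j))"
    by (rule index_mult_mat_sum[OF mult_carrier_mat[OF A E] B ij])
  also have "\<dots> = (\<Sum>y<a. if y = l then A $$ (i, k) * B $$ (l, j) else 0)"
    by (intro sum.cong) (auto simp: AE)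
  finally show ?thesis using l by simp
qed

context finite_group begin

text \<open>The substitution \<open>g \<mapsto> h g\<close> in the average. By Schur's lemma the average is then zero or a scalar,
  whatever matrix has been averaged.\<close>

lemma average_intertwines:
  assumes rho: "representation G \<rho>" and sigma: "representation G \<sigma>"
    and M: "M \<in> carrier_mat (rep_dim G \<sigma>) (rep_dim G \<rho>)" and h: "h \<in> carrier G"
  defines "T \<equiv> matrix_sum (rep_dim G \<sigma>) (rep_dim G \<rho>) (\<lambda>g. \<sigma> g * M * \<rho> (inv g)) (carrier G)"
  shows "T * \<rho> h = \<sigma> h * T"
proof -
  define a b where ab: "a = rep_dim G \<rho>" "b = rep_dim G \<sigma>"
  note r = representationD[OF rho, folded ab] and s = representationD[OF sigma, folded ab]
  note M = M[folded ab]
  have c: "\<sigma> g * M * \<rho> (inv g) \<in> carrier_mat b a" if "g \<in> carrier G" for g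
    by (intro mult_carrier_mat[OF mult_carrier_mat[OF s(2) M] r(2)]) (use that in auto)
  have "T * \<rho> h = matrix_sum b a (\<lambda>g. \<sigma> g * M * \<rho> (inv g) * \<rho> h) (carrier G)"
    unfolding T_def ab[symmetric] by (rule matrix_sum_mult[OF r(2)[OF h] c])
  also have "\<dots> = matrix_sum b a (\<lambda>g. \<sigma> (h \<otimes> g) * M * \<rho> (inv (h \<otimes> g)) * \<rho> h) (carrier G)"
    using h by (intro matrix_sum_reindex[symmetric] bij_betwI[of _ _ _ "\<lambda>g. inv h \<otimes> g"])
      (auto simp: m_assoc[symmetric])
  also have "\<dots> = matrix_sum b a (\<lambda>g. \<sigma> h * (\<sigma> g * M * \<rho> (inv g))) (carrier G)"
  proof (rule matrix_sum_cong)
    fix g assume g: "g \<in> carrier G"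
    have i: "inv g \<in> carrier G" "inv h \<in> carrier G" "inv (h \<otimes> g) \<in> carrier G" "h \<otimes> g \<in> carrier G" using g h by auto
    have "\<rho> (inv (h \<otimes> g)) * \<rho> h = \<rho> (inv g)"
      using g h by (simp add: r(3)[symmetric] inv_mult_group m_assoc)
    then have e1: "\<sigma> (h \<otimes> g) * M * \<rho> (inv (h \<otimes> g)) * \<rho> h = \<sigma> (h \<otimes> g) * M * \<rho> (inv g)"
      by (simp only: assoc_mult_mat[OF mult_carrier_mat[OF s(2)[OF i(4)] M] r(2)[OF i(3)] r(2)[OF h]])
    have e2: "\<sigma> (h \<otimes> g) * M = \<sigma> h * (\<sigma> g * M)"
      by (simp only: s(3)[OF h g] assoc_mult_mat[OF s(2)[OF h] s(2)[OF g] M])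
    have e3: "\<sigma> h * (\<sigma> g * M) * \<rho> (inv g) = \<sigma> h * (\<sigma> g * M * \<rho> (inv g))"
      by (rule assoc_mult_mat[OF s(2)[OF h] mult_carrier_mat[OF s(2)[OF g] M] r(2)[OF i(1)]])
    show "\<sigma> (h \<otimes> g) * M * \<rho> (inv (h \<otimes> g)) * \<rho> h = \<sigma> h * (\<sigma> g * M * \<rho> (inv g))"
      unfolding e1 unfolding e2 by (rule e3)
  qed
  also have "\<dots> = \<sigma> h * T"
    unfolding T_def ab[symmetric] by (rule mult_matrix_sum[OF s(2)[OF h] c, symmetric])
  finally show ?thesis .
qed

text \<open>The entries of the averages of all matrix units add up to the sum of the products of characters.
  If the representations are not isomorphic, all averages vanish. If they are, the average of the
  matrix unit \<open>E\<^sub>k\<^sub>l\<close> is the scalar given by its trace, which is 0 unless \<open>k = l\<close>. The value at the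
  inverse element takes the place of the complex conjugate, so that unitarity of representations
  does not enter.\<close>

theorem character_orthogonality:
  assumes rho: "irreducible_rep G \<rho>" and sigma: "irreducible_rep G \<sigma>"
  shows "(\<Sum>g\<in>carrier G. character \<rho> (inv g) * character \<sigma> g) =
    (if rep_iso G \<rho> \<sigma> then of_nat (card (carrier G)) else 0)"
proof -
  have main: "(\<Sum>g\<in>carrier G. character \<rho> (inv g) * character \<sigma> g) =
      (\<Sum>k<rep_dim G \<sigma>. \<Sum>l<rep_dim G \<rho>. matrix_sum (rep_dim G \<sigma>) (rep_dim G \<rho>)
        (\<lambda>g. \<sigma> g * mat (rep_dim G \<sigma>) (rep_dim G \<rho>) (\<lambda>(x, y). if x = k \<and> y = l then 1 else 0) * \<rho> (inv g)) (carrier G) $$ (k, l))"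
    if rho: "representation G \<rho>" and sigma: "representation G \<sigma>" for \<rho> \<sigma> :: "'a rep"
  proof -
    define a b where ab: "a = rep_dim G \<rho>" "b = rep_dim G \<sigma>"
    note r = representationD[OF rho, folded ab] and s = representationD[OF sigma, folded ab]
    have "(\<Sum>g\<in>carrier G. character \<rho> (inv g) * character \<sigma> g) =
      (\<Sum>g\<in>carrier G. \<Sum>k<b. \<Sum>l<a. \<sigma> g $$ (k, k) * \<rho> (inv g) $$ (l, l))"
    proof (rule sum.cong[OF refl])
      fix g assume g: "g \<in> carrier G"
      have dims: "dim_row (\<rho> (inv g)) = a" "dim_row (\<sigma> g) = b" using r(2)[of "inv g"] s(2)[OF g] g by auto
      show "character \<rho> (inv g) * character \<sigma> g = (\<Sum>k<b. \<Sum>l<a. \<sigma> g $$ (k, k) * \<rho> (inv g) $$ (l, l))"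
        by (simp add: character_def dims sum_product[symmetric] mult.commute)
    qed
    also have "\<dots> = (\<Sum>k<b. \<Sum>l<a. \<Sum>g\<in>carrier G. \<sigma> g $$ (k, k) * \<rho> (inv g) $$ (l, l))"
      by (subst sum.swap, intro sum.cong refl, subst sum.swap) simp
    also have "\<dots> = (\<Sum>k<b. \<Sum>l<a. matrix_sum b a
        (\<lambda>g. \<sigma> g * mat b a (\<lambda>(x, y). if x = k \<and> y = l then 1 else 0) * \<rho> (inv g)) (carrier G) $$ (k, l))"
    proof (intro sum.cong refl)
      fix k l assume "k \<in> {..<b}" "l \<in> {..<a}"
      then have kl: "k < b" "l < a" by auto
      have "\<sigma> g $$ (k, k) * \<rho> (inv g) $$ (l, l) =
        (\<sigma> g * mat b a (\<lambda>(x, y). if x = k \<and> y = l then 1 else 0) * \<rho> (inv g)) $$ (k, l)"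
        if g: "g \<in> carrier G" for g
        using mult_matrix_unit_mult[OF s(2)[OF g] r(2)[OF inv_closed[OF g]] kl kl] by simp
      then show "(\<Sum>g\<in>carrier G. \<sigma> g $$ (k, k) * \<rho> (inv g) $$ (l, l)) = matrix_sum b a
        (\<lambda>g. \<sigma> g * mat b a (\<lambda>(x, y). if x = k \<and> y = l then 1 else 0) * \<rho> (inv g)) (carrier G) $$ (k, l)"
        by (simp only: index_matrix_sum(1)[OF kl] cong: sum.cong)
    qed
    finally show ?thesis by (simp only: ab)
  qed
  show ?thesis
  proof (cases "rep_iso G \<rho> \<sigma>")
    case False
    define a b where ab: "a = rep_dim G \<rho>" "b = rep_dim G \<sigma>"
    have "matrix_sum b a (\<lambda>g. \<sigma> g * M * \<rho> (inv g)) (carrier G) = 0\<^sub>m b a" if M: "M \<in> carrier_mat b a" for M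
    proof (rule ccontr)
      let ?T = "matrix_sum b a (\<lambda>g. \<sigma> g * M * \<rho> (inv g)) (carrier G)"
      assume ne: "?T \<noteq> 0\<^sub>m b a"
      have int: "?T * \<rho> h = \<sigma> h * ?T" if "h \<in> carrier G" for h
        using average_intertwines[OF irreducible_repD(1)[OF rho] irreducible_repD(1)[OF sigma] M[unfolded ab] that]
        by (simp add: ab)
      have "a = b" "?T \<in> carrier (GL b)"
        using schur[OF rho sigma, of ?T] int ne by (auto simp: ab)
      then have "rep_iso G \<rho> \<sigma>" by (intro rep_isoI[of _ b _ ?T]) (use int ab in auto)
      with False show False by simp
    qed
    then show ?thesis
      using False by (simp add: main irreducible_repD[OF rho] irreducible_repD[OF sigma] ab)
  next
    case True
    define d where "d = rep_dim G \<rho>"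
    have d: "d > 0" using irreducible_repD[OF rho] by (simp add: d_def)
    note rrho = irreducible_repD(1)[OF rho]
    note r = representationD[OF rrho, folded d_def]
    have "character \<sigma> g = character \<rho> g" if "g \<in> carrier G" for g
      using rep_iso_character[OF irreducible_repD(1)[OF rho] irreducible_repD(1)[OF sigma] True that] by simp
    then have "(\<Sum>g\<in>carrier G. character \<rho> (inv g) * character \<sigma> g) = (\<Sum>g\<in>carrier G. character \<rho> (inv g) * character \<rho> g)"
      by simp
    also have "\<dots> = (\<Sum>k<d. \<Sum>l<d. if l = k then of_nat (card (carrier G)) / of_nat d else 0)"
      unfolding main[OF rrho rrho] d_def[symmetric]
    proof (intro sum.cong refl)
      fix k l assume "k \<in> {..<d}" "l \<in> {..<d}"
      then have kl: "k < d" "l < d" by auto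
      let ?E = "mat d d (\<lambda>(x, y). if x = k \<and> y = l then 1 else 0) :: complex mat"
      let ?T = "matrix_sum d d (\<lambda>g. \<rho> g * ?E * \<rho> (inv g)) (carrier G)"
      have E: "?E \<in> carrier_mat d d" by simp
      obtain c where c: "?T = c \<cdot>\<^sub>m 1\<^sub>m d"
        by (rule schur_scalar[OF rho, of ?T])
          (use average_intertwines[OF rrho rrho, of ?E] in \<open>auto simp: d_def\<close>)
      have "c * of_nat d = mat_trace ?T" by (simp add: c mat_trace_smult[of _ d])
      also have "\<dots> = (\<Sum>g\<in>carrier G. mat_trace (\<rho> g * ?E * \<rho> (inv g)))"
        by (intro mat_trace_matrix_sum mult_carrier_mat[OF mult_carrier_mat[OF r(2) E] r(2)]) auto
      also have "\<dots> = (\<Sum>g\<in>carrier G. if l = k then 1 else 0)"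
      proof (intro sum.cong refl)
        fix g assume g: "g \<in> carrier G"
        have gi: "inv g \<in> carrier G" using g by simp
        have "mat_trace (\<rho> g * ?E * \<rho> (inv g)) = mat_trace (\<rho> (inv g) * (\<rho> g * ?E))"
          by (rule mat_trace_commute[OF mult_carrier_mat[OF r(2)[OF g] E] r(2)[OF gi]])
        also have "\<rho> (inv g) * (\<rho> g * ?E) = ?E"
          by (simp only: assoc_mult_mat[OF r(2)[OF gi] r(2)[OF g] E, symmetric] r(6)[OF g] left_mult_one_mat[OF E])
        also have "mat_trace ?E = (\<Sum>i<d. if i = k then (if l = k then 1 else 0) else 0)"
          unfolding mat_trace_def using kl by (intro sum.cong) auto
        also have "\<dots> = (if l = k then 1 else 0)" using kl by simp
        finally show "mat_trace (\<rho> g * ?E * \<rho> (inv g)) = (if l = k then 1 else 0)" .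
      qed
      also have "\<dots> = (if l = k then of_nat (card (carrier G)) else 0)" by simp
      finally have "c = (if l = k then of_nat (card (carrier G)) / of_nat d else 0)"
        using d by (auto simp: field_simps split: if_splits)
      then show "?T $$ (k, l) = (if l = k then of_nat (card (carrier G)) / of_nat d else 0)"
        unfolding c using kl by auto
    qed
    also have "\<dots> = of_nat (card (carrier G))" using d by simp
    finally show ?thesis using True by simp
  qed
qed

section \<open>Multiplicities as inner products\<close>

text \<open>The inner product of the character of \<open>\<rho>\<close> with an arbitrary function \<open>F\<close>. It is linear in \<open>F\<close>, and
  it is the multiplicity of \<open>\<rho>\<close> in \<open>V\<close> when \<open>F\<close> is the character of \<open>V\<close>.\<close>

definition char_mult :: "'a rep \<Rightarrow> ('a \<Rightarrow> complex) \<Rightarrow> complex" where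
  "char_mult \<rho> F = (\<Sum>g\<in>carrier G. character \<rho> (inv g) * F g) / of_nat (card (carrier G))"

lemma char_mult_cong:
  "(\<And>g. g \<in> carrier G \<Longrightarrow> F g = F' g) \<Longrightarrow> char_mult \<rho> F = char_mult \<rho> F'"
  by (simp add: char_mult_def cong: sum.cong)

lemma char_mult_character:
  assumes "irreducible_rep G \<rho>" "irreducible_rep G \<sigma>"
  shows "char_mult \<rho> (character \<sigma>) = (if rep_iso G \<rho> \<sigma> then 1 else 0)"
  using character_orthogonality[OF assms] card_carrier_pos by (simp add: char_mult_def)

lemma char_mult_sum_list:
  "char_mult \<rho> (\<lambda>g. \<Sum>\<sigma>\<leftarrow>\<sigma>s. F \<sigma> g) = (\<Sum>\<sigma>\<leftarrow>\<sigma>s. char_mult \<rho> (F \<sigma>))"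
  by (induction \<sigma>s) (simp_all add: char_mult_def sum.distrib distrib_left add_divide_distrib)

lemma char_mult_direct_sum:
  assumes rho: "irreducible_rep G \<rho>" and irr: "\<And>\<sigma>. \<sigma> \<in> set \<sigma>s \<Longrightarrow> irreducible_rep G \<sigma>"
  shows "char_mult \<rho> (character (direct_sum_rep \<sigma>s)) = of_nat (length (filter (rep_iso G \<rho>) \<sigma>s))"
proof -
  have "char_mult \<rho> (character (direct_sum_rep \<sigma>s)) = char_mult \<rho> (\<lambda>g. \<Sum>\<sigma>\<leftarrow>\<sigma>s. character \<sigma> g)"
    by (intro char_mult_cong character_direct_sum irreducible_repD irr)
  also have "\<dots> = (\<Sum>\<sigma>\<leftarrow>\<sigma>s. if rep_iso G \<rho> \<sigma> then 1 else 0)"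
    unfolding char_mult_sum_list using irr by (intro arg_cong[where f = sum_list] map_cong) (auto simp: char_mult_character rho)
  also have "\<dots> = of_nat (length (filter (rep_iso G \<rho>) \<sigma>s))"
    by (induction \<sigma>s) auto
  finally show ?thesis .
qed

text \<open>The number of summands isomorphic to \<open>\<rho>\<close> in any decomposition of \<open>V\<close> is the inner product of
  characters, so it is independent of the decomposition; a decomposition exists by complete
  reducibility. Hence the definite description in the definition of the multiplicity is meaningful.\<close>

theorem multiplicity_rep_eq_char_mult:
  assumes rho: "irreducible_rep G \<rho>" and V: "representation G V"
  shows "of_nat (multiplicity_rep G \<rho> V) = char_mult \<rho> (character V)"
proof -
  define P where "P = (\<lambda>m \<sigma>s. (\<forall>\<sigma> \<in> set \<sigma>s. irreducible_rep G \<sigma>) \<and>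
     rep_iso G V (direct_sum_rep \<sigma>s) \<and> m = length (filter (rep_iso G \<rho>) \<sigma>s))"
  have *: "of_nat m = char_mult \<rho> (character V)" if "P m \<sigma>s" for m \<sigma>s
  proof -
    have irr: "\<And>\<sigma>. \<sigma> \<in> set \<sigma>s \<Longrightarrow> irreducible_rep G \<sigma>" using that by (auto simp: P_def)
    have "char_mult \<rho> (character V) = char_mult \<rho> (character (direct_sum_rep \<sigma>s))"
      using that irr irreducible_repD(1)
      by (intro char_mult_cong rep_iso_character[OF V] representation_direct_sum) (auto simp: P_def)
    then show ?thesis using char_mult_direct_sum[OF rho irr] that by (simp add: P_def)
  qed
  obtain \<sigma>s where "P (length (filter (rep_iso G \<rho>) \<sigma>s)) \<sigma>s"
    using maschke[OF V] by (auto simp: P_def)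
  then have "\<exists>!m. \<exists>\<sigma>s. P m \<sigma>s"
    using * by (metis of_nat_eq_iff)
  from theI'[OF this] have "\<exists>\<sigma>s. P (multiplicity_rep G \<rho> V) \<sigma>s"
    unfolding multiplicity_rep_def P_def .
  then show ?thesis using * by blast
qed

lemma char_mult_nat:
  assumes "irreducible_rep G \<rho>" "representation G V"
  obtains m :: nat where "char_mult \<rho> (character V) = of_nat m"
  using multiplicity_rep_eq_char_mult[OF assms] by metis

end

section \<open>The trivial representation and tensor products\<close>

context group begin

lemma representation_trivial: "representation G trivial_rep" "rep_dim G trivial_rep = 1"
  by (rule representationI[of trivial_rep 1]; simp add: trivial_rep_def)+

lemma character_trivial: "character trivial_rep g = 1"
  by (simp add: character_def trivial_rep_def)

lemma irreducible_trivial: "irreducible_rep G trivial_rep"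
  unfolding irreducible_rep_iff
proof (intro conjI allI impI)
  show "representation G trivial_rep" "rep_dim G trivial_rep > 0"
    by (simp_all add: representation_trivial)
  fix W assume W: "lin_subspace (rep_dim G trivial_rep) W"
  then have W1: "W \<subseteq> carrier_vec 1" "0\<^sub>v 1 \<in> W" "\<And>c v. v \<in> W \<Longrightarrow> c \<cdot>\<^sub>v v \<in> W"
    by (simp_all add: lin_subspace_def representation_trivial)
  show "W = {0\<^sub>v (rep_dim G trivial_rep)} \<or> W = carrier_vec (rep_dim G trivial_rep)"
  proof (cases "W = {0\<^sub>v 1}")
    case False
    then obtain w where w: "w \<in> W" "w \<noteq> 0\<^sub>v 1" using W1(2) by blast
    have wc: "w \<in> carrier_vec 1" using W1(1) w by blast
    have w0: "w $ 0 \<noteq> 0"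
    proof
      assume "w $ 0 = 0"
      then have "w = 0\<^sub>v 1" using wc by (intro eq_vecI) auto
      with w(2) show False by simp
    qed
    have "v \<in> W" if v: "v \<in> carrier_vec 1" for v
    proof -
      have "v = (v $ 0 / w $ 0) \<cdot>\<^sub>v w" using v wc w0 by (intro eq_vecI) auto
      then show ?thesis using W1(3)[OF w(1), of "v $ 0 / w $ 0"] by simp
    qed
    then show ?thesis using W1(1) by (auto simp: representation_trivial)
  qed (simp add: representation_trivial)
qed

lemma kronecker_carrier:
  "A \<in> carrier_mat m m' \<Longrightarrow> B \<in> carrier_mat n n' \<Longrightarrow> kronecker A B \<in> carrier_mat (m * n) (m' * n')"
  by (simp add: kronecker_def)

end

text \<open>The indices of a Kronecker product, written as a pair of quotient and remainder.\<close>

lemma sum_div_mod: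
  "(\<Sum>l<m * n. F (l div n) (l mod n)) = (\<Sum>i<m. \<Sum>j<(n::nat). F i j :: 'a::comm_monoid_add)"
proof (cases "n = 0")
  case False
  have lt: "i * n + j < m * n" if "i < m" "j < n" for i j
  proof -
    have "i * n + j < i * n + n" using that by simp
    also have "\<dots> = Suc i * n" by simp
    also have "\<dots> \<le> m * n" using that by (intro mult_le_mono1) simp
    finally show ?thesis .
  qed
  have "(\<Sum>l<m * n. F (l div n) (l mod n)) = (\<Sum>(i, j)\<in>{..<m} \<times> {..<n}. F i j)"
    by (rule sum.reindex_bij_witness[of _ "\<lambda>(i, j). i * n + j" "\<lambda>l. (l div n, l mod n)"])
      (use False lt in \<open>auto simp: less_mult_imp_div_less\<close>)
  then show ?thesis by (simp add: sum.cartesian_product)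
qed simp

lemma kronecker_mult:
  assumes A: "A \<in> carrier_mat m m" "C \<in> carrier_mat m m" and B: "B \<in> carrier_mat n n" "D \<in> carrier_mat n n"
  shows "kronecker (A * C) (B * D) = kronecker A B * kronecker C D"
proof (rule eq_matI)
  have K: "kronecker A B \<in> carrier_mat (m * n) (m * n)" "kronecker C D \<in> carrier_mat (m * n) (m * n)"
    using A B by (auto simp: kronecker_def)
  fix i j assume "i < dim_row (kronecker A B * kronecker C D)" "j < dim_col (kronecker A B * kronecker C D)"
  then have ij: "i < m * n" "j < m * n" using K by auto
  then have n: "n > 0" by (cases n) auto
  have dm: "i div n < m" "j div n < m" "i mod n < n" "j mod n < n"
    using ij n by (auto simp: less_mult_imp_div_less)
  have "(kronecker A B * kronecker C D) $$ (i, j) = (\<Sum>l<m * n. kronecker A B $$ (i, l) * kronecker C D $$ (l, j))"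
    by (rule index_mult_mat_sum[OF K ij])
  also have "\<dots> = (\<Sum>l<m * n. (A $$ (i div n, l div n) * C $$ (l div n, j div n)) *
      (B $$ (i mod n, l mod n) * D $$ (l mod n, j mod n)))"
    using A B ij by (intro sum.cong) (auto simp: kronecker_def)
  also have "\<dots> = (\<Sum>k<m. \<Sum>l<n. (A $$ (i div n, k) * C $$ (k, j div n)) * (B $$ (i mod n, l) * D $$ (l, j mod n)))"
    by (rule sum_div_mod)
  also have "\<dots> = (A * C) $$ (i div n, j div n) * (B * D) $$ (i mod n, j mod n)"
    by (simp only: sum_product[symmetric] index_mult_mat_sum[OF A dm(1,2)] index_mult_mat_sum[OF B dm(3,4)])
  also have "\<dots> = kronecker (A * C) (B * D) $$ (i, j)"
    using A B ij by (simp add: kronecker_def)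
  finally show "kronecker (A * C) (B * D) $$ (i, j) = (kronecker A B * kronecker C D) $$ (i, j)" by simp
qed (use A B in \<open>auto simp: kronecker_def\<close>)

lemma kronecker_one: "kronecker (1\<^sub>m m) (1\<^sub>m n) = 1\<^sub>m (m * n)"
proof (rule eq_matI)
  fix i j assume "i < dim_row (1\<^sub>m (m * n) :: complex mat)" "j < dim_col (1\<^sub>m (m * n) :: complex mat)"
  then have ij: "i < m * n" "j < m * n" by auto
  then have n: "n > 0" by (cases n) auto
  have "i = j" if "i div n = j div n" "i mod n = j mod n"
    using that by (metis div_mult_mod_eq)
  then show "kronecker (1\<^sub>m m) (1\<^sub>m n) $$ (i, j) = 1\<^sub>m (m * n) $$ (i, j)"
    using ij n by (auto simp: kronecker_def less_mult_imp_div_less)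
qed (auto simp: kronecker_def)

lemma mat_trace_kronecker:
  assumes "A \<in> carrier_mat m m" "B \<in> carrier_mat n n"
  shows "mat_trace (kronecker A B) = mat_trace A * mat_trace B"
proof -
  have "mat_trace (kronecker A B) = (\<Sum>l<m * n. A $$ (l div n, l div n) * B $$ (l mod n, l mod n))"
    using assms by (auto simp: mat_trace_def kronecker_def intro!: sum.cong)
  also have "\<dots> = (\<Sum>i<m. \<Sum>j<n. A $$ (i, i) * B $$ (j, j))" by (rule sum_div_mod)
  finally show ?thesis using assms by (simp add: mat_trace_def sum_product)
qed

context group begin

lemma representation_tensor:
  assumes "representation G \<rho>" "representation G \<sigma>"
  shows "representation G (tensor_rep \<rho> \<sigma>)" "rep_dim G (tensor_rep \<rho> \<sigma>) = rep_dim G \<rho> * rep_dim G \<sigma>"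
proof -
  note r = representationD[OF assms(1)] and s = representationD[OF assms(2)]
  have 1: "tensor_rep \<rho> \<sigma> g \<in> carrier_mat (rep_dim G \<rho> * rep_dim G \<sigma>) (rep_dim G \<rho> * rep_dim G \<sigma>)"
    if "g \<in> carrier G" for g
    unfolding tensor_rep_def by (rule kronecker_carrier[OF r(2)[OF that] s(2)[OF that]])
  have 2: "tensor_rep \<rho> \<sigma> (g \<otimes> h) = tensor_rep \<rho> \<sigma> g * tensor_rep \<rho> \<sigma> h"
    if "g \<in> carrier G" "h \<in> carrier G" for g h
    unfolding tensor_rep_def r(3)[OF that] s(3)[OF that]
    by (rule kronecker_mult[OF r(2)[OF that(1)] r(2)[OF that(2)] s(2)[OF that(1)] s(2)[OF that(2)]])
  have 3: "tensor_rep \<rho> \<sigma> \<one> = 1\<^sub>m (rep_dim G \<rho> * rep_dim G \<sigma>)"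
    by (simp add: tensor_rep_def r(4) s(4) kronecker_one)
  show "representation G (tensor_rep \<rho> \<sigma>)" "rep_dim G (tensor_rep \<rho> \<sigma>) = rep_dim G \<rho> * rep_dim G \<sigma>"
    by (rule representationI; use 1 2 3 in blast)+
qed

lemma character_tensor:
  assumes "representation G \<rho>" "representation G \<sigma>" "g \<in> carrier G"
  shows "character (tensor_rep \<rho> \<sigma>) g = character \<rho> g * character \<sigma> g"
  unfolding character_eq_trace tensor_rep_def
  by (rule mat_trace_kronecker[OF representationD(2)[OF assms(1,3)] representationD(2)[OF assms(2,3)]])

text \<open>Powers of a character are characters, so they have an expansion in irreducible characters.\<close>

lemma exists_tensor_power:
  assumes "representation G \<eta>"
  shows "\<exists>V. representation G V \<and> (\<forall>g\<in>carrier G. character V g = character \<eta> g ^ r)"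
proof (induction r)
  case 0
  show ?case by (intro exI[of _ trivial_rep]) (simp add: representation_trivial character_trivial)
next
  case (Suc r)
  then obtain V where "representation G V" "\<forall>g\<in>carrier G. character V g = character \<eta> g ^ r" by blast
  then show ?case using assms
    by (intro exI[of _ "tensor_rep V \<eta>"]) (simp add: representation_tensor character_tensor)
qed

end

section \<open>The regular representation and the classes of irreducibles\<close>

context finite_group begin

text \<open>An enumeration of the group, which indexes the matrices of the regular representation.\<close>

definition element_list :: "'a list" where
  "element_list = (SOME xs. distinct xs \<and> set xs = carrier G)"

lemma element_list: "distinct element_list" "set element_list = carrier G"
proof -
  have "\<exists>xs. distinct xs \<and> set xs = carrier G"
    using finite_distinct_list[OF finite_carrier] by blast
  from someI_ex[OF this] show "distinct element_list" "set element_list = carrier G"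
    by (simp_all add: element_list_def)
qed

lemma length_element_list: "length element_list = card (carrier G)"
  using distinct_card[OF element_list(1)] element_list(2) by simp

definition regular_rep :: "'a rep" where
  "regular_rep g = mat (card (carrier G)) (card (carrier G))
     (\<lambda>(i, j). if element_list ! i = g \<otimes> element_list ! j then 1 else 0)"

lemma element_list_nth: "i < card (carrier G) \<Longrightarrow> element_list ! i \<in> carrier G"
  using element_list(2) length_element_list nth_mem by metis

lemma obtain_index:
  assumes "g \<in> carrier G" obtains i where "i < card (carrier G)" "element_list ! i = g"
  using assms element_list(2) length_element_list by (metis in_set_conv_nth)

lemma element_list_inject:
  "i < card (carrier G) \<Longrightarrow> j < card (carrier G) \<Longrightarrow> element_list ! i = element_list ! j \<longleftrightarrow> i = j"
  using nth_eq_iff_index_eq[OF element_list(1)] length_element_list by simp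

lemma representation_regular: "representation G regular_rep" "rep_dim G regular_rep = card (carrier G)"
proof -
  let ?N = "card (carrier G)"
  have 1: "regular_rep g \<in> carrier_mat ?N ?N" for g by (simp add: regular_rep_def)
  have 2: "regular_rep (g \<otimes> h) = regular_rep g * regular_rep h" if g: "g \<in> carrier G" and h: "h \<in> carrier G" for g h
  proof (rule eq_matI)
    fix i j assume "i < dim_row (regular_rep g * regular_rep h)" "j < dim_col (regular_rep g * regular_rep h)"
    then have ij: "i < ?N" "j < ?N" by (auto simp: regular_rep_def)
    have xj: "element_list ! j \<in> carrier G" by (rule element_list_nth[OF ij(2)])
    then obtain k where k: "k < ?N" "element_list ! k = h \<otimes> element_list ! j"
      using obtain_index[of "h \<otimes> element_list ! j"] h by auto
    have "(regular_rep g * regular_rep h) $$ (i, j) =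
        (\<Sum>l<?N. regular_rep g $$ (i, l) * regular_rep h $$ (l, j))"
      by (rule index_mult_mat_sum[OF 1 1 ij])
    also have "\<dots> = (\<Sum>l<?N. if l = k then regular_rep g $$ (i, k) else 0)"
      using ij by (intro sum.cong) (auto simp: regular_rep_def k(2)[symmetric] element_list_inject k(1))
    also have "\<dots> = regular_rep (g \<otimes> h) $$ (i, j)"
      using ij k g h xj by (simp add: regular_rep_def m_assoc)
    finally show "regular_rep (g \<otimes> h) $$ (i, j) = (regular_rep g * regular_rep h) $$ (i, j)" by simp
  qed (simp_all add: regular_rep_def)
  have 3: "regular_rep \<one> = 1\<^sub>m ?N"
    by (rule eq_matI) (auto simp: regular_rep_def element_list_nth element_list_inject)
  show "representation G regular_rep" "rep_dim G regular_rep = ?N"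
    by (rule representationI; use 1 2 3 in blast)+
qed

lemma character_regular:
  assumes "g \<in> carrier G"
  shows "character regular_rep g = (if g = \<one> then of_nat (card (carrier G)) else 0)"
proof -
  have "element_list ! i = g \<otimes> element_list ! i \<longleftrightarrow> g = \<one>" if "i < card (carrier G)" for i
    using element_list_nth[OF that] assms by simp
  then have "character regular_rep g = (\<Sum>i<card (carrier G). if g = \<one> then 1 else 0)"
    unfolding character_def by (intro sum.cong) (auto simp: regular_rep_def)
  then show ?thesis by simp
qed

lemma char_mult_regular:
  assumes "representation G \<rho>"
  shows "char_mult \<rho> (character regular_rep) = of_nat (rep_dim G \<rho>)"
proof -
  have "(\<Sum>g\<in>carrier G. character \<rho> (inv g) * character regular_rep g) =
    (\<Sum>g\<in>carrier G. if g = \<one> then character \<rho> \<one> * of_nat (card (carrier G)) else 0)"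
    by (intro sum.cong) (auto simp: character_regular)
  also have "\<dots> = of_nat (rep_dim G \<rho>) * of_nat (card (carrier G))"
    using finite_carrier by (simp add: character_one assms)
  finally show ?thesis using card_carrier_pos by (simp add: char_mult_def)
qed

text \<open>By its character, the regular representation contains every irreducible \<open>\<rho>\<close> with multiplicity
  equal to the dimension of \<open>\<rho>\<close>, which is positive. Hence a decomposition of it meets all
  isomorphism classes, and in particular there are finitely many.\<close>

lemma exists_irreducible_list:
  obtains \<sigma>s where "\<And>\<sigma>. \<sigma> \<in> set \<sigma>s \<Longrightarrow> irreducible_rep G \<sigma>"
    "rep_iso G regular_rep (direct_sum_rep \<sigma>s)"
    "\<And>\<rho>. irreducible_rep G \<rho> \<Longrightarrow> \<exists>\<sigma>\<in>set \<sigma>s. rep_iso G \<rho> \<sigma>"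
proof -
  obtain \<sigma>s where s: "\<And>\<sigma>. \<sigma> \<in> set \<sigma>s \<Longrightarrow> irreducible_rep G \<sigma>" "rep_iso G regular_rep (direct_sum_rep \<sigma>s)"
    using maschke[OF representation_regular(1)] by blast
  have "\<exists>\<sigma>\<in>set \<sigma>s. rep_iso G \<rho> \<sigma>" if rho: "irreducible_rep G \<rho>" for \<rho>
  proof -
    have "of_nat (length (filter (rep_iso G \<rho>) \<sigma>s)) = char_mult \<rho> (character (direct_sum_rep \<sigma>s))"
      by (rule char_mult_direct_sum[OF rho s(1), symmetric])
    also have "\<dots> = char_mult \<rho> (character regular_rep)"
      using s irreducible_repD(1)
      by (intro char_mult_cong rep_iso_character[symmetric, OF representation_regular(1)] representation_direct_sum) auto
    also have "\<dots> = of_nat (rep_dim G \<rho>)" using rho by (intro char_mult_regular irreducible_repD)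
    finally have "length (filter (rep_iso G \<rho>) \<sigma>s) > 0" using irreducible_repD(2)[OF rho] by simp
    then show ?thesis by (auto simp: filter_empty_conv)
  qed
  with s that show thesis by blast
qed

lemma equiv_rep_iso_rel: "equiv {\<rho>. irreducible_rep G \<rho>} (rep_iso_rel G)"
proof (rule equivI)
  show "refl_on {\<rho>. irreducible_rep G \<rho>} (rep_iso_rel G)"
    by (auto simp: refl_on_def rep_iso_rel_def rep_iso_refl irreducible_repD)
  show "sym (rep_iso_rel G)"
    by (auto simp: sym_def rep_iso_rel_def intro: rep_iso_sym irreducible_repD)
  show "trans (rep_iso_rel G)"
    unfolding trans_def rep_iso_rel_def using rep_iso_trans irreducible_repD(1) by blast
qed (auto simp: rep_iso_rel_def)

definition irr_class :: "'a rep \<Rightarrow> 'a rep set" where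
  "irr_class \<rho> = rep_iso_rel G `` {\<rho>}"

lemma irr_class_in_Irr: "irreducible_rep G \<rho> \<Longrightarrow> irr_class \<rho> \<in> Irr G"
  by (auto simp: irr_class_def Irr_def intro: quotientI)

lemma class_rep:
  assumes "\<Lambda> \<in> Irr G"
  shows "irreducible_rep G (class_rep \<Lambda>)" "\<Lambda> = irr_class (class_rep \<Lambda>)"
proof -
  obtain \<rho> where rho: "irreducible_rep G \<rho>" "\<Lambda> = irr_class \<rho>"
    using assms by (auto simp: Irr_def irr_class_def elim: quotientE)
  have "\<rho> \<in> \<Lambda>" using rho by (auto simp: irr_class_def rep_iso_rel_def rep_iso_refl irreducible_repD)
  then have c: "class_rep \<Lambda> \<in> \<Lambda>" unfolding class_rep_def by (rule someI[where P = "\<lambda>\<rho>. \<rho> \<in> \<Lambda>"])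
  then have r: "(\<rho>, class_rep \<Lambda>) \<in> rep_iso_rel G" using rho by (simp add: irr_class_def)
  then show "irreducible_rep G (class_rep \<Lambda>)" by (simp add: rep_iso_rel_def)
  show "\<Lambda> = irr_class (class_rep \<Lambda>)"
    using equiv_class_eq[OF equiv_rep_iso_rel r] rho by (simp add: irr_class_def)
qed

lemma rep_iso_iff_irr_class:
  assumes "irreducible_rep G \<rho>" "irreducible_rep G \<sigma>"
  shows "rep_iso G \<rho> \<sigma> \<longleftrightarrow> irr_class \<rho> = irr_class \<sigma>"
  using eq_equiv_class_iff[OF equiv_rep_iso_rel, of \<rho> \<sigma>] assms
  by (auto simp: irr_class_def rep_iso_rel_def)

lemma rep_iso_class_rep_iff:
  assumes "\<Lambda> \<in> Irr G" "irreducible_rep G \<rho>"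
  shows "rep_iso G (class_rep \<Lambda>) \<rho> \<longleftrightarrow> \<Lambda> = irr_class \<rho>"
  using rep_iso_iff_irr_class[OF class_rep(1)[OF assms(1)] assms(2)] class_rep(2)[OF assms(1)] by simp

lemma finite_Irr: "finite (Irr G)"
proof -
  obtain \<sigma>s where s: "\<And>\<sigma>. \<sigma> \<in> set \<sigma>s \<Longrightarrow> irreducible_rep G \<sigma>"
    "\<And>\<rho>. irreducible_rep G \<rho> \<Longrightarrow> \<exists>\<sigma>\<in>set \<sigma>s. rep_iso G \<rho> \<sigma>"
    by (rule exists_irreducible_list) blast
  have "Irr G \<subseteq> irr_class ` set \<sigma>s"
  proof
    fix \<Lambda> assume L: "\<Lambda> \<in> Irr G"
    from s(2)[OF class_rep(1)[OF L]] obtain \<sigma> where "\<sigma> \<in> set \<sigma>s" "rep_iso G (class_rep \<Lambda>) \<sigma>" by blast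
    then show "\<Lambda> \<in> irr_class ` set \<sigma>s" using rep_iso_class_rep_iff[OF L] s(1) by blast
  qed
  then show ?thesis by (rule finite_subset) simp
qed

lemma trivial_class: "trivial_class G = irr_class trivial_rep" "trivial_class G \<in> Irr G" "class_dim G (trivial_class G) = 1"
proof -
  show 1: "trivial_class G = irr_class trivial_rep" by (simp add: trivial_class_def irr_class_def)
  show 2: "trivial_class G \<in> Irr G" unfolding 1 by (rule irr_class_in_Irr[OF irreducible_trivial])
  have "rep_iso G (class_rep (trivial_class G)) trivial_rep"
    using rep_iso_class_rep_iff[OF 2 irreducible_trivial] 1 by simp
  then show "class_dim G (trivial_class G) = 1"
    by (simp add: class_dim_def rep_iso_dim representation_trivial)
qed

section \<open>Powers of the chain\<close>

text \<open>A decomposition of \<open>V\<close>, with the summands collected by isomorphism class.\<close>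

lemma character_expansion:
  assumes V: "representation G V" and g: "g \<in> carrier G"
  shows "character V g = (\<Sum>\<Lambda>\<in>Irr G. char_mult (class_rep \<Lambda>) (character V) * character (class_rep \<Lambda>) g)"
proof -
  obtain \<sigma>s where s: "\<And>\<sigma>. \<sigma> \<in> set \<sigma>s \<Longrightarrow> irreducible_rep G \<sigma>" "rep_iso G V (direct_sum_rep \<sigma>s)"
    using maschke[OF V] by blast
  have sr: "\<And>\<sigma>. \<sigma> \<in> set \<sigma>s \<Longrightarrow> representation G \<sigma>" using s(1) irreducible_repD(1) by blast
  have eq: "character V h = character (direct_sum_rep \<sigma>s) h" if "h \<in> carrier G" for h
    by (rule rep_iso_character[OF V representation_direct_sum[OF sr] s(2) that])
  have one: "character \<sigma> g = (\<Sum>\<Lambda>\<in>Irr G. (if rep_iso G (class_rep \<Lambda>) \<sigma> then 1 else 0) * character (class_rep \<Lambda>) g)"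
    if "\<sigma> \<in> set \<sigma>s" for \<sigma>
  proof -
    note irr = s(1)[OF that]
    have "(\<Sum>\<Lambda>\<in>Irr G. (if rep_iso G (class_rep \<Lambda>) \<sigma> then 1 else 0) * character (class_rep \<Lambda>) g)
      = (\<Sum>\<Lambda>\<in>Irr G. if \<Lambda> = irr_class \<sigma> then character \<sigma> g else 0)"
    proof (intro sum.cong refl)
      fix \<Lambda> assume L: "\<Lambda> \<in> Irr G"
      have "character (class_rep \<Lambda>) g = character \<sigma> g" if "rep_iso G (class_rep \<Lambda>) \<sigma>"
        using rep_iso_character[OF irreducible_repD(1)[OF class_rep(1)[OF L]] irreducible_repD(1)[OF irr] that g] .
      then show "(if rep_iso G (class_rep \<Lambda>) \<sigma> then 1 else 0) * character (class_rep \<Lambda>) g =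
        (if \<Lambda> = irr_class \<sigma> then character \<sigma> g else 0)"
        using rep_iso_class_rep_iff[OF L irr] by auto
    qed
    then show ?thesis using finite_Irr irr_class_in_Irr[OF irr] by simp
  qed
  have "character V g = (\<Sum>\<sigma>\<leftarrow>\<sigma>s. character \<sigma> g)"
    unfolding eq[OF g] by (rule character_direct_sum[OF sr g])
  also have "\<dots> = (\<Sum>\<sigma>\<leftarrow>\<sigma>s. \<Sum>\<Lambda>\<in>Irr G. (if rep_iso G (class_rep \<Lambda>) \<sigma> then 1 else 0) * character (class_rep \<Lambda>) g)"
    using one by (intro arg_cong[where f = sum_list] map_cong) auto
  also have "\<dots> = (\<Sum>\<Lambda>\<in>Irr G. of_nat (length (filter (rep_iso G (class_rep \<Lambda>)) \<sigma>s)) * character (class_rep \<Lambda>) g)"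
  proof -
    have *: "(\<Sum>\<sigma>\<leftarrow>xs. \<Sum>\<Lambda>\<in>Irr G. (if rep_iso G (class_rep \<Lambda>) \<sigma> then 1 else 0) * character (class_rep \<Lambda>) g) =
      (\<Sum>\<Lambda>\<in>Irr G. of_nat (length (filter (rep_iso G (class_rep \<Lambda>)) xs)) * character (class_rep \<Lambda>) g)" for xs
    proof (induction xs)
      case (Cons x xs)
      have "(\<Sum>\<sigma>\<leftarrow>x # xs. \<Sum>\<Lambda>\<in>Irr G. (if rep_iso G (class_rep \<Lambda>) \<sigma> then 1 else 0) * character (class_rep \<Lambda>) g) =
        (\<Sum>\<Lambda>\<in>Irr G. (if rep_iso G (class_rep \<Lambda>) x then 1 else 0) * character (class_rep \<Lambda>) g) +
        (\<Sum>\<Lambda>\<in>Irr G. of_nat (length (filter (rep_iso G (class_rep \<Lambda>)) xs)) * character (class_rep \<Lambda>) g)"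
        by (simp only: list.map sum_list.Cons Cons.IH)
      also have "\<dots> = (\<Sum>\<Lambda>\<in>Irr G. of_nat (length (filter (rep_iso G (class_rep \<Lambda>)) (x # xs))) * character (class_rep \<Lambda>) g)"
        unfolding sum.distrib[symmetric] by (intro sum.cong refl) (simp add: distrib_right)
      finally show ?case .
    qed simp
    show ?thesis by (rule *)
  qed
  also have "\<dots> = (\<Sum>\<Lambda>\<in>Irr G. char_mult (class_rep \<Lambda>) (character V) * character (class_rep \<Lambda>) g)"
  proof (intro sum.cong refl)
    fix \<Lambda> assume L: "\<Lambda> \<in> Irr G"
    have "char_mult (class_rep \<Lambda>) (character V) = char_mult (class_rep \<Lambda>) (character (direct_sum_rep \<sigma>s))"
      by (rule char_mult_cong[OF eq])
    also have "\<dots> = of_nat (length (filter (rep_iso G (class_rep \<Lambda>)) \<sigma>s))"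
      by (rule char_mult_direct_sum[OF class_rep(1)[OF L] s(1)])
    finally show "of_nat (length (filter (rep_iso G (class_rep \<Lambda>)) \<sigma>s)) * character (class_rep \<Lambda>) g =
      char_mult (class_rep \<Lambda>) (character V) * character (class_rep \<Lambda>) g" by simp
  qed
  finally show ?thesis .
qed

text \<open>The dimensions of the intermediate irreducibles cancel along a path of the chain. What remains is
  a sum over the last intermediate class \<open>M\<close> of the multiplicity of \<open>M\<close> in the \<open>r\<close>-th power of \<open>\<eta>\<close>
  times the multiplicity of \<open>\<Gamma>\<close> in \<open>M \<otimes> \<eta>\<close>, and this is collected by expanding the \<open>r\<close>-th power of
  the character in irreducible characters.\<close>

theorem chain_K_pow_eq:
  assumes eta: "representation G \<eta>" and L: "\<Gamma> \<in> Irr G" and D: "rep_dim G \<eta> > 0"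
  shows "of_real (chain_K_pow G \<eta> r (trivial_class G) \<Gamma>) =
    of_nat (class_dim G \<Gamma>) * char_mult (class_rep \<Gamma>) (\<lambda>g. character \<eta> g ^ r) / of_nat (rep_dim G \<eta>) ^ r"
  using L
proof (induction r arbitrary: \<Gamma>)
  case 0
  have "char_mult (class_rep \<Gamma>) (\<lambda>g. 1) = char_mult (class_rep \<Gamma>) (character trivial_rep)"
    by (simp add: character_trivial cong: char_mult_cong)
  also have "\<dots> = (if trivial_class G = \<Gamma> then 1 else 0)"
    using char_mult_character[OF class_rep(1)[OF 0] irreducible_trivial]
      rep_iso_class_rep_iff[OF 0 irreducible_trivial] trivial_class(1) by auto
  finally show ?case using trivial_class(3) by auto
next
  case (Suc r)
  obtain V where V: "representation G V" "\<And>g. g \<in> carrier G \<Longrightarrow> character V g = character \<eta> g ^ r"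
    using exists_tensor_power[OF eta, of r] by blast
  have mV: "char_mult \<rho> (\<lambda>g. character \<eta> g ^ r) = char_mult \<rho> (character V)" for \<rho>
    by (rule char_mult_cong) (simp add: V)
  let ?D = "of_nat (rep_dim G \<eta>) :: complex"
  \<comment> \<open>The factor \<open>class_dim G M\<close> of the \<open>r\<close>-step probability cancels against the denominator of the last step.\<close>
  have step: "of_real (chain_K_pow G \<eta> r (trivial_class G) M * chain_K G \<eta> M \<Gamma>) =
      of_nat (class_dim G \<Gamma>) / ?D ^ Suc r *
      (char_mult (class_rep M) (character V) * char_mult (class_rep \<Gamma>) (\<lambda>g. character (class_rep M) g * character \<eta> g))"
    if M: "M \<in> Irr G" for M
  proof -
    have dM: "class_dim G M > 0" using irreducible_repD(2)[OF class_rep(1)[OF M]] by (simp add: class_dim_def)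
    note rM = irreducible_repD(1)[OF class_rep(1)[OF M]]
    have "of_nat (multiplicity_rep G (class_rep \<Gamma>) (tensor_rep (class_rep M) \<eta>)) =
        char_mult (class_rep \<Gamma>) (character (tensor_rep (class_rep M) \<eta>))"
      by (rule multiplicity_rep_eq_char_mult[OF class_rep(1)[OF Suc(2)] representation_tensor(1)[OF rM eta]])
    also have "\<dots> = char_mult (class_rep \<Gamma>) (\<lambda>g. character (class_rep M) g * character \<eta> g)"
      by (intro char_mult_cong character_tensor rM eta)
    finally have K: "of_real (chain_K G \<eta> M \<Gamma>) = of_nat (class_dim G \<Gamma>) *
        char_mult (class_rep \<Gamma>) (\<lambda>g. character (class_rep M) g * character \<eta> g) / (of_nat (class_dim G M) * ?D)"
      by (simp add: chain_K_def)
    show ?thesis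
      using dM by (simp add: K Suc.IH[OF M] mV field_simps)
  qed
  have "of_real (chain_K_pow G \<eta> (Suc r) (trivial_class G) \<Gamma>) = of_nat (class_dim G \<Gamma>) / ?D ^ Suc r *
      (\<Sum>M\<in>Irr G. char_mult (class_rep M) (character V) * char_mult (class_rep \<Gamma>) (\<lambda>g. character (class_rep M) g * character \<eta> g))"
    unfolding chain_K_pow.simps of_real_sum sum_distrib_left by (intro sum.cong refl step)
  also have "(\<Sum>M\<in>Irr G. char_mult (class_rep M) (character V) * char_mult (class_rep \<Gamma>) (\<lambda>g. character (class_rep M) g * character \<eta> g))
      = char_mult (class_rep \<Gamma>) (\<lambda>g. \<Sum>M\<in>Irr G. char_mult (class_rep M) (character V) * (character (class_rep M) g * character \<eta> g))"
  proof -
    have "(\<Sum>M\<in>Irr G. c M * char_mult \<rho> (F M)) = char_mult \<rho> (\<lambda>g. \<Sum>M\<in>Irr G. c M * F M g)" for c \<rho> and F :: "_ \<Rightarrow> 'a \<Rightarrow> complex"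
      unfolding char_mult_def sum_divide_distrib[symmetric] times_divide_eq_right
        sum_distrib_left by (subst sum.swap) (simp add: mult_ac)
    then show ?thesis .
  qed
  also have "\<dots> = char_mult (class_rep \<Gamma>) (\<lambda>g. character \<eta> g ^ Suc r)"
  proof (rule char_mult_cong)
    fix g assume g: "g \<in> carrier G"
    have "(\<Sum>M\<in>Irr G. char_mult (class_rep M) (character V) * (character (class_rep M) g * character \<eta> g)) =
        character V g * character \<eta> g"
      unfolding character_expansion[OF V(1) g] by (simp add: sum_distrib_right mult.assoc)
    then show "(\<Sum>M\<in>Irr G. char_mult (class_rep M) (character V) * (character (class_rep M) g * character \<eta> g)) =
        character \<eta> g ^ Suc r" by (simp add: V(2)[OF g])
  qed
  finally show ?case by simp
qed

section \<open>Subgroups and class functions acting on irreducibles\<close>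

text \<open>Up to the factor \<open>card H\<close> the sum is the multiplicity of the trivial representation of \<open>H\<close> in the
  restriction of \<open>\<rho>\<close>.\<close>

lemma sum_character_subgroup:
  assumes H: "subgroup H G" and rho: "representation G \<rho>"
  obtains m :: nat where "(\<Sum>h\<in>H. character \<rho> (inv h)) = of_nat m"
proof -
  let ?H = "G\<lparr>carrier := H\<rparr>"
  interpret H: finite_group ?H
    using subgroup.subgroup_is_group[OF H is_group] finite_carrier subgroup.subset[OF H]
    by (auto simp: finite_group_def finite_group_axioms_def intro: finite_subset)
  have dim: "rep_dim ?H \<rho> = rep_dim G \<rho>" by (simp add: rep_dim_def)
  note r = representationD[OF rho]
  have HG: "h \<in> carrier G" if "h \<in> H" for h using that subgroup.subset[OF H] by blast
  have "representation ?H \<rho>"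
    by (rule H.representationI[of _ "rep_dim G \<rho>"]) (use r HG in auto)
  from H.char_mult_nat[OF H.irreducible_trivial this] obtain m :: nat
    where m: "H.char_mult trivial_rep (character \<rho>) = of_nat m" by blast
  have "(\<Sum>h\<in>H. character \<rho> h) = of_nat (m * card H)"
    using m H.card_carrier_pos by (simp add: H.char_mult_def H.character_trivial field_simps)
  moreover have "(\<Sum>h\<in>H. character \<rho> (inv h)) = (\<Sum>h\<in>H. character \<rho> h)"
    by (rule sum.reindex_bij_witness[of _ "\<lambda>h. inv h" "\<lambda>h. inv h"])
      (use HG subgroup.m_inv_closed[OF H] in auto)
  ultimately show thesis using that by metis
qed

text \<open>A class function acts on every irreducible by a scalar. The scalars are not all zero because the
  characters of the irreducibles add up, with multiplicities, to the regular character, which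
  detects the value at \<open>g0\<close>. For an irreducible with a nonzero scalar, the sum of its character over
  the inverses of \<open>S\<close> is expressed through the sums of \<open>f\<close> over the translates of \<open>S\<close>.\<close>

theorem exists_irreducible_annihilated:
  fixes f :: "'a \<Rightarrow> complex"
  assumes class_fun: "\<And>g h. g \<in> carrier G \<Longrightarrow> h \<in> carrier G \<Longrightarrow> f (h \<otimes> g \<otimes> inv h) = f g"
    and g0: "g0 \<in> carrier G" "f g0 \<noteq> 0"
  obtains \<rho> where "irreducible_rep G \<rho>"
    "\<And>S. S \<subseteq> carrier G \<Longrightarrow> (\<And>g. g \<in> carrier G \<Longrightarrow> (\<Sum>s\<in>S. f (g \<otimes> s)) = 0) \<Longrightarrow> (\<Sum>s\<in>S. character \<rho> (inv s)) = 0"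
proof -
  have scalar: "\<exists>c. \<forall>x\<in>carrier G. (\<Sum>g\<in>carrier G. f g * character \<sigma> (g \<otimes> x)) = c * character \<sigma> x"
    if sigma: "irreducible_rep G \<sigma>" for \<sigma>
  proof -
    define d where "d = rep_dim G \<sigma>"
    \<comment> \<open>The class function as a central element of the group algebra, acting on \<open>\<sigma>\<close>.\<close>
    define Z where "Z = matrix_sum d d (\<lambda>g. f g \<cdot>\<^sub>m \<sigma> g) (carrier G)"
    note r = representationD[OF irreducible_repD(1)[OF sigma], folded d_def]
    have Zc: "Z \<in> carrier_mat d d" by (simp add: Z_def)
    have fr: "f g \<cdot>\<^sub>m \<sigma> g \<in> carrier_mat d d" if "g \<in> carrier G" for g using r(2)[OF that] by simp
    have Z_mult: "Z * \<sigma> h = matrix_sum d d (\<lambda>g. f g \<cdot>\<^sub>m \<sigma> (g \<otimes> h)) (carrier G)" if h: "h \<in> carrier G" for h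
    proof -
      have "Z * \<sigma> h = matrix_sum d d (\<lambda>g. (f g \<cdot>\<^sub>m \<sigma> g) * \<sigma> h) (carrier G)"
        unfolding Z_def by (rule matrix_sum_mult[OF r(2)[OF h] fr])
      also have "\<dots> = matrix_sum d d (\<lambda>g. f g \<cdot>\<^sub>m \<sigma> (g \<otimes> h)) (carrier G)"
        by (intro matrix_sum_cong) (simp only: mult_smult_assoc_mat[OF r(2) r(2)[OF h]] r(3)[OF _ h])
      finally show ?thesis .
    qed
    have "Z * \<sigma> h = \<sigma> h * Z" if h: "h \<in> carrier G" for h
    proof -
      have cancel: "inv h \<otimes> (h \<otimes> x) = x" "h \<otimes> (inv h \<otimes> x) = x" if "x \<in> carrier G" for x
        using h that by (simp_all add: m_assoc[symmetric])
      have "Z * \<sigma> h = matrix_sum d d (\<lambda>g. f (h \<otimes> g \<otimes> inv h) \<cdot>\<^sub>m \<sigma> (h \<otimes> g \<otimes> inv h \<otimes> h)) (carrier G)"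
        unfolding Z_mult[OF h]
        using h by (intro matrix_sum_reindex[symmetric] bij_betwI[of _ _ _ "\<lambda>g. inv h \<otimes> g \<otimes> h"])
          (auto simp: m_assoc cancel)
      also have "\<dots> = matrix_sum d d (\<lambda>g. \<sigma> h * (f g \<cdot>\<^sub>m \<sigma> g)) (carrier G)"
      proof (rule matrix_sum_cong)
        fix g assume g: "g \<in> carrier G"
        have "h \<otimes> g \<otimes> inv h \<otimes> h = h \<otimes> g" using g h by (simp add: m_assoc)
        then show "f (h \<otimes> g \<otimes> inv h) \<cdot>\<^sub>m \<sigma> (h \<otimes> g \<otimes> inv h \<otimes> h) = \<sigma> h * (f g \<cdot>\<^sub>m \<sigma> g)"
          by (simp only: class_fun[OF g h] r(3)[OF h g] mult_smult_distrib[OF r(2)[OF h] r(2)[OF g]])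
      qed
      also have "\<dots> = \<sigma> h * Z" unfolding Z_def by (rule mult_matrix_sum[OF r(2)[OF h] fr, symmetric])
      finally show ?thesis .
    qed
    then obtain c where c: "Z = c \<cdot>\<^sub>m 1\<^sub>m d"
      using schur_scalar[OF sigma, of Z] Zc unfolding d_def by blast
    have "(\<Sum>g\<in>carrier G. f g * character \<sigma> (g \<otimes> x)) = c * character \<sigma> x" if x: "x \<in> carrier G" for x
    proof -
      have "c * character \<sigma> x = mat_trace (Z * \<sigma> x)"
        unfolding c using r(2)[OF x] by (simp add: mult_smult_assoc_mat[of _ d d] mat_trace_smult[of _ d] character_eq_trace)
      also have "\<dots> = (\<Sum>g\<in>carrier G. mat_trace (f g \<cdot>\<^sub>m \<sigma> (g \<otimes> x)))"
        unfolding Z_mult[OF x] using r(2) x by (intro mat_trace_matrix_sum) auto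
      also have "\<dots> = (\<Sum>g\<in>carrier G. f g * character \<sigma> (g \<otimes> x))"
        using r(2) x by (intro sum.cong) (auto simp: mat_trace_smult[of _ d] character_eq_trace)
      finally show ?thesis by simp
    qed
    then show ?thesis by blast
  qed
  obtain \<sigma>s where s: "\<And>\<sigma>. \<sigma> \<in> set \<sigma>s \<Longrightarrow> irreducible_rep G \<sigma>" "rep_iso G regular_rep (direct_sum_rep \<sigma>s)"
    by (rule exists_irreducible_list) blast
  have sr: "\<And>\<sigma>. \<sigma> \<in> set \<sigma>s \<Longrightarrow> representation G \<sigma>" using s(1) irreducible_repD(1) by blast
  \<comment> \<open>The regular character vanishes off the identity, so translating by the inverse of \<open>g0\<close> picks out \<open>f g0\<close>.\<close>
  let ?x = "inv g0"
  have "\<exists>\<sigma>\<in>set \<sigma>s. (\<Sum>g\<in>carrier G. f g * character \<sigma> (g \<otimes> ?x)) \<noteq> 0"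
  proof (rule ccontr)
    assume "\<not> ?thesis"
    then have "0 = (\<Sum>\<sigma>\<leftarrow>\<sigma>s. \<Sum>g\<in>carrier G. f g * character \<sigma> (g \<otimes> ?x))"
      by (induction \<sigma>s) auto
    also have "\<dots> = (\<Sum>g\<in>carrier G. f g * (\<Sum>\<sigma>\<leftarrow>\<sigma>s. character \<sigma> (g \<otimes> ?x)))"
      by (induction \<sigma>s) (simp_all add: sum.distrib distrib_left)
    also have "\<dots> = (\<Sum>g\<in>carrier G. if g = g0 then f g0 * of_nat (card (carrier G)) else 0)"
    proof (rule sum.cong[OF refl])
      fix g assume g: "g \<in> carrier G"
      have gx: "g \<otimes> ?x \<in> carrier G" using g g0(1) by simp
      have "(\<Sum>\<sigma>\<leftarrow>\<sigma>s. character \<sigma> (g \<otimes> ?x)) = character regular_rep (g \<otimes> ?x)"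
        using character_direct_sum[OF sr gx]
          rep_iso_character[OF representation_regular(1) representation_direct_sum[OF sr] s(2) gx] by simp
      also have "\<dots> = (if g = g0 then of_nat (card (carrier G)) else 0)"
        using inv_solve_right[of \<one> g g0] g g0(1) by (auto simp: character_regular[OF gx])
      finally show "f g * (\<Sum>\<sigma>\<leftarrow>\<sigma>s. character \<sigma> (g \<otimes> ?x)) = (if g = g0 then f g0 * of_nat (card (carrier G)) else 0)"
        by simp
    qed
    finally show False using finite_carrier g0 card_carrier_pos by simp
  qed
  then obtain \<rho> where rho: "irreducible_rep G \<rho>" and ne: "(\<Sum>g\<in>carrier G. f g * character \<rho> (g \<otimes> ?x)) \<noteq> 0"
    using s(1) by blast
  from scalar[OF rho] obtain c where
    key: "\<And>x. x \<in> carrier G \<Longrightarrow> c * character \<rho> x = (\<Sum>g\<in>carrier G. f g * character \<rho> (g \<otimes> x))" by metis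
  have c0: "c \<noteq> 0" using ne key[of ?x] g0(1) by auto
  show thesis
  proof (rule that[OF rho])
    fix S assume S: "S \<subseteq> carrier G" and zero: "\<And>g. g \<in> carrier G \<Longrightarrow> (\<Sum>s\<in>S. f (g \<otimes> s)) = 0"
    have "c * (\<Sum>s\<in>S. character \<rho> (inv s)) = (\<Sum>s\<in>S. \<Sum>g\<in>carrier G. f g * character \<rho> (g \<otimes> inv s))"
      using S by (auto simp: sum_distrib_left key intro!: sum.cong)
    also have "\<dots> = (\<Sum>s\<in>S. \<Sum>g\<in>carrier G. f (g \<otimes> s) * character \<rho> g)"
    proof (rule sum.cong[OF refl])
      fix s assume "s \<in> S"
      then have s: "s \<in> carrier G" using S by blast
      show "(\<Sum>g\<in>carrier G. f g * character \<rho> (g \<otimes> inv s)) = (\<Sum>g\<in>carrier G. f (g \<otimes> s) * character \<rho> g)"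
        by (rule sum.reindex_bij_witness[of _ "\<lambda>g. g \<otimes> s" "\<lambda>g. g \<otimes> inv s"]) (use s in \<open>auto simp: m_assoc\<close>)
    qed
    also have "\<dots> = (\<Sum>g\<in>carrier G. (\<Sum>s\<in>S. f (g \<otimes> s)) * character \<rho> g)"
      by (subst sum.swap) (simp add: sum_distrib_right)
    also have "\<dots> = 0" by (simp add: zero)
    finally show "(\<Sum>s\<in>S. character \<rho> (inv s)) = 0" using c0 by simp
  qed
qed

end

section \<open>Extensions of a finite field\<close>

lemma power_card_finite_field: "(x :: 'f::{field,finite}) ^ CARD('f) = x"
proof (cases "x = 0")
  case False
  let ?P = "\<Prod>(UNIV - {0 :: 'f})"
  have "x * ((\<Prod>y\<in>UNIV - {0}. x * y)) = x * x ^ (CARD('f) - 1) * ?P"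
    by (simp add: prod.distrib mult_ac)
  also have "(\<Prod>y\<in>UNIV - {0}. x * y) = ?P"
    by (rule prod.reindex_bij_witness[of _ "\<lambda>y. y / x" "\<lambda>y. x * y"]) (use False in auto)
  also have "x * x ^ (CARD('f) - 1) = x ^ CARD('f)"
    by (simp add: power_eq_if)
  finally show ?thesis by simp
qed (simp add: power_0_left)

lemma card_field_ge_2: "CARD('f::{field,finite}) \<ge> 2"
proof -
  have "card {0, 1 :: 'f} \<le> CARD('f)" by (intro card_mono) auto
  then show ?thesis by simp
qed

text \<open>The polynomial \<open>(X + 1)\<^sup>q - X\<^sup>q - 1\<close> has degree less than \<open>q\<close> and vanishes at all \<open>q\<close> elements of
  the field, since \<open>a\<^sup>q = a\<close>. Hence its coefficients vanish. In this way \<open>q\<close> need not be written as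
  a power of the characteristic.\<close>

lemma binomial_card_eq_0:
  assumes "0 < i" "i < CARD('f::{field,finite})"
  shows "(of_nat (CARD('f) choose i) :: 'f) = 0"
proof -
  let ?q = "CARD('f)"
  \<comment> \<open>This is \<open>(X + 1)\<^sup>q - X\<^sup>q - 1\<close>.\<close>
  define p :: "'f poly" where "p = (\<Sum>i\<in>{0<..<?q}. Polynomial.monom (of_nat (?q choose i)) i)"
  have coeff: "Polynomial.coeff p j = (if 0 < j \<and> j < ?q then of_nat (?q choose j) else 0)" for j
  proof -
    have "Polynomial.coeff p j = (\<Sum>i\<in>{0<..<?q}. if i = j then of_nat (?q choose j) else 0)"
      unfolding p_def coeff_sum by (intro sum.cong) auto
    then show ?thesis by simp
  qed
  have deg: "Polynomial.degree p < ?q"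
  proof -
    have "Polynomial.degree p \<le> ?q - 1" by (intro degree_le allI impI) (auto simp: coeff)
    then show ?thesis using card_field_ge_2[where 'f = 'f] by simp
  qed
  have root: "poly p a = 0" for a :: 'f
  proof -
    have split: "{..?q} = insert 0 (insert ?q {0<..<?q})" by auto
    have "a + 1 = (a + 1) ^ ?q" by (simp only: power_card_finite_field)
    also have "\<dots> = (\<Sum>k\<le>?q. of_nat (?q choose k) * a ^ k)"
      by (simp add: binomial_ring)
    also have "\<dots> = 1 + (a ^ ?q + (\<Sum>k\<in>{0<..<?q}. of_nat (?q choose k) * a ^ k))"
      unfolding split by (subst sum.insert; simp)+
    also have "(\<Sum>k\<in>{0<..<?q}. of_nat (?q choose k) * a ^ k) = poly p a"
      by (simp add: p_def poly_sum poly_monom)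
    finally show ?thesis by (simp add: power_card_finite_field)
  qed
  have "p = 0"
  proof (rule ccontr)
    assume "p \<noteq> 0"
    from card_poly_roots_bound[OF this] root deg show False by simp
  qed
  then show ?thesis using coeff[of i] assms by simp
qed

lemma frobenius_add:
  fixes x y :: "'f::{field,finite} alg_closure"
  shows "(x + y) ^ (CARD('f) ^ m) = x ^ (CARD('f) ^ m) + y ^ (CARD('f) ^ m)"
proof (induction m)
  case (Suc m)
  let ?q = "CARD('f)"
  have add: "(u + v) ^ ?q = u ^ ?q + v ^ ?q" for u v :: "'f alg_closure"
  proof -
    have split: "{..?q} = insert 0 (insert ?q {0<..<?q})" by auto
    have z: "of_nat (?q choose k) = (0 :: 'f alg_closure)" if "k \<in> {0<..<?q}" for k
      using arg_cong[OF binomial_card_eq_0[where 'f = 'f, of k], of to_ac] that by simp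
    have "(u + v) ^ ?q = (\<Sum>k\<le>?q. of_nat (?q choose k) * u ^ k * v ^ (?q - k))"
      by (rule binomial_ring)
    also have "\<dots> = v ^ ?q + (u ^ ?q + (\<Sum>k\<in>{0<..<?q}. of_nat (?q choose k) * u ^ k * v ^ (?q - k)))"
      unfolding split by (subst sum.insert; simp)+
    also have "(\<Sum>k\<in>{0<..<?q}. of_nat (?q choose k) * u ^ k * v ^ (?q - k)) = 0"
      by (intro sum.neutral ballI) (simp add: z)
    finally show ?thesis by simp
  qed
  have "(x + y) ^ (?q ^ Suc m) = ((x + y) ^ (?q ^ m)) ^ ?q" by (simp add: power_mult[symmetric] mult.commute)
  also have "\<dots> = x ^ (?q ^ Suc m) + y ^ (?q ^ Suc m)"
    by (simp add: Suc.IH add power_mult[symmetric] mult.commute)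
  finally show ?case .
qed simp

lemma frobenius_sum:
  fixes f :: "'b \<Rightarrow> 'f::{field,finite} alg_closure"
  shows "finite A \<Longrightarrow> (\<Sum>x\<in>A. f x) ^ (CARD('f) ^ m) = (\<Sum>x\<in>A. f x ^ (CARD('f) ^ m))"
  by (induction A rule: finite_induct) (simp_all add: frobenius_add)

lemma frobenius_to_ac: "to_ac (a :: 'f::{field,finite}) ^ (CARD('f) ^ m) = to_ac a"
proof (induction m)
  case (Suc m)
  have "to_ac a ^ (CARD('f) ^ Suc m) = (to_ac a ^ (CARD('f) ^ m)) ^ CARD('f)"
    by (simp add: power_mult[symmetric] mult.commute)
  also have "\<dots> = to_ac (a ^ CARD('f))" by (simp only: Suc.IH to_ac_power)
  finally show ?case by (simp add: power_card_finite_field)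
qed simp

lemma card_frobenius_fixed_le:
  assumes "m > 0"
  shows "finite {t :: 'f::{field,finite} alg_closure. t ^ (CARD('f) ^ m) = t}"
    "card {t :: 'f alg_closure. t ^ (CARD('f) ^ m) = t} \<le> CARD('f) ^ m"
proof -
  let ?Q = "CARD('f) ^ m"
  have Q: "?Q > 1" using assms card_field_ge_2[where 'f = 'f] by (intro one_less_power) auto
  define p :: "'f alg_closure poly" where "p = Polynomial.monom 1 ?Q - Polynomial.monom 1 1"
  have c: "Polynomial.coeff p ?Q = 1" using Q by (simp add: p_def)
  then have "p \<noteq> 0" by auto
  have deg: "Polynomial.degree p \<le> ?Q" unfolding p_def using Q by (intro degree_diff_le) (auto simp: degree_monom_eq)
  have set: "{t. poly p t = 0} = {t. t ^ ?Q = t}" by (simp add: p_def poly_monom)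
  show "finite {t :: 'f alg_closure. t ^ ?Q = t}"
    using poly_roots_finite[OF \<open>p \<noteq> 0\<close>] by (simp add: set)
  show "card {t :: 'f alg_closure. t ^ ?Q = t} \<le> ?Q"
    using card_poly_roots_bound[OF \<open>p \<noteq> 0\<close>] deg by (simp add: set)
qed

text \<open>The polynomial \<open>X\<^sup>Q - X\<close> with \<open>Q = q\<^sup>m\<close> has derivative \<open>-1\<close>, so its roots in the algebraic closure
  are simple, and there are \<open>Q\<close> of them. They form the field with \<open>q\<^sup>m\<close> elements.\<close>

lemma card_frobenius_fixed:
  assumes "m > 0"
  shows "card {t :: 'f::{field,finite} alg_closure. t ^ (CARD('f) ^ m) = t} = CARD('f) ^ m"
proof -
  let ?Q = "CARD('f) ^ m"
  have Q: "?Q > 1" using assms card_field_ge_2[where 'f = 'f] by (intro one_less_power) auto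
  have q0: "(of_nat ?Q :: 'f alg_closure) = 0"
  proof -
    have "(of_nat CARD('f) :: 'f) = 0"
      using binomial_card_eq_0[where 'f = 'f, of 1] card_field_ge_2[where 'f = 'f] by simp
    then have "(of_nat CARD('f) :: 'f alg_closure) = 0"
      by (metis to_ac_0 to_ac_of_nat)
    then show ?thesis using assms by simp
  qed
  define p :: "'f alg_closure poly" where "p = Polynomial.monom 1 ?Q - Polynomial.monom 1 1"
  have c: "Polynomial.coeff p ?Q = 1" using Q by (simp add: p_def)
  then have p0: "p \<noteq> 0" by auto
  have "Polynomial.degree p \<le> ?Q" unfolding p_def using Q by (intro degree_diff_le) (auto simp: degree_monom_eq)
  moreover have "Polynomial.degree p \<ge> ?Q" using c by (intro le_degree) simp
  ultimately have deg: "Polynomial.degree p = ?Q" by simp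
  have dp: "pderiv p = - 1" by (simp add: p_def pderiv_diff pderiv_monom q0 monom_0 one_pCons del: of_nat_power)
  have sf: "order t p \<le> 1" for t
  proof (rule ccontr)
    assume "\<not> order t p \<le> 1"
    then have "[:-t, 1:]\<^sup>2 dvd p" using order_divides[of t 2 p] by auto
    then obtain r where r: "p = [:-t, 1:] * [:-t, 1:] * r" unfolding power2_eq_square by (elim dvdE)
    have "poly (pderiv p) t = 0" unfolding r pderiv_mult by simp
    with dp show False by simp
  qed
  obtain A where A: "size A = Polynomial.degree p" "p = smult (Polynomial.lead_coeff p) (\<Prod>x\<in>#A. [:-x, 1:])"
    using alg_closed_imp_factorization[OF p0] by blast
  have "proots p = proots (\<Prod>x\<in>#A. [:-x, 1:])"
    using A(2) p0 by (metis leading_coeff_0_iff proots_smult)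
  also have "\<dots> = A"
  proof (induction A)
    case (add x A)
    have nz: "(\<Prod>x\<in>#A. [:-x, 1:]) \<noteq> 0" by auto
    have "proots (\<Prod>x\<in>#add_mset x A. [:-x, 1:]) = proots [:-x, 1:] + proots (\<Prod>x\<in>#A. [:-x, 1:])"
      by (simp only: image_mset_add_mset prod_mset.add_mset proots_mult[OF _ nz] pCons_eq_0_iff one_neq_zero simp_thms not_False_eq_True)
    then show ?case by (simp add: add.IH)
  qed simp
  finally have "proots p = A" .
  have "count A t \<le> 1" for t
    using sf[of t] \<open>proots p = A\<close> p0 by (metis count_proots)
  then have "count A t = 1" if "t \<in># A" for t
    using that by (intro le_antisym) (auto simp: Suc_le_eq)
  then have "card (set_mset A) = size A"
    by (simp add: size_multiset_overloaded_eq)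
  moreover have "set_mset A = {t. t ^ ?Q = t}"
    unfolding \<open>proots p = A\<close>[symmetric] using p0 by (simp add: set_count_proots p_def poly_monom)
  ultimately show ?thesis using A(1) deg by simp
qed

text \<open>There are fewer than \<open>q\<^sup>n\<close> elements to avoid: those fixed by a lower power of the Frobenius map
  number at most \<open>q + q\<^sup>2 + \<dots> + q\<^bsup>n-1\<^esup> < q\<^sup>n\<close>, and they include 0 and 1 unless \<open>n = 1\<close>. For \<open>n = 1\<close>
  only 0 and 1 have to be avoided, which is possible if \<open>q > 2\<close>.\<close>

lemma exists_field_generator:
  assumes n: "n \<ge> 1" and not: "\<not> (n = 1 \<and> CARD('f::{field,finite}) = 2)"
  obtains z :: "'f::{field,finite} alg_closure" where "z ^ (CARD('f) ^ n) = z" "z \<noteq> 0" "z \<noteq> 1"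
    "\<And>m. 0 < m \<Longrightarrow> m < n \<Longrightarrow> z ^ (CARD('f) ^ m) \<noteq> z"
proof -
  let ?q = "CARD('f)"
  let ?L = "\<lambda>m. {t :: 'f alg_closure. t ^ (?q ^ m) = t}"
  have q2: "?q \<ge> 2" by (rule card_field_ge_2)
  \<comment> \<open>The elements to be avoided. The last part contains 0 and 1 as well if \<open>n \<ge> 2\<close>.\<close>
  define B where "B = {0, 1 :: 'f alg_closure} \<union> (\<Union>m\<in>{0<..<n}. ?L m)"
  have fin: "finite B" unfolding B_def using card_frobenius_fixed_le(1) by auto
  have "card B < ?q ^ n"
  proof (cases "n = 1")
    case True
    then have "{0<..<n} = {}" by auto
    then have "card B \<le> 2" by (simp add: B_def card_insert_if)
    then show ?thesis using True q2 not by simp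
  next
    case False
    then have n2: "n \<ge> 2" using n by simp
    have pos: "?q ^ k > 0" for k by simp
    then have "{0, 1} \<subseteq> ?L 1" using q2 by (auto simp: power_0_left)
    then have "B = (\<Union>m\<in>{0<..<n}. ?L m)" unfolding B_def using n2 by fastforce
    then have "card B \<le> (\<Sum>m\<in>{0<..<n}. card (?L m))" by (simp add: card_UN_le)
    also have "\<dots> \<le> (\<Sum>m\<in>{0<..<n}. ?q ^ m)" by (intro sum_mono card_frobenius_fixed_le(2)) auto
    also have "\<dots> < ?q ^ n"
      using n
    proof (induction n rule: dec_induct)
      case base
      have "{0<..<Suc 0} = {}" by auto
      then show ?case using q2 by simp
    next
      case (step k)
      have "{0<..<Suc k} = insert k {0<..<k}" using step by auto
      then have "(\<Sum>m\<in>{0<..<Suc k}. ?q ^ m) = ?q ^ k + (\<Sum>m\<in>{0<..<k}. ?q ^ m)" by simp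
      also have "\<dots> < ?q ^ k + ?q ^ k" using step by simp
      also have "\<dots> \<le> ?q ^ Suc k"
        using mult_le_mono1[OF q2, of "?q ^ k"] unfolding mult_2 power_Suc .
      finally show ?case .
    qed
    finally show ?thesis .
  qed
  moreover have "n > 0" using n by simp
  ultimately have "card B < card (?L n)" by (simp only: card_frobenius_fixed[where 'f = 'f])
  then have "\<not> ?L n \<subseteq> B" using card_mono[OF fin, of "?L n"] by linarith
  then obtain z where zL: "z \<in> ?L n" and zB: "z \<notin> B" by blast
  have "z ^ (?q ^ n) = z" using zL by (rule CollectD)
  moreover have "z \<noteq> 0" "z \<noteq> 1" using zB unfolding B_def by blast+
  moreover have "z ^ (?q ^ m) \<noteq> z" if "0 < m" "m < n" for m
  proof
    assume "z ^ (?q ^ m) = z"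
    then have "z \<in> ?L m" by (rule CollectI)
    then have "z \<in> (\<Union>m\<in>{0<..<n}. ?L m)" by (rule UN_I[rotated]) (simp add: that)
    with zB show False unfolding B_def by blast
  qed
  ultimately show thesis by (rule that)
qed

section \<open>Elliptic matrices\<close>

lemma card_carrier_vec: "card (carrier_vec n :: 'f::finite vec set) = CARD('f) ^ n"
proof -
  have "bij_betw (\<lambda>f. Matrix.vec n f) ({..<n} \<rightarrow>\<^sub>E (UNIV :: 'f set)) (carrier_vec n)"
    by (rule bij_betw_byWitness[of _ "\<lambda>v. restrict (\<lambda>i. v $ i) {..<n}"])
      (auto simp: PiE_def extensional_def restrict_def fun_eq_iff intro!: eq_vecI)
  then have "card ({..<n} \<rightarrow>\<^sub>E (UNIV :: 'f set)) = card (carrier_vec n :: 'f vec set)"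
    by (rule bij_betw_same_card)
  then show ?thesis by (simp add: card_funcsetE)
qed

definition unipotent_mat :: "nat \<Rightarrow> 'f::field mat \<Rightarrow> bool" where
  "unipotent_mat n g \<longleftrightarrow> (\<forall>v\<in>carrier_vec n. \<exists>k. ((\<lambda>v. g *\<^sub>v v - v) ^^ k) v = 0\<^sub>v n)"

text \<open>Elements acting irreducibly. In dimension one every matrix does; leaving out the identity ensures
  that it counts as unipotent only.\<close>

definition elliptic_mat :: "nat \<Rightarrow> 'f::field mat \<Rightarrow> bool" where
  "elliptic_mat n g \<longleftrightarrow> g \<noteq> 1\<^sub>m n \<and>
     (\<forall>U. lin_subspace n U \<longrightarrow> (\<forall>u\<in>U. g *\<^sub>v u \<in> U) \<longrightarrow> U = {0\<^sub>v n} \<or> U = carrier_vec n)"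

definition shift_mat :: "nat \<Rightarrow> 'f::field mat" where
  "shift_mat n = mat n n (\<lambda>(i, j). if i = Suc j then 1 else 0)"

text \<open>The invertible matrices that agree with the shift \<open>e\<^sub>j \<mapsto> e\<^bsub>j+1\<^esub>\<close> on the hyperplane where the last
  coordinate vanishes: the companion matrices of the monic polynomials of degree \<open>n\<close> with nonzero
  constant coefficient.\<close>

definition companion_mats :: "nat \<Rightarrow> 'f::field mat set" where
  "companion_mats n = {Y \<in> carrier (GL n). \<forall>c\<in>carrier_vec n. c $ (n - 1) = 0 \<longrightarrow> Y *\<^sub>v c = shift_mat n *\<^sub>v c}"

lemma shift_mat_carrier [simp]: "shift_mat n \<in> carrier_mat n n"
  by (simp add: shift_mat_def)

lemma shift_mat_mult_vec:
  assumes "c \<in> carrier_vec n" "i < n"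
  shows "(shift_mat n *\<^sub>v c) $ i = (if i = 0 then 0 else (c :: 'f::field vec) $ (i - 1))"
proof -
  have "(shift_mat n *\<^sub>v c) $ i = (\<Sum>j<n. (if i = Suc j then 1 else 0) * c $ j)"
    using assms by (simp add: shift_mat_def scalar_prod_def lessThan_atLeast0)
  also have "\<dots> = (\<Sum>j<n. if j = i - 1 then (if i = 0 then 0 else c $ (i - 1)) else 0)"
    by (intro sum.cong) auto
  also have "\<dots> = (if i = 0 then 0 else c $ (i - 1))" using assms by simp
  finally show ?thesis .
qed

text \<open>Let \<open>L\<close> be the field with \<open>q\<^sup>n\<close> elements and \<open>z\<close> a generator of it. The powers \<open>1, z, \<dots>, z\<^bsup>n-1\<^esup>\<close>
  form a basis of \<open>L\<close>, because a vanishing combination is a polynomial of degree less than \<open>n\<close> with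
  the \<open>n\<close> different conjugates \<open>z\<^bsup>q\<^sup>m\<^esup>\<close> of \<open>z\<close> as roots. In this basis multiplication by \<open>z\<close> is a
  companion matrix. A subspace stable under it is an ideal of the field \<open>L\<close>, hence trivial.\<close>

lemma exists_elliptic_companion:
  assumes n: "n \<ge> 1" and not: "\<not> (n = 1 \<and> CARD('f::{field,finite}) = 2)"
  shows "\<exists>Y\<in>companion_mats n. elliptic_mat n (Y :: 'f mat)"
proof -
  let ?q = "CARD('f)"
  obtain z :: "'f alg_closure" where z: "z ^ (?q ^ n) = z" "z \<noteq> 0" "z \<noteq> 1"
    "\<And>m. 0 < m \<Longrightarrow> m < n \<Longrightarrow> z ^ (?q ^ m) \<noteq> z"
    by (rule exists_field_generator[OF n not]) blast
  \<comment> \<open>Coordinates with respect to the powers of \<open>z\<close>.\<close>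
  define ev :: "'f vec \<Rightarrow> 'f alg_closure" where "ev v = (\<Sum>i<n. to_ac (v $ i) * z ^ i)" for v
  define L where "L = {t :: 'f alg_closure. t ^ (?q ^ n) = t}"
  have ev_smult: "ev (c \<cdot>\<^sub>v v) = to_ac c * ev v" if "v \<in> carrier_vec n" for c v
    using that by (simp add: ev_def sum_distrib_left mult.assoc)
  have ev_diff: "ev (v - w) = ev v - ev w" if "v \<in> carrier_vec n" "w \<in> carrier_vec n" for v w
    using that by (simp add: ev_def sum_subtractf left_diff_distrib)
  have ev_unit: "ev (unit_vec n j) = z ^ j" if "j < n" for j
  proof -
    have "ev (unit_vec n j) = (\<Sum>i<n. if i = j then z ^ j else 0)"
      unfolding ev_def using that by (intro sum.cong) auto
    then show ?thesis using that by simp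
  qed
  have ev_mult: "ev (Q *\<^sub>v v) = (\<Sum>j<n. to_ac (v $ j) * ev (col Q j))"
    if Q: "Q \<in> carrier_mat n n" and v: "v \<in> carrier_vec n" for Q v
  proof -
    have "ev (Q *\<^sub>v v) = (\<Sum>i<n. \<Sum>j<n. to_ac (Q $$ (i, j)) * to_ac (v $ j) * z ^ i)"
      unfolding ev_def using Q v
      by (intro sum.cong) (simp_all add: scalar_prod_def lessThan_atLeast0 to_ac_sum sum_distrib_right)
    also have "\<dots> = (\<Sum>j<n. \<Sum>i<n. to_ac (Q $$ (i, j)) * to_ac (v $ j) * z ^ i)"
      by (rule sum.swap)
    also have "\<dots> = (\<Sum>j<n. to_ac (v $ j) * ev (col Q j))"
      unfolding ev_def sum_distrib_left using Q by (intro sum.cong) (simp_all add: mult_ac)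
    finally show ?thesis .
  qed
  \<comment> \<open>If two conjugates agree, a power of the Frobenius map of exponent \<open>a + (n - b) < n\<close> fixes \<open>z\<close>.\<close>
  have conj_inj: "inj_on (\<lambda>m. z ^ (?q ^ m)) {..<n}"
  proof (rule linorder_inj_onI)
    fix a b :: nat assume ab: "a < b" "a \<in> {..<n}" "b \<in> {..<n}"
    show "z ^ (?q ^ a) \<noteq> z ^ (?q ^ b)"
    proof
      assume eq: "z ^ (?q ^ a) = z ^ (?q ^ b)"
      have "z = z ^ (?q ^ (b + (n - b)))" using ab z(1) by simp
      also have "\<dots> = (z ^ (?q ^ b)) ^ (?q ^ (n - b))" by (simp only: power_add power_mult)
      also have "\<dots> = z ^ (?q ^ (a + (n - b)))" by (simp only: eq[symmetric] power_add power_mult)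
      finally have "z ^ (?q ^ (a + (n - b))) = z" by (rule sym)
      moreover have "0 < a + (n - b)" "a + (n - b) < n" using ab by auto
      then have "z ^ (?q ^ (a + (n - b))) \<noteq> z" by (rule z(4))
      ultimately show False by (rule notE[rotated])
    qed
  qed auto
  have ev_inj: "v = 0\<^sub>v n" if v: "v \<in> carrier_vec n" and v0: "ev v = 0" for v
  proof -
    define p where "p = (\<Sum>i<n. Polynomial.monom (to_ac (v $ i)) i)"
    have coeff: "Polynomial.coeff p j = (if j < n then to_ac (v $ j) else 0)" for j
    proof -
      have "Polynomial.coeff p j = (\<Sum>i<n. if i = j then to_ac (v $ j) else 0)"
        unfolding p_def coeff_sum by (intro sum.cong) auto
      then show ?thesis by simp
    qed
    have root: "poly p (z ^ (?q ^ m)) = 0" for m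
    proof -
      have "poly p (z ^ (?q ^ m)) = (\<Sum>i<n. (to_ac (v $ i) * z ^ i) ^ (?q ^ m))"
        unfolding p_def poly_sum
        by (intro sum.cong refl)
          (simp only: poly_monom power_mult_distrib frobenius_to_ac power_mult[symmetric] mult.commute)
      also have "\<dots> = ev v ^ (?q ^ m)" unfolding ev_def by (rule frobenius_sum[symmetric]) simp
      finally show ?thesis using v0 by simp
    qed
    have "p = 0"
    proof (rule ccontr)
      assume p0: "p \<noteq> 0"
      have "n = card ((\<lambda>m. z ^ (?q ^ m)) ` {..<n})" using card_image[OF conj_inj] by simp
      also have "\<dots> \<le> card {x. poly p x = 0}"
        using root by (intro card_mono poly_roots_finite[OF p0]) auto
      also have "\<dots> \<le> Polynomial.degree p" by (rule card_poly_roots_bound[OF p0])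
      also have "\<dots> \<le> n - 1" by (intro degree_le allI impI) (auto simp: coeff)
      finally show False using n by simp
    qed
    then have "to_ac (v $ j) = 0" if "j < n" for j using coeff[of j] that by simp
    then show ?thesis using v by (intro eq_vecI) auto
  qed
  have ev_inj_on: "inj_on ev (carrier_vec n)"
  proof (rule inj_onI)
    fix v w assume vw: "v \<in> carrier_vec n" "w \<in> carrier_vec n" "ev v = ev w"
    then have "v - w = 0\<^sub>v n" using ev_inj[of "v - w"] ev_diff[of v w] by simp
    then have "(v - w) $ i = 0" if "i < n" for i using that by simp
    then show "v = w" using vw by (intro eq_vecI) auto
  qed
  have ev_L: "ev v \<in> L" for v
  proof -
    have "ev v ^ (?q ^ n) = (\<Sum>i<n. (to_ac (v $ i) * z ^ i) ^ (?q ^ n))"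
      unfolding ev_def by (rule frobenius_sum) simp
    also have "\<dots> = ev v"
      unfolding ev_def
    proof (intro sum.cong refl)
      fix i
      have "(z ^ i) ^ (?q ^ n) = (z ^ (?q ^ n)) ^ i" by (simp only: power_mult[symmetric] mult.commute)
      then show "(to_ac (v $ i) * z ^ i) ^ (?q ^ n) = to_ac (v $ i) * z ^ i"
        by (simp only: power_mult_distrib frobenius_to_ac z(1))
    qed
    finally show ?thesis by (simp add: L_def)
  qed
  have surj: "ev ` carrier_vec n = L"
  proof (rule card_subset_eq)
    show "finite L" unfolding L_def using n by (intro card_frobenius_fixed_le) simp
    show "ev ` carrier_vec n \<subseteq> L" using ev_L by blast
    have "card (ev ` carrier_vec n) = ?q ^ n" by (simp only: card_image[OF ev_inj_on] card_carrier_vec)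
    also have "\<dots> = card L" unfolding L_def using n by (intro card_frobenius_fixed[symmetric]) simp
    finally show "card (ev ` carrier_vec n) = card L" .
  qed
  have zL: "z ^ j \<in> L" for j
    unfolding L_def mem_Collect_eq by (metis mult.commute power_mult z(1))
  have "\<exists>x\<in>carrier_vec n. ev x = z ^ Suc j" for j using zL[of "Suc j"] surj by (metis imageE)
  then obtain x where x: "\<And>j. x j \<in> carrier_vec n" "\<And>j. ev (x j) = z ^ Suc j" by metis
  define C where "C = mat_of_cols n (map x [0..<n])"
  have C: "C \<in> carrier_mat n n" by (auto simp: C_def)
  have colC: "col C j = x j" if "j < n" for j using that x(1) by (auto simp: C_def)
  have evC: "ev (C *\<^sub>v v) = z * ev v" if v: "v \<in> carrier_vec n" for v
  proof -
    have "ev (C *\<^sub>v v) = (\<Sum>j<n. to_ac (v $ j) * z ^ Suc j)"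
      by (simp add: ev_mult[OF C v] colC x(2))
    also have "\<dots> = z * ev v" by (simp add: ev_def sum_distrib_left mult_ac)
    finally show ?thesis .
  qed
  have Cv: "C *\<^sub>v v \<in> carrier_vec n" if "v \<in> carrier_vec n" for v using C that by simp
  have GL: "C \<in> carrier (GL n)"
    unfolding GL_iff_kernel[OF C]
  proof (intro ballI impI)
    fix v assume v: "v \<in> carrier_vec n" "C *\<^sub>v v = 0\<^sub>v n"
    have "z * ev v = ev (0\<^sub>v n)" using evC[OF v(1)] v(2) by simp
    also have "\<dots> = 0" by (simp add: ev_def)
    finally show "v = 0\<^sub>v n" using ev_inj[OF v(1)] z(2) by simp
  qed
  have companion: "C \<in> companion_mats n"
    unfolding companion_mats_def
  proof (intro CollectI conjI ballI impI GL)
    fix c :: "'f vec" assume c: "c \<in> carrier_vec n" "c $ (n - 1) = 0"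
    obtain m where m: "n = Suc m" using n by (cases n) auto
    have S: "shift_mat n *\<^sub>v c \<in> carrier_vec n" by (rule mult_mat_vec_carrier[OF shift_mat_carrier c(1)])
    have "ev (shift_mat n *\<^sub>v c) = (\<Sum>i<n. to_ac (if i = 0 then 0 else c $ (i - 1)) * z ^ i)"
      unfolding ev_def by (intro sum.cong refl) (simp only: shift_mat_mult_vec[OF c(1)] lessThan_iff)
    also have "\<dots> = (\<Sum>i<m. to_ac (c $ i) * z ^ Suc i)"
      unfolding m by (subst sum.lessThan_Suc_shift) simp
    also have "\<dots> = (\<Sum>i<n. to_ac (c $ i) * z ^ Suc i)"
      using c(2) by (simp add: m)
    also have "\<dots> = ev (C *\<^sub>v c)"
      unfolding evC[OF c(1)] by (simp add: ev_def sum_distrib_left mult_ac)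
    finally show "C *\<^sub>v c = shift_mat n *\<^sub>v c"
      using inj_onD[OF ev_inj_on _ Cv[OF c(1)] S] by simp
  qed
  have "elliptic_mat n C"
    unfolding elliptic_mat_def
  proof (intro conjI allI impI)
    show "C \<noteq> 1\<^sub>m n"
    proof
      assume "C = 1\<^sub>m n"
      then have "z * ev (unit_vec n 0) = ev (unit_vec n 0)"
        using evC[of "unit_vec n 0"] by simp
      then show False using ev_unit[of 0] n z(3) by simp
    qed
    fix U assume U: "lin_subspace n U" and stable: "\<forall>u\<in>U. C *\<^sub>v u \<in> U"
    show "U = {0\<^sub>v n} \<or> U = carrier_vec n"
    proof (cases "U = {0\<^sub>v n}")
      case False
      then obtain u where u: "u \<in> U" "u \<noteq> 0\<^sub>v n" using U unfolding lin_subspace_def by blast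
      have uc: "u \<in> carrier_vec n" using U u by (auto simp: lin_subspace_def)
      have evu: "ev u \<noteq> 0" using ev_inj[OF uc] u by blast
      \<comment> \<open>The vectors \<open>C\<^sup>j u\<close> correspond to \<open>z\<^sup>j\<close> times the element of \<open>u\<close>, and these multiples span the field.\<close>
      define y where "y j = ((\<lambda>v. C *\<^sub>v v) ^^ j) u" for j
      have y: "y j \<in> U" "ev (y j) = z ^ j * ev u" for j
      proof (induction j)
        case (Suc j)
        have "y j \<in> carrier_vec n" using Suc(1) U by (auto simp: lin_subspace_def)
        then show "y (Suc j) \<in> U" "ev (y (Suc j)) = z ^ Suc j * ev u"
          using Suc stable evC[of "y j"] by (simp_all add: y_def)
      qed (simp_all add: y_def u)
      have yc: "y j \<in> carrier_vec n" for j using y(1) U by (auto simp: lin_subspace_def)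
      define Q where "Q = mat_of_cols n (map y [0..<n])"
      have Q: "Q \<in> carrier_mat n n" by (auto simp: Q_def)
      have colQ: "col Q j = y j" if "j < n" for j using that yc by (auto simp: Q_def)
      have "w \<in> U" if w: "w \<in> carrier_vec n" for w
      proof -
        have "ev w / ev u \<in> L" using ev_L[of w] ev_L[of u] by (simp add: L_def power_divide)
        then obtain a where a: "a \<in> carrier_vec n" "ev a = ev w / ev u" using surj by (metis imageE)
        have "ev (Q *\<^sub>v a) = (\<Sum>j<n. to_ac (a $ j) * z ^ j) * ev u"
          by (simp add: ev_mult[OF Q a(1)] colQ y(2) sum_distrib_right mult.assoc)
        also have "\<dots> = ev w" using a(2) evu unfolding ev_def by simp
        finally have "Q *\<^sub>v a = w"
          using inj_onD[OF ev_inj_on, of "Q *\<^sub>v a" w] Q a(1) w by simp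
        moreover have "Q *\<^sub>v a \<in> U"
          by (rule lin_subspace_mult_vec[OF U Q, of n]) (use colQ y a in auto)
        ultimately show ?thesis by simp
      qed
      then show ?thesis using U by (auto simp: lin_subspace_def)
    qed simp
  qed
  with companion show ?thesis by blast
qed

section \<open>Unipotent matrices and maps given on a hyperplane\<close>

lemma lin_subspaceD:
  assumes "lin_subspace n U"
  shows "u \<in> U \<Longrightarrow> u \<in> carrier_vec n" "0\<^sub>v n \<in> U" "u \<in> U \<Longrightarrow> v \<in> U \<Longrightarrow> u + v \<in> U"
    "u \<in> U \<Longrightarrow> c \<cdot>\<^sub>v u \<in> U" "u \<in> U \<Longrightarrow> v \<in> U \<Longrightarrow> u - v \<in> U" "u \<in> U \<Longrightarrow> - u \<in> U"
proof -
  show c: "u \<in> U \<Longrightarrow> u \<in> carrier_vec n" for u using assms by (auto simp: lin_subspace_def)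
  show "0\<^sub>v n \<in> U" using assms by (auto simp: lin_subspace_def)
  show a: "u \<in> U \<Longrightarrow> v \<in> U \<Longrightarrow> u + v \<in> U" for u v using assms by (auto simp: lin_subspace_def)
  show s: "u \<in> U \<Longrightarrow> c \<cdot>\<^sub>v u \<in> U" for u c using assms by (auto simp: lin_subspace_def)
  have "- u = (- 1) \<cdot>\<^sub>v u" for u :: "'a vec" by (intro eq_vecI) auto
  then show m: "u \<in> U \<Longrightarrow> - u \<in> U" for u using s[of u "-1"] by simp
  show "u \<in> U \<Longrightarrow> v \<in> U \<Longrightarrow> u - v \<in> U"
    using a[of u "- v"] m[of v] c[of u] c[of v] by (simp add: minus_add_uminus_vec)
qed

lemma card_fixed_vectors:
  fixes g :: "'f::{field,finite} mat"
  assumes g: "g \<in> carrier_mat n n"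
  shows "card {v \<in> carrier_vec n. g *\<^sub>v v = v} = CARD('f) ^ fixed_dim n g"
proof -
  have "(g - 1\<^sub>m n) *\<^sub>v v = 0\<^sub>v n \<longleftrightarrow> g *\<^sub>v v = v" if v: "v \<in> carrier_vec n" for v
  proof -
    have "(g - 1\<^sub>m n) *\<^sub>v v = g *\<^sub>v v - v"
      using g v by (simp add: minus_mult_distrib_mat_vec)
    moreover have "g *\<^sub>v v - v = 0\<^sub>v n \<longleftrightarrow> g *\<^sub>v v = v"
      using g v by (auto simp: vec_eq_iff)
    ultimately show ?thesis by simp
  qed
  then have "{v \<in> carrier_vec n. g *\<^sub>v v = v} = mat_kernel (g - 1\<^sub>m n)"
    using g by (auto simp: mat_kernel_def)
  then show ?thesis
    unfolding fixed_dim_def using g by (simp add: card_mat_kernel[of _ n n] minus_carrier_mat)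
qed

lemma displacement_add:
  fixes g :: "'f::field mat"
  assumes "g \<in> carrier_mat n n" "v \<in> carrier_vec n" "w \<in> carrier_vec n"
  shows "g *\<^sub>v (v + w) - (v + w) = (g *\<^sub>v v - v) + (g *\<^sub>v w - w)"
  using assms by (intro eq_vecI) (auto simp: mult_add_distrib_mat_vec)

lemma displacement_smult:
  fixes g :: "'f::field mat"
  assumes "g \<in> carrier_mat n n" "v \<in> carrier_vec n"
  shows "g *\<^sub>v (c \<cdot>\<^sub>v v) - c \<cdot>\<^sub>v v = c \<cdot>\<^sub>v (g *\<^sub>v v - v)"
  using assms by (intro eq_vecI) (auto simp: mult_mat_vec right_diff_distrib)

text \<open>The last nonzero iterate of \<open>u \<mapsto> g u - u\<close>.\<close>

lemma unipotent_fixed_vector: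
  fixes g :: "'f::field mat"
  assumes uni: "unipotent_mat n g" and U: "U \<subseteq> carrier_vec n" "\<And>u. u \<in> U \<Longrightarrow> g *\<^sub>v u - u \<in> U"
    and u: "u \<in> U" "u \<noteq> 0\<^sub>v n" and g: "g \<in> carrier_mat n n"
  obtains w where "w \<in> U" "w \<noteq> 0\<^sub>v n" "g *\<^sub>v w = w"
proof -
  let ?N = "\<lambda>v. g *\<^sub>v v - v"
  define k where "k = (LEAST k. (?N ^^ k) u = 0\<^sub>v n)"
  have ex: "\<exists>k. (?N ^^ k) u = 0\<^sub>v n" using uni u U by (auto simp: unipotent_mat_def)
  have k0: "(?N ^^ k) u = 0\<^sub>v n" unfolding k_def by (rule LeastI_ex[OF ex])
  then have "k \<noteq> 0" using u by (intro notI) simp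
  then obtain j where j: "k = Suc j" by (cases k) auto
  have inU: "(?N ^^ i) u \<in> U" for i by (induction i) (use u U in auto)
  define w where "w = (?N ^^ j) u"
  have w: "w \<in> U" using inU by (simp add: w_def)
  have "w \<noteq> 0\<^sub>v n" unfolding w_def using not_less_Least[of j "\<lambda>k. (?N ^^ k) u = 0\<^sub>v n"] j by (simp add: k_def)
  moreover have "g *\<^sub>v w - w = 0\<^sub>v n" using k0 by (simp add: j w_def)
  then have "(g *\<^sub>v w - w) $ i = 0" if "i < n" for i using that by simp
  then have "g *\<^sub>v w = w" using w U g by (intro eq_vecI) auto
  ultimately show thesis using w that by blast
qed

lemma unipotent_imp_GL:
  fixes g :: "'f::field mat"
  assumes g: "g \<in> carrier_mat n n" and uni: "unipotent_mat n g"
  shows "g \<in> carrier (GL n)"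
  unfolding GL_iff_kernel[OF g]
proof (intro ballI impI, rule ccontr)
  fix v assume v: "v \<in> carrier_vec n" "g *\<^sub>v v = 0\<^sub>v n" "v \<noteq> 0\<^sub>v n"
  define U where "U = {v \<in> carrier_vec n. g *\<^sub>v v = 0\<^sub>v n}"
  have sub: "U \<subseteq> carrier_vec n" by (auto simp: U_def)
  have st: "g *\<^sub>v u - u \<in> U" if "u \<in> U" for u
  proof -
    have u: "u \<in> carrier_vec n" "g *\<^sub>v u = 0\<^sub>v n" using that by (auto simp: U_def)
    have "g *\<^sub>v (0\<^sub>v n - u) = g *\<^sub>v 0\<^sub>v n - g *\<^sub>v u" using g u by (intro mult_minus_distrib_mat_vec) auto
    also have "\<dots> = 0\<^sub>v n" using g u by (intro eq_vecI) auto
    finally show ?thesis using g u by (simp add: U_def)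
  qed
  have "v \<in> U" using v by (simp add: U_def)
  from unipotent_fixed_vector[OF uni sub st this v(3) g] obtain w where "w \<in> U" "w \<noteq> 0\<^sub>v n" "g *\<^sub>v w = w" by blast
  then show False by (simp add: U_def)
qed

definition hyperplane :: "nat \<Rightarrow> 'f::field vec \<Rightarrow> 'f vec set" where
  "hyperplane n l = {w \<in> carrier_vec n. l \<bullet> w = 0}"

text \<open>The matrix \<open>g\<close> stands for the map that it induces on the hyperplane.\<close>

definition extensions :: "nat \<Rightarrow> 'f::field vec \<Rightarrow> 'f mat \<Rightarrow> 'f mat set" where
  "extensions n l g = {h \<in> carrier (GL n). \<forall>w\<in>hyperplane n l. h *\<^sub>v w = g *\<^sub>v w}"

text \<open>The largest subspace of the hyperplane that is stable under \<open>g\<close>. All extensions of the restriction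
  of \<open>g\<close> to the hyperplane have the same core.\<close>

definition stable_core :: "nat \<Rightarrow> 'f::field vec \<Rightarrow> 'f mat \<Rightarrow> 'f vec set" where
  "stable_core n l g = {w \<in> carrier_vec n. \<forall>i. l \<bullet> ((g ^\<^sub>m i) *\<^sub>v w) = 0}"

lemma lin_subspace_hyperplane: "l \<in> carrier_vec n \<Longrightarrow> lin_subspace n (hyperplane n l)"
  by (auto simp: lin_subspace_def hyperplane_def scalar_prod_add_distrib[of _ n])

lemma pow_mat_Suc_vec:
  fixes g :: "'f::field mat"
  assumes "g \<in> carrier_mat n n" "w \<in> carrier_vec n"
  shows "(g ^\<^sub>m Suc i) *\<^sub>v w = (g ^\<^sub>m i) *\<^sub>v (g *\<^sub>v w)"
  using assms by (simp add: assoc_mult_mat_vec[of _ n n])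

lemma lin_subspace_stable_core:
  fixes g :: "'f::field mat"
  assumes l: "l \<in> carrier_vec n" and g: "g \<in> carrier_mat n n"
  shows "lin_subspace n (stable_core n l g)"
proof -
  have p: "g ^\<^sub>m i \<in> carrier_mat n n" for i using g by (rule pow_carrier_mat)
  have c: "(g ^\<^sub>m i) *\<^sub>v w \<in> carrier_vec n" if "w \<in> carrier_vec n" for i w by (rule mult_mat_vec_carrier[OF p that])
  have z: "(g ^\<^sub>m i) *\<^sub>v 0\<^sub>v n = 0\<^sub>v n" for i by (rule mult_zero_vec[OF p])
  show ?thesis
    unfolding lin_subspace_def stable_core_def
    by (auto simp: z l mult_add_distrib_mat_vec[OF p] mult_mat_vec[OF p] scalar_prod_add_distrib[OF l c c]
        scalar_prod_smult_distrib[OF l c])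
qed

lemma stable_core_subset: "g \<in> carrier_mat n n \<Longrightarrow> stable_core n l g \<subseteq> hyperplane n l"
proof
  fix w assume g: "g \<in> carrier_mat n n" and "w \<in> stable_core n l g"
  then have "w \<in> carrier_vec n" "l \<bullet> ((g ^\<^sub>m 0) *\<^sub>v w) = 0" unfolding stable_core_def by blast+
  then show "w \<in> hyperplane n l" using g by (simp add: hyperplane_def)
qed

lemma stable_core_stable:
  fixes g :: "'f::field mat"
  assumes "g \<in> carrier_mat n n" "w \<in> stable_core n l g"
  shows "g *\<^sub>v w \<in> stable_core n l g"
proof -
  have w: "w \<in> carrier_vec n" "\<And>i. l \<bullet> ((g ^\<^sub>m Suc i) *\<^sub>v w) = 0"
    using assms unfolding stable_core_def by blast+
  then show ?thesis
    using assms(1) unfolding stable_core_def pow_mat_Suc_vec[OF assms(1) w(1)] by simp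
qed

lemma stable_core_maximal:
  fixes g :: "'f::field mat"
  assumes g: "g \<in> carrier_mat n n" and U: "U \<subseteq> hyperplane n l" "\<And>u. u \<in> U \<Longrightarrow> g *\<^sub>v u \<in> U"
  shows "U \<subseteq> stable_core n l g"
proof
  fix u assume u: "u \<in> U"
  have *: "(g ^\<^sub>m i) *\<^sub>v u \<in> U" if "u \<in> U" for i u
    using that
  proof (induction i arbitrary: u)
    case 0
    then have "u \<in> carrier_vec n" using U by (auto simp: hyperplane_def)
    then show ?case using g 0 by simp
  next
    case (Suc i)
    then have "u \<in> carrier_vec n" using U by (auto simp: hyperplane_def)
    then show ?case unfolding pow_mat_Suc_vec[OF g \<open>u \<in> carrier_vec n\<close>] using Suc U(2) by blast
  qed
  then show "u \<in> stable_core n l g" using *[OF u] u U by (auto simp: stable_core_def hyperplane_def)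
qed

text \<open>The core together with \<open>w\<close> spans a subspace of the hyperplane that is stable under \<open>g\<close>, so \<open>w\<close>
  lies in the core by maximality.\<close>

lemma displacement_in_core:
  fixes g :: "'f::field mat"
  assumes l: "l \<in> carrier_vec n" and g: "g \<in> carrier_mat n n" and w: "w \<in> hyperplane n l"
    and d: "g *\<^sub>v w - w \<in> stable_core n l g"
  shows "w \<in> stable_core n l g"
proof -
  let ?A = "stable_core n l g"
  note A = lin_subspaceD[OF lin_subspace_stable_core[OF l g]]
  have wc: "w \<in> carrier_vec n" using w by (simp add: hyperplane_def)
  define U where "U = {u \<in> carrier_vec n. \<exists>c. u - c \<cdot>\<^sub>v w \<in> ?A}"
  have "U \<subseteq> ?A"
  proof (rule stable_core_maximal[OF g])
    show "U \<subseteq> hyperplane n l"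
    proof
      fix u assume "u \<in> U"
      then obtain c where u: "u \<in> carrier_vec n" "u - c \<cdot>\<^sub>v w \<in> ?A" by (auto simp: U_def)
      then have "l \<bullet> (u - c \<cdot>\<^sub>v w) = 0" using stable_core_subset[OF g, of l] by (auto simp: hyperplane_def)
      moreover have "l \<bullet> (u - c \<cdot>\<^sub>v w) = l \<bullet> u - c * (l \<bullet> w)"
        using l u wc by (simp add: scalar_prod_minus_distrib[of _ n])
      ultimately show "u \<in> hyperplane n l" using u w by (simp add: hyperplane_def)
    qed
    fix u assume "u \<in> U"
    then obtain c where u: "u \<in> carrier_vec n" "u - c \<cdot>\<^sub>v w \<in> ?A" by (auto simp: U_def)
    have "g *\<^sub>v u - c \<cdot>\<^sub>v w = g *\<^sub>v (u - c \<cdot>\<^sub>v w) + c \<cdot>\<^sub>v (g *\<^sub>v w - w)"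
      using g u wc by (intro eq_vecI) (auto simp: mult_minus_distrib_mat_vec[of _ n n] mult_mat_vec[of _ n n] right_diff_distrib)
    also have "\<dots> \<in> ?A" by (rule A(3)[OF stable_core_stable[OF g u(2)] A(4)[OF d]])
    finally show "g *\<^sub>v u \<in> U" using g u by (auto simp: U_def)
  qed
  moreover have "w \<in> U"
  proof -
    have "w - 1 \<cdot>\<^sub>v w = 0\<^sub>v n" using wc by (intro eq_vecI) auto
    then have "w - 1 \<cdot>\<^sub>v w \<in> ?A" using A(2) by simp
    then show ?thesis using wc unfolding U_def by blast
  qed
  ultimately show ?thesis by blast
qed

text \<open>The matrix of \<open>v \<mapsto> h v + (l \<bullet> v) a\<close>, which agrees with \<open>h\<close> on the hyperplane.\<close>

definition rank_one_update :: "nat \<Rightarrow> 'f::field vec \<Rightarrow> 'f mat \<Rightarrow> 'f vec \<Rightarrow> 'f mat" where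
  "rank_one_update n l h a = h + mat n n (\<lambda>(i, j). a $ i * l $ j)"

lemma rank_one_update_carrier [simp]: "rank_one_update n l h a \<in> carrier_mat n n"
  by (simp add: rank_one_update_def)

lemma rank_one_update_mult_vec:
  fixes h :: "'f::field mat"
  assumes "h \<in> carrier_mat n n" "a \<in> carrier_vec n" "l \<in> carrier_vec n" "v \<in> carrier_vec n"
  shows "rank_one_update n l h a *\<^sub>v v = h *\<^sub>v v + (l \<bullet> v) \<cdot>\<^sub>v a"
proof (rule eq_vecI)
  fix i assume "i < dim_vec (h *\<^sub>v v + (l \<bullet> v) \<cdot>\<^sub>v a)"
  then have i: "i < n" using assms by simp
  have "(rank_one_update n l h a *\<^sub>v v) $ i = (\<Sum>j<n. (h $$ (i, j) + a $ i * l $ j) * v $ j)"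
    using assms i by (simp add: rank_one_update_def scalar_prod_def lessThan_atLeast0)
  also have "\<dots> = (\<Sum>j<n. h $$ (i, j) * v $ j) + (\<Sum>j<n. l $ j * v $ j) * a $ i"
    by (simp only: distrib_right sum.distrib sum_distrib_right mult.assoc mult.commute[of "a $ i"])
  also have "\<dots> = (h *\<^sub>v v + (l \<bullet> v) \<cdot>\<^sub>v a) $ i"
    using assms i by (simp add: scalar_prod_def lessThan_atLeast0)
  finally show "(rank_one_update n l h a *\<^sub>v v) $ i = (h *\<^sub>v v + (l \<bullet> v) \<cdot>\<^sub>v a) $ i" .
qed (use assms in \<open>auto simp: rank_one_update_def\<close>)

lemma rank_one_update_cancel:
  assumes "h \<in> carrier_mat n n" "a \<in> carrier_vec n"
  shows "rank_one_update n l (rank_one_update n l h a) (- a) = h"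
    "rank_one_update n l (rank_one_update n l h (- a)) a = (h :: 'f::field mat)"
  using assms by (auto simp: rank_one_update_def intro!: eq_matI)

lemma extensionsD:
  assumes "h \<in> extensions n l g"
  shows "h \<in> carrier (GL n)" "h \<in> carrier_mat n n" "w \<in> hyperplane n l \<Longrightarrow> h *\<^sub>v w = g *\<^sub>v w"
  using assms by (auto simp: extensions_def GL_iff)

text \<open>Modulo the core the update by an element of the core changes nothing, and on the core the matrices
  \<open>h\<close> and its update agree. So the iterated displacement of the update reaches the core after as
  many steps as that of \<open>h\<close> needs to reach 0, and from then on coincides with that of \<open>h\<close>.\<close>

lemma rank_one_update_unipotent_extension:
  fixes g :: "'f::field mat"
  assumes l: "l \<in> carrier_vec n" and g: "g \<in> carrier_mat n n"
    and h: "h \<in> extensions n l g" "unipotent_mat n h" and a: "a \<in> stable_core n l g"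
  shows "rank_one_update n l h a \<in> extensions n l g" "unipotent_mat n (rank_one_update n l h a)"
proof -
  let ?A = "stable_core n l g" and ?h = "rank_one_update n l h a"
  note A = lin_subspaceD[OF lin_subspace_stable_core[OF l g]]
  note hc = extensionsD[OF h(1)]
  have ac: "a \<in> carrier_vec n" by (rule A(1)[OF a])
  note up = rank_one_update_mult_vec[OF hc(2) ac l]
  have AW: "x \<in> hyperplane n l" if "x \<in> ?A" for x using that stable_core_subset[OF g, of l] by blast
  have upW: "?h *\<^sub>v w = g *\<^sub>v w" if w: "w \<in> hyperplane n l" for w
  proof -
    have wc: "w \<in> carrier_vec n" "l \<bullet> w = 0" using w by (auto simp: hyperplane_def)
    have "?h *\<^sub>v w = g *\<^sub>v w + 0 \<cdot>\<^sub>v a" using up[OF wc(1)] wc hc(3)[OF w] by simp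
    also have "\<dots> = g *\<^sub>v w" using g wc ac by (intro eq_vecI) auto
    finally show ?thesis .
  qed
  have iter_c: "((\<lambda>v. M *\<^sub>v v - v) ^^ j) v \<in> carrier_vec n" if "M \<in> carrier_mat n n" "v \<in> carrier_vec n" for M :: "'f mat" and v j
    by (induction j) (use that in auto)
  \<comment> \<open>The displacements of both matrices stay congruent modulo the core.\<close>
  have near: "((\<lambda>v. ?h *\<^sub>v v - v) ^^ j) v - ((\<lambda>v. h *\<^sub>v v - v) ^^ j) v \<in> ?A" if v: "v \<in> carrier_vec n" for v j
  proof (induction j)
    case 0
    then show ?case using v A(2) by simp
  next
    case (Suc j)
    define x y where xy: "x = ((\<lambda>v. ?h *\<^sub>v v - v) ^^ j) v" "y = ((\<lambda>v. h *\<^sub>v v - v) ^^ j) v"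
    have c: "x \<in> carrier_vec n" "y \<in> carrier_vec n"
      unfolding xy using iter_c[OF _ v] hc(2) by auto
    have xyA: "x - y \<in> ?A" using Suc by (simp add: xy)
    have "?h *\<^sub>v x - x - (h *\<^sub>v y - y) = (g *\<^sub>v (x - y) - (x - y)) + (l \<bullet> x) \<cdot>\<^sub>v a"
    proof -
      have "g *\<^sub>v (x - y) = h *\<^sub>v (x - y)" using hc(3)[OF AW[OF xyA]] by simp
      also have "\<dots> = h *\<^sub>v x - h *\<^sub>v y" using hc(2) c by (intro mult_minus_distrib_mat_vec) auto
      finally have "g *\<^sub>v (x - y) = h *\<^sub>v x - h *\<^sub>v y" .
      then show ?thesis using up[OF c(1)] hc(2) c ac by (intro eq_vecI) auto
    qed
    also have "\<dots> \<in> ?A" by (rule A(3)[OF A(5)[OF stable_core_stable[OF g xyA] xyA] A(4)[OF a]])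
    finally show ?case by (simp add: xy)
  qed
  show uni: "unipotent_mat n ?h"
    unfolding unipotent_mat_def
  proof
    fix v :: "'f vec" assume v: "v \<in> carrier_vec n"
    obtain k where k: "((\<lambda>v. h *\<^sub>v v - v) ^^ k) v = 0\<^sub>v n" using h(2) v by (auto simp: unipotent_mat_def)
    define x where "x = ((\<lambda>v. ?h *\<^sub>v v - v) ^^ k) v"
    have xc: "x \<in> carrier_vec n" unfolding x_def using iter_c[OF _ v] by simp
    have "x - 0\<^sub>v n \<in> ?A" using near[OF v, of k] k by (simp add: x_def)
    then have xA: "x \<in> ?A" using xc by simp
    have same: "((\<lambda>v. ?h *\<^sub>v v - v) ^^ j) x = ((\<lambda>v. h *\<^sub>v v - v) ^^ j) x \<and> ((\<lambda>v. h *\<^sub>v v - v) ^^ j) x \<in> ?A" for j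
    proof (induction j)
      case (Suc j)
      let ?y = "((\<lambda>v. h *\<^sub>v v - v) ^^ j) x"
      have "?h *\<^sub>v ?y = g *\<^sub>v ?y" "h *\<^sub>v ?y = g *\<^sub>v ?y"
        using upW[OF AW] hc(3)[OF AW] Suc by blast+
      then show ?case using Suc stable_core_stable[OF g] A(5) by simp
    qed (simp add: xA)
    obtain m where "((\<lambda>v. h *\<^sub>v v - v) ^^ m) x = 0\<^sub>v n" using h(2) xc by (auto simp: unipotent_mat_def)
    then have "((\<lambda>v. ?h *\<^sub>v v - v) ^^ (m + k)) v = 0\<^sub>v n"
      using same[of m] by (simp add: funpow_add x_def)
    then show "\<exists>k. ((\<lambda>v. ?h *\<^sub>v v - v) ^^ k) v = 0\<^sub>v n" by blast
  qed
  show "?h \<in> extensions n l g"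
    unfolding extensions_def using unipotent_imp_GL[OF _ uni] upW by simp
qed

section \<open>Weighted counts of unipotent extensions\<close>

text \<open>Up to sign this is the value of a cuspidal character of \<open>GL(n,q)\<close> at a unipotent element with a
  fixed space of dimension \<open>k \<ge> 1\<close>, a Green polynomial. What matters is that the value at 1 is 1,
  that no value is zero, and the recursion in \<open>k\<close>.\<close>

definition green_weight :: "nat \<Rightarrow> nat \<Rightarrow> complex" where
  "green_weight q k = (\<Prod>i\<in>{1..<k}. 1 - of_nat q ^ i)"

lemma green_weight_Suc: "k \<ge> 1 \<Longrightarrow> green_weight q (Suc k) = green_weight q k * (1 - of_nat q ^ k)"
  by (simp add: green_weight_def prod.atLeastLessThan_Suc)

lemma green_weight_1 [simp]: "green_weight q (Suc 0) = 1"
  by (simp add: green_weight_def)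

lemma green_weight_nonzero: "q \<ge> 2 \<Longrightarrow> green_weight q k \<noteq> 0"
proof -
  assume q: "q \<ge> 2"
  have "(of_nat q ^ i :: complex) \<noteq> 1" if "i \<ge> 1" for i
  proof -
    have "q ^ i > 1" using q that by (intro one_less_power) auto
    then have "(of_nat (q ^ i) :: complex) \<noteq> 1" by (metis of_nat_eq_1_iff less_irrefl)
    then show ?thesis by (simp only: of_nat_power not_False_eq_True)
  qed
  then show ?thesis by (auto simp: green_weight_def)
qed

text \<open>The functional \<open>l\<close> maps \<open>S\<close> onto the field, with kernel \<open>S \<inter> hyperplane n l\<close>.\<close>

lemma card_subspace_off_hyperplane:
  fixes S :: "'f::{field,finite} vec set"
  assumes S: "lin_subspace n S" and l: "l \<in> carrier_vec n" and b: "b \<in> S" "b \<notin> hyperplane n l"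
  shows "card S = CARD('f) * card (S \<inter> hyperplane n l)"
proof -
  note SD = lin_subspaceD[OF S]
  have lb: "l \<bullet> b \<noteq> 0" using b SD(1) by (auto simp: hyperplane_def)
  define b' where "b' = (1 / (l \<bullet> b)) \<cdot>\<^sub>v b"
  have b': "b' \<in> S" "b' \<in> carrier_vec n" "l \<bullet> b' = 1"
    using SD(4)[OF b(1)] SD(1)[OF b(1)] l lb by (auto simp: b'_def)
  have "bij_betw (\<lambda>(c, k). c \<cdot>\<^sub>v b' + k) ((UNIV :: 'f set) \<times> (S \<inter> hyperplane n l)) S"
  proof (rule bij_betw_byWitness[of _ "\<lambda>v. (l \<bullet> v, v - (l \<bullet> v) \<cdot>\<^sub>v b')"])
    show "\<forall>x\<in>UNIV \<times> (S \<inter> hyperplane n l).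
        (\<lambda>v. (l \<bullet> v, v - (l \<bullet> v) \<cdot>\<^sub>v b')) ((\<lambda>(c, k). c \<cdot>\<^sub>v b' + k) x) = x"
    proof clarify
      fix c k assume "k \<in> hyperplane n l"
      then have k: "k \<in> carrier_vec n" "l \<bullet> k = 0" by (simp_all add: hyperplane_def)
      have "l \<bullet> (c \<cdot>\<^sub>v b' + k) = c" using k b' l by (simp add: scalar_prod_add_distrib[of _ n])
      moreover have "c \<cdot>\<^sub>v b' + k - c \<cdot>\<^sub>v b' = k" using k b' by (intro eq_vecI) auto
      ultimately show "l \<bullet> (c \<cdot>\<^sub>v b' + k) = c \<and> c \<cdot>\<^sub>v b' + k - (l \<bullet> (c \<cdot>\<^sub>v b' + k)) \<cdot>\<^sub>v b' = k" by simp
    qed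
    show "\<forall>v\<in>S. (\<lambda>(c, k). c \<cdot>\<^sub>v b' + k) (l \<bullet> v, v - (l \<bullet> v) \<cdot>\<^sub>v b') = v"
    proof clarify
      fix v assume "v \<in> S"
      then show "(l \<bullet> v) \<cdot>\<^sub>v b' + (v - (l \<bullet> v) \<cdot>\<^sub>v b') = v"
        using SD(1)[of v] b'(2) by (intro eq_vecI) auto
    qed
    show "(\<lambda>(c, k). c \<cdot>\<^sub>v b' + k) ` (UNIV \<times> (S \<inter> hyperplane n l)) \<subseteq> S"
      using SD(3,4) b'(1) by auto
    show "(\<lambda>v. (l \<bullet> v, v - (l \<bullet> v) \<cdot>\<^sub>v b')) ` S \<subseteq> UNIV \<times> (S \<inter> hyperplane n l)"
    proof (rule image_subsetI)
      fix v assume v: "v \<in> S"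
      have "v - (l \<bullet> v) \<cdot>\<^sub>v b' \<in> S" by (rule SD(5)[OF v SD(4)[OF b'(1)]])
      moreover have "l \<bullet> (v - (l \<bullet> v) \<cdot>\<^sub>v b') = 0"
        using SD(1)[OF v] b' l by (simp add: scalar_prod_minus_distrib[of _ n])
      ultimately show "(l \<bullet> v, v - (l \<bullet> v) \<cdot>\<^sub>v b') \<in> UNIV \<times> (S \<inter> hyperplane n l)"
        using SD(1) by (simp add: hyperplane_def)
    qed
  qed
  from bij_betw_same_card[OF this] show ?thesis by (simp add: card_cartesian_product)
qed

text \<open>All updates have the same fixed vectors on the hyperplane, \<open>q\<^sup>k\<close> in number, so each has a fixed
  space of dimension \<open>k\<close> or \<open>k + 1\<close>, where \<open>k \<ge> 1\<close> because \<open>h\<close> fixes a nonzero vector of the core.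
  If \<open>B\<close> is the set of updates with dimension \<open>k + 1\<close>, then counting pairs of an update and a vector
  fixed by it shows that the core has \<open>q\<^sup>k\<close> times as many elements as \<open>B\<close>. The average of the
  weights is therefore the weight of \<open>k\<close> times \<open>q\<^bsup>-k\<^esup> (1 - q\<^sup>k) + (1 - q\<^bsup>-k\<^esup>) = 0\<close>.\<close>

lemma sum_green_weight_updates:
  fixes g :: "'f::{field,finite} mat"
  assumes l: "l \<in> carrier_vec n" "e \<in> carrier_vec n" "l \<bullet> e = 1" and g: "g \<in> carrier_mat n n"
    and ne: "stable_core n l g \<noteq> {0\<^sub>v n}"
    and h: "h \<in> extensions n l g" "unipotent_mat n h"
  shows "(\<Sum>a\<in>stable_core n l g. green_weight CARD('f) (fixed_dim n (rank_one_update n l h a))) = 0"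
proof -
  let ?q = "CARD('f)" and ?A = "stable_core n l g" and ?W = "hyperplane n l"
  let ?up = "\<lambda>a. rank_one_update n l h a"
  let ?fix = "\<lambda>a. {v \<in> carrier_vec n. ?up a *\<^sub>v v = v}"
  note A = lin_subspaceD[OF lin_subspace_stable_core[OF l(1) g]]
  note hc = extensionsD[OF h(1)]
  have q2: "?q \<ge> 2" by (rule card_field_ge_2)
  have finC: "finite (carrier_vec n :: 'f vec set)" by (rule finite_carrier_vec_finite_field)
  have finA: "finite ?A" using finite_subset[OF _ finC] A(1) by blast
  have AW: "?A \<subseteq> ?W" by (rule stable_core_subset[OF g])
  have WC: "?W \<subseteq> carrier_vec n" by (auto simp: hyperplane_def)
  have hA: "h *\<^sub>v a = g *\<^sub>v a" if "a \<in> ?A" for a using hc(3) AW that by blast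
  have disp: "?up a *\<^sub>v v = v \<longleftrightarrow> (l \<bullet> v) \<cdot>\<^sub>v a = v - h *\<^sub>v v" if a: "a \<in> ?A" and v: "v \<in> carrier_vec n" for a v
    unfolding rank_one_update_mult_vec[OF hc(2) A(1)[OF a] l(1) v] vec_eq_iff
    using A(1)[OF a] v hc(2) by (auto simp: algebra_simps)
  define K where "K = {v \<in> ?W. g *\<^sub>v v = v}"
  have fixW: "?fix a \<inter> ?W = K" if a: "a \<in> ?A" for a
  proof -
    have "?up a *\<^sub>v v = g *\<^sub>v v" if v: "v \<in> ?W" for v
      using extensionsD(3)[OF rank_one_update_unipotent_extension(1)[OF l(1) g h a] v] .
    then show ?thesis using WC by (auto simp: K_def)
  qed
  have fix_sub: "lin_subspace n (?fix a)" for a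
    by (auto simp: lin_subspace_def mult_zero_vec[OF rank_one_update_carrier]
        mult_add_distrib_mat_vec[OF rank_one_update_carrier] mult_mat_vec[OF rank_one_update_carrier])
  have fix_card: "?q ^ fixed_dim n (?up a) = card (?fix a)" for a
    by (rule card_fixed_vectors[symmetric]) simp
  have fix_cases: "card (?fix a) = card K \<or> card (?fix a) = ?q * card K" if a: "a \<in> ?A" for a
  proof (cases "?fix a \<subseteq> ?W")
    case True
    then show ?thesis using fixW[OF a] by (simp add: Int_absorb2)
  next
    case False
    then show ?thesis using card_subspace_off_hyperplane[OF fix_sub l(1)] fixW[OF a] by blast
  qed
  obtain a1 where a1: "a1 \<in> ?A" "a1 \<noteq> 0\<^sub>v n" using ne A(2) by blast
  obtain k1 where k1: "k1 \<in> ?A" "k1 \<noteq> 0\<^sub>v n" "h *\<^sub>v k1 = k1"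
  proof (rule unipotent_fixed_vector[OF h(2) _ _ a1 hc(2)])
    show "?A \<subseteq> carrier_vec n" using A(1) by blast
    show "h *\<^sub>v u - u \<in> ?A" if "u \<in> ?A" for u
      unfolding hA[OF that] by (rule A(5)[OF stable_core_stable[OF g that] that])
  qed blast
  have K2: "card K \<ge> 2"
  proof -
    have "{0\<^sub>v n, k1} \<subseteq> K" using k1 hA A(2) AW mult_zero_vec[OF g] by (auto simp: K_def)
    moreover have "finite K" using finite_subset[OF _ finC] WC by (auto simp: K_def)
    ultimately have "card {0\<^sub>v n, k1} \<le> card K" by (intro card_mono)
    then show ?thesis using k1(2) by (simp add: card_insert_if split: if_splits)
  qed
  obtain k where k: "card K = ?q ^ k" "k \<ge> 1"
  proof -
    have "\<exists>k. card K = ?q ^ k"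
    proof (cases "card (?fix (0\<^sub>v n)) = card K")
      case True
      then show ?thesis using fix_card[of "0\<^sub>v n"] by metis
    next
      case False
      then have eq: "?q * card K = ?q ^ fixed_dim n (?up (0\<^sub>v n))"
        using fix_cases[OF A(2)] fix_card[of "0\<^sub>v n"] by simp
      then have "fixed_dim n (?up (0\<^sub>v n)) \<noteq> 0" using q2 by (intro notI) simp
      then obtain j where "fixed_dim n (?up (0\<^sub>v n)) = Suc j" by (cases "fixed_dim n (?up (0\<^sub>v n))") auto
      then show ?thesis using eq by auto
    qed
    then obtain k where "card K = ?q ^ k" by blast
    moreover from this K2 have "k \<noteq> 0" by (intro notI) simp
    ultimately show thesis using that by simp
  qed
  define B where "B = {a \<in> ?A. fixed_dim n (?up a) = Suc k}"
  have dim: "fixed_dim n (?up a) = (if a \<in> B then Suc k else k)" if a: "a \<in> ?A" for a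
  proof -
    have "?q ^ fixed_dim n (?up a) = ?q ^ k \<or> ?q ^ fixed_dim n (?up a) = ?q ^ Suc k"
      using fix_cases[OF a] by (simp only: fix_card k(1) power_Suc)
    then have "fixed_dim n (?up a) = k \<or> fixed_dim n (?up a) = Suc k"
      using q2 by (simp only: power_inject_exp)
    then show ?thesis using a by (auto simp: B_def)
  qed
  \<comment> \<open>The vectors that \<open>h\<close> moves by an element of the core form a subspace which meets the
    hyperplane in the core only; as \<open>h\<close> is unipotent on the quotient, it is not
    contained in the hyperplane.\<close>
  define V where "V = {v \<in> carrier_vec n. h *\<^sub>v v - v \<in> ?A}"
  have V: "lin_subspace n V"
    unfolding lin_subspace_def V_def
    using A(2,3,4) by (auto simp: displacement_add[OF hc(2)] displacement_smult[OF hc(2)] mult_zero_vec[OF hc(2)])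
  have VW: "V \<inter> ?W = ?A"
  proof
    show "V \<inter> ?W \<subseteq> ?A" using displacement_in_core[OF l(1) g] hc(3) by (auto simp: V_def)
    show "?A \<subseteq> V \<inter> ?W"
      using AW A(1) hA A(5)[OF stable_core_stable[OF g]] by (auto simp: V_def)
  qed
  have "\<not> V \<subseteq> ?W"
  proof
    assume "V \<subseteq> ?W"
    then have VA: "V \<subseteq> ?A" using VW by blast
    let ?N = "\<lambda>v. h *\<^sub>v v - v"
    obtain k where "(?N ^^ k) e = 0\<^sub>v n" using h(2) l by (auto simp: unipotent_mat_def)
    then have "(?N ^^ k) e \<in> ?A" using A(2) by simp
    then have "e \<in> ?A"
    proof (induction k)
      case (Suc k)
      have "(?N ^^ k) e \<in> carrier_vec n" by (induction k) (use l hc(2) in auto)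
      then have "(?N ^^ k) e \<in> V" using Suc.prems by (simp add: V_def)
      then show ?case using VA Suc.IH by blast
    qed simp
    then show False using AW l by (auto simp: hyperplane_def)
  qed
  then obtain b where "b \<in> V" "b \<notin> ?W" by blast
  from card_subspace_off_hyperplane[OF V l(1) this] have cardV: "card V = ?q * card ?A" by (simp add: VW)
  \<comment> \<open>Counting the pairs of an update and a vector fixed by it in two ways.\<close>
  have per_vector: "card {a \<in> ?A. ?up a *\<^sub>v v = v} = (if v \<in> K then card ?A else if v \<in> V - ?W then 1 else 0)"
    if v: "v \<in> carrier_vec n" for v
  proof (cases "v \<in> ?W")
    case True
    have "?up a *\<^sub>v v = v \<longleftrightarrow> v \<in> K" if "a \<in> ?A" for a using fixW[OF that] True v by blast
    then have "{a \<in> ?A. ?up a *\<^sub>v v = v} = (if v \<in> K then ?A else {})" by auto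
    then show ?thesis using True by simp
  next
    case False
    define c where "c = l \<bullet> v"
    have c0: "c \<noteq> 0" using False v by (simp add: c_def hyperplane_def)
    have vK: "v \<notin> K" using False by (simp add: K_def)
    have sol: "?up a *\<^sub>v v = v \<longleftrightarrow> a = (- (1 / c)) \<cdot>\<^sub>v (h *\<^sub>v v - v)" if a: "a \<in> ?A" for a
      unfolding disp[OF a v] c_def[symmetric] unfolding vec_eq_iff
      using A(1)[OF a] v hc(2) c0 by (auto simp: field_simps)
    show ?thesis
    proof (cases "v \<in> V")
      case True
      then have "(- (1 / c)) \<cdot>\<^sub>v (h *\<^sub>v v - v) \<in> ?A" using A(4) by (simp add: V_def)
      then have "{a \<in> ?A. ?up a *\<^sub>v v = v} = {(- (1 / c)) \<cdot>\<^sub>v (h *\<^sub>v v - v)}" using sol by blast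
      then show ?thesis using True False vK by simp
    next
      case vV: False
      have "?up a *\<^sub>v v \<noteq> v" if a: "a \<in> ?A" for a
      proof
        assume "?up a *\<^sub>v v = v"
        then have "a = (- (1 / c)) \<cdot>\<^sub>v (h *\<^sub>v v - v)" using sol[OF a] by simp
        then have "h *\<^sub>v v - v = (- c) \<cdot>\<^sub>v a" using v hc(2) c0 by (intro eq_vecI) auto
        then show False using A(4)[OF a] v vV by (simp add: V_def)
      qed
      then have "{a \<in> ?A. ?up a *\<^sub>v v = v} = {}" by blast
      then show ?thesis using vK vV by (simp only: card.empty if_False Diff_iff simp_thms)
    qed
  qed
  have count: "(\<Sum>a\<in>?A. card (?fix a)) = card K * card ?A + card (V - ?W)"
  proof -
    have "(\<Sum>a\<in>?A. card (?fix a)) = (\<Sum>a\<in>?A. \<Sum>v\<in>carrier_vec n. if ?up a *\<^sub>v v = v then 1 else 0)"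
      using finC by (simp add: sum.If_cases Int_def)
    also have "\<dots> = (\<Sum>v\<in>carrier_vec n. \<Sum>a\<in>?A. if ?up a *\<^sub>v v = v then 1 else 0)" by (rule sum.swap)
    also have "\<dots> = (\<Sum>v\<in>carrier_vec n. card {a \<in> ?A. ?up a *\<^sub>v v = v})"
      using finA by (simp add: sum.If_cases Int_def)
    also have "\<dots> = (\<Sum>v\<in>carrier_vec n. (if v \<in> K then card ?A else 0) + (if v \<in> V - ?W then 1 else 0))"
      by (intro sum.cong refl) (auto simp: per_vector K_def)
    also have "\<dots> = (\<Sum>v\<in>carrier_vec n \<inter> K. card ?A) + (\<Sum>v\<in>carrier_vec n \<inter> (V - ?W). 1)"
      unfolding sum.distrib using finC by (simp only: sum.inter_restrict)
    also have "carrier_vec n \<inter> K = K" using WC by (auto simp: K_def)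
    also have "carrier_vec n \<inter> (V - ?W) = V - ?W" by (auto simp: V_def)
    finally show ?thesis by simp
  qed
  have cardVW: "card (V - ?W) + card ?A = ?q * card ?A"
  proof -
    have "finite V" using finite_subset[OF _ finC] by (auto simp: V_def)
    then have "card V = card (V \<inter> ?W) + card (V - ?W)" by (rule card_Int_Diff)
    then show ?thesis using cardV by (simp add: VW)
  qed
  have BA: "B \<subseteq> ?A" "finite B" using finA by (auto simp: B_def)
  have sum_B: "(\<Sum>a\<in>?A. if a \<in> B then x else y) = of_nat (card B) * x + (of_nat (card ?A) - of_nat (card B)) * y"
    for x y :: complex
  proof -
    have "(\<Sum>a\<in>?A. if a \<in> B then x else y) = of_nat (card (?A \<inter> B)) * x + of_nat (card (?A - B)) * y"
      using finA by (simp add: sum.If_cases Diff_eq)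
    also have "?A \<inter> B = B" using BA by blast
    also have "card (?A - B) = card ?A - card B" using BA finA by (intro card_Diff_subset)
    finally show ?thesis using card_mono[OF finA BA(1)] by (simp add: of_nat_diff)
  qed
  have size: "of_nat (card B) * of_nat ?q ^ k = (of_nat (card ?A) :: complex)"
  proof -
    have "(\<Sum>a\<in>?A. of_nat (card (?fix a)) :: complex) = (\<Sum>a\<in>?A. if a \<in> B then of_nat ?q ^ Suc k else of_nat ?q ^ k)"
    proof (rule sum.cong[OF refl])
      fix a assume "a \<in> ?A"
      from dim[OF this] show "(of_nat (card (?fix a)) :: complex) = (if a \<in> B then of_nat ?q ^ Suc k else of_nat ?q ^ k)"
        unfolding fix_card[symmetric] by simp
    qed
    moreover have "(\<Sum>a\<in>?A. of_nat (card (?fix a)) :: complex) = of_nat ?q ^ k * of_nat (card ?A) + of_nat (card (V - ?W))"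
      using arg_cong[OF count, of "of_nat :: nat \<Rightarrow> complex"] by (simp add: k(1))
    moreover have "(of_nat (card (V - ?W)) :: complex) = of_nat ?q * of_nat (card ?A) - of_nat (card ?A)"
      using arg_cong[OF cardVW, of "of_nat :: nat \<Rightarrow> complex"] by (simp add: algebra_simps)
    ultimately have "(of_nat ?q - 1) * (of_nat (card B) * of_nat ?q ^ k) = (of_nat ?q - 1) * (of_nat (card ?A) :: complex)"
      by (simp add: sum_B algebra_simps)
    moreover have "(of_nat ?q - 1 :: complex) \<noteq> 0" using q2 by (auto simp: of_nat_eq_1_iff)
    ultimately show ?thesis by simp
  qed
  have "(\<Sum>a\<in>?A. green_weight ?q (fixed_dim n (?up a))) =
      (\<Sum>a\<in>?A. if a \<in> B then green_weight ?q (Suc k) else green_weight ?q k)"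
    by (intro sum.cong refl) (simp add: dim)
  also have "\<dots> = green_weight ?q k * (of_nat (card ?A) - of_nat (card B) * of_nat ?q ^ k)"
    by (simp add: sum_B green_weight_Suc[OF k(2)] algebra_simps)
  also have "\<dots> = 0" by (simp add: size)
  finally show ?thesis .
qed

lemma finite_GL: "finite (carrier (GL n :: 'f::{field,finite} mat monoid))"
proof -
  have "carrier (GL n :: 'f mat monoid) \<subseteq> (\<lambda>vs. mat_of_rows n vs) ` {vs. set vs \<subseteq> carrier_vec n \<and> length vs = n}"
  proof
    fix g :: "'f mat" assume "g \<in> carrier (GL n)"
    then have "dim_row g = n" "dim_col g = n" by (auto simp: GL_iff)
    then have "g = mat_of_rows n (rows g)" "set (rows g) \<subseteq> carrier_vec n" "length (rows g) = n"
      using mat_of_rows_rows[of g] rows_carrier[of g] length_rows[of g] by simp_all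
    then show "g \<in> (\<lambda>vs. mat_of_rows n vs) ` {vs. set vs \<subseteq> carrier_vec n \<and> length vs = n}" by blast
  qed
  then show ?thesis
    by (rule finite_subset) (intro finite_imageI finite_lists_length_eq finite_carrier_vec_finite_field)
qed

lemma finite_extensions: "finite (extensions n l g :: 'f::{field,finite} mat set)"
  by (rule finite_subset[OF _ finite_GL]) (auto simp: extensions_def)

text \<open>The updates by the vectors of the core permute the unipotent extensions, so the sum can be
  averaged over the core, and each average vanishes.\<close>

lemma sum_unipotent_extensions:
  fixes g :: "'f::{field,finite} mat"
  assumes l: "l \<in> carrier_vec n" "e \<in> carrier_vec n" "l \<bullet> e = 1" and g: "g \<in> carrier_mat n n"
    and ne: "stable_core n l g \<noteq> {0\<^sub>v n}"
  shows "(\<Sum>h\<in>{h \<in> extensions n l g. unipotent_mat n h}. green_weight CARD('f) (fixed_dim n h)) = 0"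
proof -
  let ?A = "stable_core n l g" and ?Y = "{h \<in> extensions n l g. unipotent_mat n h}"
  let ?F = "\<lambda>h. green_weight CARD('f) (fixed_dim n h)" and ?up = "rank_one_update n l"
  note A = lin_subspaceD[OF lin_subspace_stable_core[OF l(1) g]]
  have finA: "finite ?A"
    using finite_subset[OF _ finite_carrier_vec_finite_field] A(1) by blast
  have "(\<Sum>h\<in>?Y. ?F (?up h a)) = (\<Sum>h\<in>?Y. ?F h)" if a: "a \<in> ?A" for a
  proof (rule sum.reindex_bij_witness[of _ "\<lambda>h. ?up h (- a)" "\<lambda>h. ?up h a"])
    fix h assume h: "h \<in> ?Y"
    have hc: "h \<in> carrier_mat n n" using h extensionsD(2) by blast
    show "?up (?up h a) (- a) = h" "?up (?up h (- a)) a = h"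
      using rank_one_update_cancel[OF hc A(1)[OF a]] by simp_all
    show "?up h a \<in> ?Y" using rank_one_update_unipotent_extension[OF l(1) g _ _ a] h by blast
    show "?up h (- a) \<in> ?Y" using rank_one_update_unipotent_extension[OF l(1) g _ _ A(6)[OF a]] h by blast
  qed simp
  then have "of_nat (card ?A) * (\<Sum>h\<in>?Y. ?F h) = (\<Sum>a\<in>?A. \<Sum>h\<in>?Y. ?F (?up h a))"
    by simp
  also have "\<dots> = (\<Sum>h\<in>?Y. \<Sum>a\<in>?A. ?F (?up h a))" by (rule sum.swap)
  also have "\<dots> = 0"
  proof (rule sum.neutral, rule ballI)
    fix h assume "h \<in> ?Y"
    then have "h \<in> extensions n l g" "unipotent_mat n h" by simp_all
    then show "(\<Sum>a\<in>?A. ?F (?up h a)) = 0" by (rule sum_green_weight_updates[OF l g ne])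
  qed
  finally have "of_nat (card ?A) * (\<Sum>h\<in>?Y. ?F h) = 0" .
  moreover have "card ?A > 0" using finA A(2) by (auto simp: card_gt_0_iff)
  ultimately show ?thesis by simp
qed

text \<open>The core is stable under every extension, it is nonzero, and it is contained in a hyperplane.\<close>

lemma no_elliptic_extension:
  fixes g :: "'f::field mat"
  assumes l: "l \<in> carrier_vec n" "e \<in> carrier_vec n" "l \<bullet> e = 1" and g: "g \<in> carrier_mat n n"
    and ne: "stable_core n l g \<noteq> {0\<^sub>v n}" and h: "h \<in> extensions n l g"
  shows "\<not> elliptic_mat n h"
proof
  assume ell: "elliptic_mat n h"
  let ?A = "stable_core n l g"
  have sub: "?A \<subseteq> hyperplane n l" by (rule stable_core_subset[OF g])
  have "\<forall>u\<in>?A. h *\<^sub>v u \<in> ?A"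
    using extensionsD(3)[OF h] sub stable_core_stable[OF g] by (metis subsetD)
  then have "?A = carrier_vec n"
    using ell ne lin_subspace_stable_core[OF l(1) g] unfolding elliptic_mat_def by blast
  then have "e \<in> hyperplane n l" using sub l by blast
  with l show False by (simp add: hyperplane_def)
qed

section \<open>Extensions of a map with trivial core\<close>

text \<open>The square matrix with rows \<open>u 0, \<dots>, u (k - 1), 0, \<dots>, 0\<close> is singular since its last row vanishes.\<close>

lemma common_zero:
  fixes u :: "nat \<Rightarrow> 'f::field vec"
  assumes u: "\<And>i. i < k \<Longrightarrow> u i \<in> carrier_vec n" and k: "k < n"
  obtains v where "v \<in> carrier_vec n" "v \<noteq> 0\<^sub>v n" "\<And>i. i < k \<Longrightarrow> u i \<bullet> v = 0"
proof -
  define M where "M = mat n n (\<lambda>(i, j). if i < k then u i $ j else 0)"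
  have M: "M \<in> carrier_mat n n" by (simp add: M_def)
  have "transpose_mat M *\<^sub>v unit_vec n (n - 1) = 0\<^sub>v n"
  proof (rule eq_vecI)
    fix i assume "i < dim_vec (0\<^sub>v n :: 'f vec)"
    then have i: "i < n" by simp
    have "(transpose_mat M *\<^sub>v unit_vec n (n - 1)) $ i = transpose_mat M $$ (i, n - 1)"
      using M i k by (intro index_mult_unit_vec[of _ n n]) auto
    then show "(transpose_mat M *\<^sub>v unit_vec n (n - 1)) $ i = 0\<^sub>v n $ i"
      using i k by (simp add: M_def)
  qed (simp add: M_def)
  moreover have "unit_vec n (n - 1) \<noteq> (0\<^sub>v n :: 'f vec)" using k by simp
  moreover have "transpose_mat M \<in> carrier_mat n n" using M by simp
  ultimately have "det (transpose_mat M) = 0"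
    using det_0_iff_vec_prod_zero_field unit_vec_carrier by blast
  then have "det M = 0" using det_transpose[OF M] by simp
  then obtain v where v: "v \<in> carrier_vec n" "v \<noteq> 0\<^sub>v n" "M *\<^sub>v v = 0\<^sub>v n"
    using det_0_iff_vec_prod_zero_field[OF M] by blast
  have "u i \<bullet> v = 0" if i: "i < k" for i
  proof -
    have "row M i = u i" using i k u[OF i] by (intro eq_vecI) (auto simp: M_def)
    then have "u i \<bullet> v = (M *\<^sub>v v) $ i" using M i k by simp
    then show ?thesis using v i k by simp
  qed
  with v that show thesis by blast
qed

text \<open>A basis in which \<open>g\<close> acts on the hyperplane as the shift. The vectors \<open>v\<close> for which \<open>v, g v, \<dots>,
  g\<^bsup>n-2\<^esup> v\<close> lie in the hyperplane are subject to \<open>n - 1\<close> linear conditions, so there is one with \<open>v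
  \<noteq> 0\<close>. The basis consists of the vectors \<open>g\<^sup>i v\<close> for \<open>i < n\<close>: if they were dependent, the first few
  of them would span a nonzero subspace of the hyperplane stable under \<open>g\<close>, against the triviality
  of the core.\<close>

lemma trivial_core_basis:
  fixes g :: "'f::field mat"
  assumes l: "l \<in> carrier_vec n" "e \<in> carrier_vec n" "l \<bullet> e = 1" and g: "g \<in> carrier_mat n n"
    and core: "stable_core n l g = {0\<^sub>v n}" and n: "n \<ge> 1"
  obtains B lam where "B \<in> carrier (GL n)" "lam \<noteq> 0"
    "\<And>c. c \<in> carrier_vec n \<Longrightarrow> l \<bullet> (B *\<^sub>v c) = lam * c $ (n - 1)"
    "\<And>c. c \<in> carrier_vec n \<Longrightarrow> c $ (n - 1) = 0 \<Longrightarrow> g *\<^sub>v (B *\<^sub>v c) = B *\<^sub>v (shift_mat n *\<^sub>v c)"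
proof -
  have p: "g ^\<^sub>m i \<in> carrier_mat n n" for i using g by (rule pow_carrier_mat)
  have pt: "transpose_mat (g ^\<^sub>m i) \<in> carrier_mat n n" for i using p[of i] by simp
  obtain v where v: "v \<in> carrier_vec n" "v \<noteq> 0\<^sub>v n"
    "\<And>i. i < n - 1 \<Longrightarrow> (transpose_mat (g ^\<^sub>m i) *\<^sub>v l) \<bullet> v = 0"
    by (rule common_zero[of "n - 1" "\<lambda>i. transpose_mat (g ^\<^sub>m i) *\<^sub>v l" n])
      (use mult_mat_vec_carrier[OF pt l(1)] n in auto)
  define x where "x i = (g ^\<^sub>m i) *\<^sub>v v" for i
  have xc: "x i \<in> carrier_vec n" for i unfolding x_def by (rule mult_mat_vec_carrier[OF p v(1)])
  have lx: "l \<bullet> x i = 0" if "i < n - 1" for i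
    using v(3)[OF that] transpose_vec_mult_scalar[OF p[of i] v(1) l(1)] by (simp add: x_def)
  have x0: "x 0 = v" using v g by (simp add: x_def)
  have gx: "g *\<^sub>v x i = x (Suc i)" for i
  proof (induction i)
    case 0
    show ?case unfolding x0 using g v(1) by (simp add: x_def)
  next
    case (Suc i)
    have comm: "g * g ^\<^sub>m k = g ^\<^sub>m k * g" for k
    proof (induction k)
      case (Suc k)
      have "g * (g ^\<^sub>m k * g) = (g * g ^\<^sub>m k) * g" by (rule assoc_mult_mat[OF g p g, symmetric])
      then show ?case using Suc by simp
    qed (use g in simp)
    have "g *\<^sub>v x (Suc i) = (g * g ^\<^sub>m Suc i) *\<^sub>v v"
      unfolding x_def by (rule assoc_mult_mat_vec[OF g p v(1), symmetric])
    also have "\<dots> = x (Suc (Suc i))" by (simp add: comm[of "Suc i"] x_def del: pow_mat.simps(2)) (simp add: comm[of "Suc i", simplified])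
    finally show ?case .
  qed
  define B where "B = mat_of_cols n (map x [0..<n])"
  have B: "B \<in> carrier_mat n n" by (auto simp: B_def)
  have colB: "col B j = x j" if "j < n" for j using that xc by (auto simp: B_def)
  have hyp: "lin_subspace n (hyperplane n l)" by (rule lin_subspace_hyperplane[OF l(1)])
  have B_GL: "B \<in> carrier (GL n)"
    unfolding GL_iff_kernel[OF B]
  proof (intro ballI impI, rule ccontr)
    fix c assume c: "c \<in> carrier_vec n" "B *\<^sub>v c = 0\<^sub>v n" "c \<noteq> 0\<^sub>v n"
    have "\<exists>j<n. c $ j \<noteq> 0"
    proof (rule ccontr)
      assume "\<not> ?thesis"
      then have "c = 0\<^sub>v n" using c(1) by (intro eq_vecI) auto
      with c(3) show False by simp
    qed
    then have ne: "{j. j < n \<and> c $ j \<noteq> 0} \<noteq> {}" by blast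
    \<comment> \<open>The last index in a linear relation: \<open>x j\<close> is a combination of its predecessors, so their span is stable.\<close>
    define j where "j = Max {j. j < n \<and> c $ j \<noteq> 0}"
    have "j \<in> {j. j < n \<and> c $ j \<noteq> 0}" unfolding j_def by (rule Max_in[OF _ ne]) simp
    then have j: "j < n" "c $ j \<noteq> 0" by auto
    have above: "c $ i = 0" if "j < i" "i < n" for i
    proof (rule ccontr)
      assume "c $ i \<noteq> 0"
      then have "i \<le> j" unfolding j_def using that by (intro Max_ge) auto
      with that show False by simp
    qed
    define U where "U = {B *\<^sub>v d | d. d \<in> carrier_vec n \<and> (\<forall>i. j \<le> i \<longrightarrow> i < n \<longrightarrow> d $ i = 0)}"
    have U: "lin_subspace n U"
      unfolding lin_subspace_def
    proof (intro conjI ballI allI)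
      show "U \<subseteq> carrier_vec n" using B by (auto simp: U_def)
      show "0\<^sub>v n \<in> U" unfolding U_def
        by (rule CollectI, rule exI[of _ "0\<^sub>v n"]) (simp add: mult_zero_vec[OF B])
      fix a b assume "a \<in> U" "b \<in> U"
      then obtain d d' where d: "a = B *\<^sub>v d" "d \<in> carrier_vec n" "\<forall>i. j \<le> i \<longrightarrow> i < n \<longrightarrow> d $ i = 0"
        "b = B *\<^sub>v d'" "d' \<in> carrier_vec n" "\<forall>i. j \<le> i \<longrightarrow> i < n \<longrightarrow> d' $ i = 0" by (auto simp: U_def)
      then show "a + b \<in> U" unfolding U_def
        by (intro CollectI exI[of _ "d + d'"]) (auto simp: mult_add_distrib_mat_vec[OF B])
    next
      fix s a assume "a \<in> U"
      then obtain d where d: "a = B *\<^sub>v d" "d \<in> carrier_vec n" "\<forall>i. j \<le> i \<longrightarrow> i < n \<longrightarrow> d $ i = 0"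
        by (auto simp: U_def)
      then show "s \<cdot>\<^sub>v a \<in> U" unfolding U_def
        by (intro CollectI exI[of _ "s \<cdot>\<^sub>v d"]) (auto simp: mult_mat_vec[OF B])
    qed
    have xU: "x i \<in> U" if "i < j" for i
    proof -
      have "B *\<^sub>v unit_vec n i = x i" using mult_unit_vec[OF B, of i] that j colB[of i] by simp
      then show ?thesis unfolding U_def using that j by (intro CollectI exI[of _ "unit_vec n i"]) auto
    qed
    have xjU: "x j \<in> U"
    proof -
      define d where "d = Matrix.vec n (\<lambda>i. if i = j then 0 else - (c $ i / c $ j))"
      have dc: "d \<in> carrier_vec n" by (simp add: d_def)
      have "d = (- (1 / c $ j)) \<cdot>\<^sub>v c + unit_vec n j"
        using j c(1) by (intro eq_vecI) (auto simp: d_def)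
      then have "B *\<^sub>v d = B *\<^sub>v ((- (1 / c $ j)) \<cdot>\<^sub>v c) + B *\<^sub>v unit_vec n j"
        using c(1) by (simp add: mult_add_distrib_mat_vec[OF B])
      also have "B *\<^sub>v ((- (1 / c $ j)) \<cdot>\<^sub>v c) = 0\<^sub>v n"
        unfolding mult_mat_vec[OF B c(1)] c(2) by (intro eq_vecI) auto
      also have "B *\<^sub>v unit_vec n j = x j" using mult_unit_vec[OF B, of j] j colB[of j] by simp
      also have "0\<^sub>v n + x j = x j" using xc by simp
      finally have "B *\<^sub>v d = x j" .
      moreover have "\<forall>i. j \<le> i \<longrightarrow> i < n \<longrightarrow> d $ i = 0" using above by (auto simp: d_def)
      ultimately show ?thesis unfolding U_def using dc by (intro CollectI exI[of _ d]) auto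
    qed
    have UW: "U \<subseteq> hyperplane n l"
    proof
      fix a assume "a \<in> U"
      then obtain d where d: "a = B *\<^sub>v d" "d \<in> carrier_vec n" "\<And>i. j \<le> i \<Longrightarrow> i < n \<Longrightarrow> d $ i = 0"
        by (auto simp: U_def)
      show "a \<in> hyperplane n l" unfolding d(1)
        by (rule lin_subspace_mult_vec[OF hyp B, of j]) (use d colB lx xc j in \<open>auto simp: hyperplane_def\<close>)
    qed
    have gU: "g *\<^sub>v a \<in> U" if "a \<in> U" for a
    proof -
      from that obtain d where d: "a = B *\<^sub>v d" "d \<in> carrier_vec n" "\<And>i. j \<le> i \<Longrightarrow> i < n \<Longrightarrow> d $ i = 0"
        by (auto simp: U_def)
      have "g *\<^sub>v a = (g * B) *\<^sub>v d" unfolding d(1) by (rule assoc_mult_mat_vec[OF g B d(2), symmetric])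
      also have "\<dots> \<in> U"
      proof (rule lin_subspace_mult_vec[OF U mult_carrier_mat[OF g B], of j])
        fix i assume i: "i < j"
        then have "col (g * B) i = x (Suc i)" using j colB gx by (simp add: col_mult2[OF g B])
        then show "col (g * B) i \<in> U" using xU[of "Suc i"] xjU i by (cases "Suc i = j") auto
      qed (use d j in auto)
      finally show ?thesis .
    qed
    have "U \<subseteq> stable_core n l g" by (rule stable_core_maximal[OF g UW gU])
    moreover have "v \<in> U" using xU[of 0] xjU x0 by (cases "j = 0") auto
    ultimately show False using core v(2) by blast
  qed
  define lam where "lam = l \<bullet> x (n - 1)"
  have form: "l \<bullet> (B *\<^sub>v c) = lam * c $ (n - 1)" if c: "c \<in> carrier_vec n" for c
  proof -
    define c' where "c' = c - c $ (n - 1) \<cdot>\<^sub>v unit_vec n (n - 1)"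
    have cc': "c' \<in> carrier_vec n" using c by (simp add: c'_def)
    have "B *\<^sub>v c' \<in> hyperplane n l"
    proof (rule lin_subspace_mult_vec[OF hyp B, of "n - 1"])
      fix i assume "n - 1 \<le> i" "i < n"
      then have "i = n - 1" by simp
      then show "c' $ i = 0" using c n by (simp add: c'_def)
    qed (use cc' colB lx xc in \<open>auto simp: hyperplane_def\<close>)
    then have z: "l \<bullet> (B *\<^sub>v c') = 0" by (simp add: hyperplane_def)
    have Bu: "B *\<^sub>v unit_vec n (n - 1) = x (n - 1)" using mult_unit_vec[OF B, of "n - 1"] n colB[of "n - 1"] by simp
    have "c = c' + c $ (n - 1) \<cdot>\<^sub>v unit_vec n (n - 1)" using c by (intro eq_vecI) (auto simp: c'_def)
    then have "B *\<^sub>v c = B *\<^sub>v (c' + c $ (n - 1) \<cdot>\<^sub>v unit_vec n (n - 1))" by simp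
    also have "\<dots> = B *\<^sub>v c' + c $ (n - 1) \<cdot>\<^sub>v x (n - 1)"
      using cc' Bu by (simp add: mult_add_distrib_mat_vec[OF B] mult_mat_vec[OF B])
    finally have "l \<bullet> (B *\<^sub>v c) = l \<bullet> (B *\<^sub>v c') + c $ (n - 1) * lam"
      using l B cc' xc by (simp add: scalar_prod_add_distrib[of _ n] lam_def)
    then show ?thesis by (simp add: z)
  qed
  have lam0: "lam \<noteq> 0"
  proof
    assume "lam = 0"
    obtain B' where B': "B' \<in> carrier_mat n n" "B * B' = 1\<^sub>m n" using B_GL by (auto simp: GL_iff)
    have "l \<bullet> (B *\<^sub>v (B' *\<^sub>v e)) = 0" using form[of "B' *\<^sub>v e"] B' l \<open>lam = 0\<close> by simp
    moreover have "B *\<^sub>v (B' *\<^sub>v e) = e" using assoc_mult_mat_vec[OF B B'(1) l(2)] B' l by simp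
    ultimately show False using l by simp
  qed
  have shift: "g *\<^sub>v (B *\<^sub>v c) = B *\<^sub>v (shift_mat n *\<^sub>v c)" if c: "c \<in> carrier_vec n" "c $ (n - 1) = 0" for c
  proof -
    have S: "shift_mat n \<in> carrier_mat n n" by simp
    have entry: "(g * B) $$ (i, j) = (B * shift_mat n) $$ (i, j)" if ij: "i < n" "j < n - 1" for i j
    proof -
      have jn: "j < n" "Suc j < n" using ij by auto
      have "(g * B) $$ (i, j) = col (g * B) j $ i" using g B ij by simp
      also have "\<dots> = x (Suc j) $ i" by (simp add: col_mult2[OF g B jn(1)] colB[OF jn(1)] gx)
      also have "\<dots> = B $$ (i, Suc j)" using colB[OF jn(2)] B ij jn by (metis index_col carrier_matD)
      also have "\<dots> = (\<Sum>k<n. if k = Suc j then B $$ (i, Suc j) else 0)" using jn by simp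
      also have "\<dots> = (\<Sum>k<n. B $$ (i, k) * shift_mat n $$ (k, j))"
        using jn by (intro sum.cong) (auto simp: shift_mat_def)
      also have "\<dots> = (B * shift_mat n) $$ (i, j)" by (rule index_mult_mat_sum[OF B S ij(1) jn(1), symmetric])
      finally show ?thesis .
    qed
    have "(g * B) *\<^sub>v c = (B * shift_mat n) *\<^sub>v c"
    proof (rule eq_vecI)
      fix i assume "i < dim_vec ((B * shift_mat n) *\<^sub>v c)"
      then have i: "i < n" using B by simp
      have "((g * B) *\<^sub>v c) $ i = (\<Sum>j<n. (g * B) $$ (i, j) * c $ j)"
        by (rule index_mult_vec_sum[OF mult_carrier_mat[OF g B] c(1) i])
      also have "\<dots> = (\<Sum>j<n. (B * shift_mat n) $$ (i, j) * c $ j)"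
      proof (intro sum.cong refl)
        fix j assume j: "j \<in> {..<n}"
        show "(g * B) $$ (i, j) * c $ j = (B * shift_mat n) $$ (i, j) * c $ j"
        proof (cases "j < n - 1")
          case False
          then have "j = n - 1" using j by simp
          then show ?thesis using c(2) by (simp only: mult_zero_right)
        qed (simp only: entry[OF i])
      qed
      also have "\<dots> = ((B * shift_mat n) *\<^sub>v c) $ i"
        by (rule index_mult_vec_sum[OF mult_carrier_mat[OF B S] c(1) i, symmetric])
      finally show "((g * B) *\<^sub>v c) $ i = ((B * shift_mat n) *\<^sub>v c) $ i" .
    qed (use g B in simp)
    then show ?thesis by (simp only: assoc_mult_mat_vec[OF g B c(1)] assoc_mult_mat_vec[OF B S c(1)])
  qed
  show thesis by (rule that[OF B_GL lam0 form shift])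
qed

lemma conj_mult_vec:
  fixes P :: "'f::field mat"
  assumes "P \<in> carrier_mat n n" "P' \<in> carrier_mat n n" "h \<in> carrier_mat n n" "P' * P = 1\<^sub>m n" "v \<in> carrier_vec n"
  shows "(P * h * P') *\<^sub>v (P *\<^sub>v v) = P *\<^sub>v (h *\<^sub>v v)"
proof -
  have c: "P * h \<in> carrier_mat n n" "P *\<^sub>v v \<in> carrier_vec n" using assms by auto
  have "(P * h * P') *\<^sub>v (P *\<^sub>v v) = (P * h) *\<^sub>v (P' *\<^sub>v (P *\<^sub>v v))"
    by (rule assoc_mult_mat_vec[OF c(1) assms(2) c(2)])
  also have "P' *\<^sub>v (P *\<^sub>v v) = v"
    using assms by (simp add: assoc_mult_mat_vec[OF assms(2,1,5), symmetric])
  also have "(P * h) *\<^sub>v v = P *\<^sub>v (h *\<^sub>v v)" by (rule assoc_mult_mat_vec[OF assms(1,3,5)])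
  finally show ?thesis .
qed

lemma conj_cancel:
  fixes P :: "'f::field mat"
  assumes "P \<in> carrier_mat n n" "P' \<in> carrier_mat n n" "h \<in> carrier_mat n n" "P' * P = 1\<^sub>m n"
  shows "P' * (P * h * P') * P = h"
proof -
  have c: "P * h \<in> carrier_mat n n" "h * P' \<in> carrier_mat n n" using assms by auto
  have "P' * (P * h * P') = (P' * P) * (h * P')"
    by (simp only: assoc_mult_mat[OF assms(1,3,2)] assoc_mult_mat[OF assms(2,1) c(2)])
  also have "\<dots> = h * P'" using assms c by simp
  also have "h * P' * P = h * (P' * P)" by (rule assoc_mult_mat[OF assms(3,2,1)])
  also have "\<dots> = h" using assms by simp
  finally show ?thesis .
qed

lemma unipotent_conj:
  fixes P :: "'f::field mat"
  assumes P: "P \<in> carrier_mat n n" "P' \<in> carrier_mat n n" "P * P' = 1\<^sub>m n" "P' * P = 1\<^sub>m n"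
    and h: "h \<in> carrier_mat n n" "unipotent_mat n h"
  shows "unipotent_mat n (P * h * P')"
  unfolding unipotent_mat_def
proof
  fix v :: "'f vec" assume v: "v \<in> carrier_vec n"
  define w where "w = P' *\<^sub>v v"
  have w: "w \<in> carrier_vec n" using P v by (simp add: w_def)
  have vw: "v = P *\<^sub>v w" using P v by (simp add: w_def assoc_mult_mat_vec[OF P(1,2) v, symmetric])
  obtain k where k: "((\<lambda>v. h *\<^sub>v v - v) ^^ k) w = 0\<^sub>v n" using h(2) w by (auto simp: unipotent_mat_def)
  have "((\<lambda>v. (P * h * P') *\<^sub>v v - v) ^^ j) v = P *\<^sub>v (((\<lambda>v. h *\<^sub>v v - v) ^^ j) w) \<and> ((\<lambda>v. h *\<^sub>v v - v) ^^ j) w \<in> carrier_vec n" for j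
  proof (induction j)
    case (Suc j)
    define y where "y = ((\<lambda>v. h *\<^sub>v v - v) ^^ j) w"
    have y: "y \<in> carrier_vec n" using Suc by (simp add: y_def)
    have hy: "h *\<^sub>v y \<in> carrier_vec n" using h y by simp
    have "(P * h * P') *\<^sub>v (P *\<^sub>v y) - P *\<^sub>v y = P *\<^sub>v (h *\<^sub>v y - y)"
      by (simp only: conj_mult_vec[OF P(1,2) h(1) P(4) y] mult_minus_distrib_mat_vec[OF P(1) hy y])
    then show ?case using Suc h y by (simp add: y_def)
  qed (use vw w in simp)
  then have "((\<lambda>v. (P * h * P') *\<^sub>v v - v) ^^ k) v = 0\<^sub>v n" using k mult_zero_vec[OF P(1)] by simp
  then show "\<exists>k. ((\<lambda>v. (P * h * P') *\<^sub>v v - v) ^^ k) v = 0\<^sub>v n" by blast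
qed

lemma elliptic_conj:
  fixes P :: "'f::field mat"
  assumes P: "P \<in> carrier_mat n n" "P' \<in> carrier_mat n n" "P * P' = 1\<^sub>m n" "P' * P = 1\<^sub>m n"
    and h: "h \<in> carrier_mat n n" "elliptic_mat n h"
  shows "elliptic_mat n (P * h * P')"
  unfolding elliptic_mat_def
proof (intro conjI allI impI)
  show "P * h * P' \<noteq> 1\<^sub>m n"
  proof
    assume "P * h * P' = 1\<^sub>m n"
    then have "h = P' * 1\<^sub>m n * P" using conj_cancel[OF P(1,2) h(1) P(4)] by simp
    then have "h = 1\<^sub>m n" using P by simp
    with h(2) show False by (simp add: elliptic_mat_def)
  qed
  fix U assume U: "lin_subspace n U" and st: "\<forall>u\<in>U. (P * h * P') *\<^sub>v u \<in> U"
  note UD = lin_subspaceD[OF U]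
  define V where "V = {v \<in> carrier_vec n. P *\<^sub>v v \<in> U}"
  have "lin_subspace n V"
    unfolding lin_subspace_def V_def
    using UD by (auto simp: mult_zero_vec[OF P(1)] mult_add_distrib_mat_vec[OF P(1)] mult_mat_vec[OF P(1)])
  moreover have "h *\<^sub>v v \<in> V" if "v \<in> V" for v
  proof -
    have v: "v \<in> carrier_vec n" "P *\<^sub>v v \<in> U" using that by (auto simp: V_def)
    have "P *\<^sub>v (h *\<^sub>v v) \<in> U" using st v(2) conj_mult_vec[OF P(1,2) h(1) P(4) v(1)] by metis
    then show ?thesis using h v by (simp add: V_def)
  qed
  ultimately have "V = {0\<^sub>v n} \<or> V = carrier_vec n" using h(2) unfolding elliptic_mat_def by blast
  moreover have PP: "P *\<^sub>v (P' *\<^sub>v u) = u" if "u \<in> carrier_vec n" for u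
    using P that by (simp add: assoc_mult_mat_vec[OF P(1,2) that, symmetric])
  have inV: "P' *\<^sub>v u \<in> V" if "u \<in> U" for u using that UD(1)[OF that] PP P by (simp add: V_def)
  show "U = {0\<^sub>v n} \<or> U = carrier_vec n"
  proof (cases "V = {0\<^sub>v n}")
    case True
    have "u = 0\<^sub>v n" if u: "u \<in> U" for u
    proof -
      have "P' *\<^sub>v u = 0\<^sub>v n" using inV[OF u] True by simp
      then show ?thesis using PP[OF UD(1)[OF u]] mult_zero_vec[OF P(1)] by simp
    qed
    then show ?thesis using UD(2) by blast
  next
    case False
    then have "V = carrier_vec n" using calculation by blast
    then have "u \<in> U" if u: "u \<in> carrier_vec n" for u
    proof -
      have "P' *\<^sub>v u \<in> V" using P u \<open>V = carrier_vec n\<close> by simp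
      then show ?thesis using PP[OF u] by (simp add: V_def)
    qed
    then show ?thesis using UD(1) by blast
  qed
qed

lemma fixed_dim_conj:
  fixes P :: "'f::{field,finite} mat"
  assumes P: "P \<in> carrier_mat n n" "P' \<in> carrier_mat n n" "P * P' = 1\<^sub>m n" "P' * P = 1\<^sub>m n"
    and h: "h \<in> carrier_mat n n"
  shows "fixed_dim n (P * h * P') = fixed_dim n h"
proof -
  have c: "P * h * P' \<in> carrier_mat n n" using P h by simp
  have PP: "P *\<^sub>v (P' *\<^sub>v u) = u" "P' *\<^sub>v (P *\<^sub>v u) = u" if "u \<in> carrier_vec n" for u
    using P that by (simp_all add: assoc_mult_mat_vec[OF P(1,2) that, symmetric] assoc_mult_mat_vec[OF P(2,1) that, symmetric])
  have "bij_betw (\<lambda>v. P *\<^sub>v v) {v \<in> carrier_vec n. h *\<^sub>v v = v} {v \<in> carrier_vec n. (P * h * P') *\<^sub>v v = v}"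
  proof (rule bij_betw_byWitness[of _ "\<lambda>v. P' *\<^sub>v v"])
    show "(\<lambda>v. P *\<^sub>v v) ` {v \<in> carrier_vec n. h *\<^sub>v v = v} \<subseteq> {v \<in> carrier_vec n. (P * h * P') *\<^sub>v v = v}"
      using P conj_mult_vec[OF P(1,2) h P(4)] by auto
    show "(\<lambda>v. P' *\<^sub>v v) ` {v \<in> carrier_vec n. (P * h * P') *\<^sub>v v = v} \<subseteq> {v \<in> carrier_vec n. h *\<^sub>v v = v}"
    proof clarify
      fix v assume v: "v \<in> carrier_vec n" "(P * h * P') *\<^sub>v v = v"
      have w: "P' *\<^sub>v v \<in> carrier_vec n" using P v by simp
      have "P *\<^sub>v (h *\<^sub>v (P' *\<^sub>v v)) = v"
        using conj_mult_vec[OF P(1,2) h P(4) w] PP(1)[OF v(1)] v(2) by simp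
      then have "h *\<^sub>v (P' *\<^sub>v v) = P' *\<^sub>v v" using PP(2)[of "h *\<^sub>v (P' *\<^sub>v v)"] h w by simp
      then show "P' *\<^sub>v v \<in> carrier_vec n \<and> h *\<^sub>v (P' *\<^sub>v v) = P' *\<^sub>v v" using w by simp
    qed
  qed (use PP in auto)
  from bij_betw_same_card[OF this] have "CARD('f) ^ fixed_dim n (P * h * P') = CARD('f) ^ fixed_dim n h"
    by (simp only: card_fixed_vectors[OF c] card_fixed_vectors[OF h])
  moreover have "CARD('f) > 1" using card_field_ge_2[where 'f = 'f] by simp
  ultimately show ?thesis by (simp only: power_inject_exp)
qed

text \<open>All maps on a hyperplane with trivial core look the same in a suitable basis, so all of them have
  as many extensions of a given conjugacy type as the shift.\<close>

lemma extensions_trivial_core: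
  fixes g :: "'f::field mat"
  assumes l: "l \<in> carrier_vec n" "e \<in> carrier_vec n" "l \<bullet> e = 1" and g: "g \<in> carrier_mat n n"
    and core: "stable_core n l g = {0\<^sub>v n}" and n: "n \<ge> 1"
  obtains B B' where "B \<in> carrier_mat n n" "B' \<in> carrier_mat n n" "B * B' = 1\<^sub>m n" "B' * B = 1\<^sub>m n"
    "bij_betw (\<lambda>Y. B * Y * B') (companion_mats n) (extensions n l g)"
proof -
  obtain B lam where B: "B \<in> carrier (GL n)" "lam \<noteq> 0"
    "\<And>c. c \<in> carrier_vec n \<Longrightarrow> l \<bullet> (B *\<^sub>v c) = lam * c $ (n - 1)"
    "\<And>c. c \<in> carrier_vec n \<Longrightarrow> c $ (n - 1) = 0 \<Longrightarrow> g *\<^sub>v (B *\<^sub>v c) = B *\<^sub>v (shift_mat n *\<^sub>v c)"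
    by (rule trivial_core_basis[OF l g core n]) blast
  obtain B' where B': "B \<in> carrier_mat n n" "B' \<in> carrier_mat n n" "B * B' = 1\<^sub>m n" "B' * B = 1\<^sub>m n"
    using B(1) by (auto simp: GL_iff)
  have B'GL: "B' \<in> carrier (GL n)" using B' by (auto simp: GL_iff)
  have BB: "B *\<^sub>v (B' *\<^sub>v u) = u" "B' *\<^sub>v (B *\<^sub>v u) = u" if "u \<in> carrier_vec n" for u
    using B' that by (simp_all add: assoc_mult_mat_vec[OF B'(1,2) that, symmetric] assoc_mult_mat_vec[OF B'(2,1) that, symmetric])
  have "bij_betw (\<lambda>Y. B * Y * B') (companion_mats n) (extensions n l g)"
  proof (rule bij_betw_byWitness[of _ "\<lambda>h. B' * h * B"])
    show "\<forall>Y\<in>companion_mats n. B' * (B * Y * B') * B = Y"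
      by (auto simp: companion_mats_def GL_iff intro!: conj_cancel[OF B'(1,2) _ B'(4)])
    show "\<forall>h\<in>extensions n l g. B * (B' * h * B) * B' = h"
      by (auto simp: extensions_def GL_iff intro!: conj_cancel[OF B'(2,1) _ B'(3)])
    show "(\<lambda>Y. B * Y * B') ` companion_mats n \<subseteq> extensions n l g"
    proof clarify
      fix Y :: "'f mat" assume Y: "Y \<in> companion_mats n"
      then have YG: "Y \<in> carrier (GL n)" "Y \<in> carrier_mat n n" by (auto simp: companion_mats_def GL_iff)
      have "(B * Y * B') *\<^sub>v w = g *\<^sub>v w" if w: "w \<in> hyperplane n l" for w
      proof -
        have wc: "w \<in> carrier_vec n" "l \<bullet> w = 0" using w by (auto simp: hyperplane_def)
        define c where "c = B' *\<^sub>v w"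
        have c: "c \<in> carrier_vec n" "B *\<^sub>v c = w" using B' wc BB by (auto simp: c_def)
        have c0: "c $ (n - 1) = 0" using B(2) B(3)[OF c(1)] c(2) wc by simp
        have "(B * Y * B') *\<^sub>v w = B *\<^sub>v (Y *\<^sub>v c)"
          using conj_mult_vec[OF B'(1,2) YG(2) B'(4) c(1)] c(2) by simp
        also have "Y *\<^sub>v c = shift_mat n *\<^sub>v c" using Y c(1) c0 by (auto simp: companion_mats_def)
        also have "B *\<^sub>v \<dots> = g *\<^sub>v w" using B(4)[OF c(1) c0] c(2) by simp
        finally show ?thesis .
      qed
      then show "B * Y * B' \<in> extensions n l g"
        unfolding extensions_def using B(1) B'GL YG by (simp add: GL_mult)
    qed
    show "(\<lambda>h. B' * h * B) ` extensions n l g \<subseteq> companion_mats n"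
    proof clarify
      fix h assume h: "h \<in> extensions n l g"
      note hD = extensionsD[OF h]
      have "(B' * h * B) *\<^sub>v c = shift_mat n *\<^sub>v c" if c: "c \<in> carrier_vec n" "c $ (n - 1) = 0" for c
      proof -
        have Bc: "B *\<^sub>v c \<in> carrier_vec n" using B' c by simp
        have S: "shift_mat n *\<^sub>v c \<in> carrier_vec n" by (rule mult_mat_vec_carrier[OF shift_mat_carrier c(1)])
        have "B *\<^sub>v c \<in> hyperplane n l" using B(3)[OF c(1)] c Bc by (simp add: hyperplane_def)
        then have "h *\<^sub>v (B *\<^sub>v c) = B *\<^sub>v (shift_mat n *\<^sub>v c)" using hD(3) B(4)[OF c] by simp
        moreover have "(B' * h * B) *\<^sub>v (B' *\<^sub>v (B *\<^sub>v c)) = B' *\<^sub>v (h *\<^sub>v (B *\<^sub>v c))"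
          by (rule conj_mult_vec[OF B'(2,1) hD(2) B'(3) Bc])
        ultimately show ?thesis using BB(2)[OF c(1)] BB(2)[OF S] by simp
      qed
      then show "B' * h * B \<in> companion_mats n"
        unfolding companion_mats_def using B(1) B'GL hD(1) by (simp add: GL_mult)
    qed
  qed
  with B' that show thesis by blast
qed

section \<open>A class function with vanishing sums over extensions\<close>

text \<open>A combination of a function supported on unipotent elements and one supported on elliptic
  elements. The two counts of companion matrices balance the contributions of both parts to the sum
  over the extensions of a map with trivial core.\<close>

definition cuspidal_fun :: "nat \<Rightarrow> 'f::{field,finite} mat \<Rightarrow> complex" where
  "cuspidal_fun n g =
     (if unipotent_mat n g then of_nat (card {Y \<in> companion_mats n. elliptic_mat n (Y :: 'f mat)}) *
        green_weight CARD('f) (fixed_dim n g) else 0) -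
     (if elliptic_mat n g then of_nat (card {Y \<in> companion_mats n. unipotent_mat n (Y :: 'f mat)}) else 0)"

lemma cuspidal_fun_conj:
  fixes P :: "'f::{field,finite} mat"
  assumes P: "P \<in> carrier_mat n n" "P' \<in> carrier_mat n n" "P * P' = 1\<^sub>m n" "P' * P = 1\<^sub>m n"
    and h: "h \<in> carrier_mat n n"
  shows "cuspidal_fun n (P * h * P') = cuspidal_fun n h"
proof -
  have c: "P * h * P' \<in> carrier_mat n n" using P h by simp
  note undo = conj_cancel[OF P(1,2) h P(4)]
  have "unipotent_mat n (P * h * P') \<longleftrightarrow> unipotent_mat n h"
    using unipotent_conj[OF P h] unipotent_conj[OF P(2,1,4,3) c] undo by auto
  moreover have "elliptic_mat n (P * h * P') \<longleftrightarrow> elliptic_mat n h"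
    using elliptic_conj[OF P h] elliptic_conj[OF P(2,1,4,3) c] undo by auto
  ultimately show ?thesis by (simp add: cuspidal_fun_def fixed_dim_conj[OF P h])
qed

text \<open>The value is a nonzero weight times the number of elliptic companion matrices, so their existence
  enters here.\<close>

lemma cuspidal_fun_one:
  assumes n: "n \<ge> 1" and not: "\<not> (n = 1 \<and> CARD('f::{field,finite}) = 2)"
  shows "cuspidal_fun n (1\<^sub>m n :: 'f mat) \<noteq> 0"
proof -
  have "unipotent_mat n (1\<^sub>m n :: 'f mat)"
    unfolding unipotent_mat_def by (intro ballI exI[of _ 1]) simp
  moreover have "\<not> elliptic_mat n (1\<^sub>m n :: 'f mat)" by (simp add: elliptic_mat_def)
  moreover have "card {Y \<in> companion_mats n. elliptic_mat n (Y :: 'f mat)} > 0"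
  proof -
    have "finite {Y \<in> companion_mats n. elliptic_mat n (Y :: 'f mat)}"
      by (rule finite_subset[OF _ finite_GL]) (auto simp: companion_mats_def)
    then show ?thesis using exists_elliptic_companion[OF n not] by (auto simp: card_gt_0_iff)
  qed
  ultimately show ?thesis
    using green_weight_nonzero[OF card_field_ge_2[where 'f = 'f]] by (simp add: cuspidal_fun_def)
qed

text \<open>A fixed vector in the hyperplane lies in the core, so \<open>l\<close> is injective on the fixed vectors and
  there are at most \<open>q\<close> of them. Being unipotent, \<open>h\<close> fixes some nonzero vector.\<close>

lemma fixed_dim_unipotent_trivial_core:
  fixes g :: "'f::{field,finite} mat"
  assumes l: "l \<in> carrier_vec n" "e \<in> carrier_vec n" "l \<bullet> e = 1" and g: "g \<in> carrier_mat n n"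
    and core: "stable_core n l g = {0\<^sub>v n}" and h: "h \<in> extensions n l g" "unipotent_mat n h"
  shows "fixed_dim n h = 1"
proof -
  let ?q = "CARD('f)" and ?X = "{v \<in> carrier_vec n. h *\<^sub>v v = v}"
  have q2: "?q \<ge> 2" by (rule card_field_ge_2)
  note hD = extensionsD[OF h(1)]
  have finX: "finite ?X" by (rule finite_subset[OF _ finite_carrier_vec_finite_field]) auto
  have e0: "e \<noteq> 0\<^sub>v n" using l by auto
  obtain w where w: "w \<in> carrier_vec n" "w \<noteq> 0\<^sub>v n" "h *\<^sub>v w = w"
    by (rule unipotent_fixed_vector[OF h(2) subset_refl _ l(2) e0 hD(2)]) (use hD(2) in auto)
  have "card {0\<^sub>v n, w} \<le> card ?X" using w mult_zero_vec[OF hD(2)] by (intro card_mono finX) auto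
  then have ge: "card ?X \<ge> 2" using w(2) by (simp add: card_insert_if split: if_splits)
  \<comment> \<open>The difference of two fixed vectors with the same value of \<open>l\<close> is a fixed vector in the hyperplane.\<close>
  have "inj_on (\<lambda>v. l \<bullet> v) ?X"
  proof (rule inj_onI)
    fix x y assume x: "x \<in> ?X" and y: "y \<in> ?X" and eq: "l \<bullet> x = l \<bullet> y"
    have c: "x \<in> carrier_vec n" "y \<in> carrier_vec n" using x y by auto
    have W: "x - y \<in> hyperplane n l" using c eq l by (simp add: hyperplane_def scalar_prod_minus_distrib[of _ n])
    have "h *\<^sub>v (x - y) = x - y" using x y by (simp add: mult_minus_distrib_mat_vec[OF hD(2)])
    then have "g *\<^sub>v (x - y) - (x - y) = 0\<^sub>v n" using hD(3)[OF W] c by simp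
    then have "g *\<^sub>v (x - y) - (x - y) \<in> stable_core n l g" using core by simp
    from displacement_in_core[OF l(1) g W this] core have z: "x - y = 0\<^sub>v n" by simp
    have "(x - y) $ i = 0" if "i < n" for i using z that by simp
    then show "x = y" using c by (intro eq_vecI) auto
  qed
  then have "card ?X \<le> card (UNIV :: 'f set)" by (rule card_inj_on_le) auto
  then have "?q ^ fixed_dim n h \<le> ?q ^ 1" by (simp add: card_fixed_vectors[OF hD(2)])
  then have "fixed_dim n h \<le> 1" using q2 by (subst (asm) power_increasing_iff) auto
  moreover have "fixed_dim n h \<noteq> 0" using ge by (intro notI) (simp add: card_fixed_vectors[OF hD(2)])
  ultimately show ?thesis by simp
qed

text \<open>If the core is nonzero, there are no elliptic extensions, and the unipotent ones cancel among
  themselves. If it is zero, the extensions correspond to the companion matrices by a conjugation,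
  all unipotent ones have weight 1, and the two parts of the function cancel by the choice of the
  factors.\<close>

theorem sum_cuspidal_fun_extensions:
  fixes g :: "'f::{field,finite} mat"
  assumes l: "l \<in> carrier_vec n" "l \<noteq> 0\<^sub>v n" and g: "g \<in> carrier_mat n n"
  shows "(\<Sum>h\<in>extensions n l g. cuspidal_fun n h) = 0"
proof -
  let ?E = "extensions n l g" and ?q = "CARD('f)"
  have "\<exists>i<n. l $ i \<noteq> 0"
  proof (rule ccontr)
    assume "\<not> ?thesis"
    then have "l = 0\<^sub>v n" using l(1) by (intro eq_vecI) auto
    with l(2) show False by simp
  qed
  then obtain i where i: "i < n" "l $ i \<noteq> 0" by blast
  then have n: "n \<ge> 1" by simp
  \<comment> \<open>A vector off the hyperplane, normalized to \<open>l \<bullet> e = 1\<close>.\<close>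
  define e where "e = (1 / l $ i) \<cdot>\<^sub>v unit_vec n i"
  have e: "e \<in> carrier_vec n" "l \<bullet> e = 1" using l i by (simp_all add: e_def)
  let ?N = "card {Y \<in> companion_mats n. elliptic_mat n (Y :: 'f mat)}"
  let ?M = "card {Y \<in> companion_mats n. unipotent_mat n (Y :: 'f mat)}"
  have fin: "finite ?E" by (rule finite_extensions)
  have split: "(\<Sum>h\<in>?E. cuspidal_fun n h) =
      of_nat ?N * (\<Sum>h\<in>{h \<in> ?E. unipotent_mat n h}. green_weight ?q (fixed_dim n h)) -
      of_nat (card {h \<in> ?E. elliptic_mat n h}) * of_nat ?M"
    unfolding cuspidal_fun_def sum_subtractf sum_distrib_left
    using fin by (simp add: sum.If_cases Int_def)
  show ?thesis
  proof (cases "stable_core n l g = {0\<^sub>v n}")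
    case False
    have "{h \<in> ?E. elliptic_mat n h} = {}" using no_elliptic_extension[OF l(1) e g False] by blast
    then show ?thesis by (simp only: split sum_unipotent_extensions[OF l(1) e g False]) simp
  next
    case True
    obtain B B' where B: "B \<in> carrier_mat n n" "B' \<in> carrier_mat n n" "B * B' = 1\<^sub>m n" "B' * B = 1\<^sub>m n"
      and bij: "bij_betw (\<lambda>Y. B * Y * B') (companion_mats n) ?E"
      by (rule extensions_trivial_core[OF l(1) e g True n])
    have transfer: "card {h \<in> ?E. Q h} = card {Y \<in> companion_mats n. Q Y}"
      if Q: "\<And>P P' h. P \<in> carrier_mat n n \<Longrightarrow> P' \<in> carrier_mat n n \<Longrightarrow> P * P' = 1\<^sub>m n \<Longrightarrow> P' * P = 1\<^sub>m n \<Longrightarrow>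
        h \<in> carrier_mat n n \<Longrightarrow> Q h \<Longrightarrow> Q (P * h * P')" for Q :: "'f mat \<Rightarrow> bool"
    proof -
      have comp: "Y \<in> carrier_mat n n" if "Y \<in> companion_mats n" for Y :: "'f mat"
        using that by (simp add: companion_mats_def GL_iff)
      have iff: "Q (B * Y * B') \<longleftrightarrow> Q Y" if "Y \<in> companion_mats n" for Y
      proof -
        have c: "B * Y * B' \<in> carrier_mat n n" using B comp[OF that] by simp
        show ?thesis
          using Q[OF B comp[OF that]] Q[OF B(2,1,4,3) c] conj_cancel[OF B(1,2) comp[OF that] B(4)] by auto
      qed
      have "{h \<in> ?E. Q h} = (\<lambda>Y. B * Y * B') ` {Y \<in> companion_mats n. Q Y}"
        unfolding bij_betw_imp_surj_on[OF bij, symmetric] using iff by auto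
      moreover have "inj_on (\<lambda>Y. B * Y * B') {Y \<in> companion_mats n. Q Y}"
        by (rule inj_on_subset[OF bij_betw_imp_inj_on[OF bij]]) blast
      ultimately show ?thesis by (simp only: card_image)
    qed
    have "(\<Sum>h\<in>{h \<in> ?E. unipotent_mat n h}. green_weight ?q (fixed_dim n h)) =
        (\<Sum>h\<in>{h \<in> ?E. unipotent_mat n h}. 1)"
      using fixed_dim_unipotent_trivial_core[OF l(1) e g True] by (intro sum.cong) auto
    then have "(\<Sum>h\<in>{h \<in> ?E. unipotent_mat n h}. green_weight ?q (fixed_dim n h)) =
        of_nat (card {h \<in> ?E. unipotent_mat n h})" by simp
    then show ?thesis
      by (simp only: split transfer[of "unipotent_mat n", OF unipotent_conj]
          transfer[of "elliptic_mat n", OF elliptic_conj] mult.commute diff_self)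
  qed
qed

section \<open>Gaussian binomial coefficients and independent lists\<close>

fun q_binomial :: "nat \<Rightarrow> nat \<Rightarrow> nat \<Rightarrow> nat" where
  "q_binomial q r 0 = 1"
| "q_binomial q 0 (Suc k) = 0"
| "q_binomial q (Suc r) (Suc k) = q_binomial q r k + q ^ Suc k * q_binomial q r (Suc k)"

lemma q_binomial_eq_0: "r < k \<Longrightarrow> q_binomial q r k = 0"
  by (induction q r k rule: q_binomial.induct) auto

text \<open>Multiplying \<open>P\<^sub>k(x) = (x - 1) (x - q) \<dots> (x - q\<^bsup>k-1\<^esup>)\<close> by \<open>x\<close> gives \<open>P\<^bsub>k+1\<^esub>(x) + q\<^sup>k P\<^sub>k(x)\<close>, which
  is the recursion of the coefficients. The upper limit \<open>m\<close> is free so that it can be chosen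
  uniformly; the coefficients vanish for \<open>k > r\<close>.\<close>

lemma power_eq_sum_q_binomial:
  fixes x :: "'a::comm_ring_1"
  shows "r \<le> m \<Longrightarrow> x ^ r = (\<Sum>k\<le>m. of_nat (q_binomial q r k) * (\<Prod>j<k. x - of_nat q ^ j))"
proof (induction r arbitrary: m)
  case 0
  have "(\<Sum>k\<le>m. of_nat (q_binomial q 0 k) * (\<Prod>j<k. x - of_nat q ^ j)) = (\<Sum>k\<le>m. if k = 0 then 1 else 0)"
    by (intro sum.cong refl) (simp add: q_binomial_eq_0)
  then show ?case by simp
next
  case (Suc r)
  obtain m' where m': "m = Suc m'" "r \<le> m'" using Suc.prems by (cases m) auto
  let ?P = "\<lambda>k. \<Prod>j<k. x - of_nat q ^ j"
  let ?c = "\<lambda>k. of_nat (q_binomial q r k) :: 'a"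
  have "(\<Sum>k\<le>m. of_nat (q_binomial q (Suc r) k) * ?P k) =
      1 + (\<Sum>k\<le>m'. of_nat (q_binomial q (Suc r) (Suc k)) * ?P (Suc k))"
    unfolding m'(1) by (subst sum.atMost_Suc_shift) simp
  also have "(\<Sum>k\<le>m'. of_nat (q_binomial q (Suc r) (Suc k)) * ?P (Suc k)) =
      (\<Sum>k\<le>m'. ?c k * ?P (Suc k)) + (\<Sum>k\<le>m'. of_nat q ^ Suc k * ?c (Suc k) * ?P (Suc k))"
    unfolding sum.distrib[symmetric] by (intro sum.cong refl) (simp add: algebra_simps)
  also have "1 + ((\<Sum>k\<le>m'. ?c k * ?P (Suc k)) + (\<Sum>k\<le>m'. of_nat q ^ Suc k * ?c (Suc k) * ?P (Suc k))) =
      (\<Sum>k\<le>m'. ?c k * ?P (Suc k)) + (\<Sum>k\<le>m. of_nat q ^ k * ?c k * ?P k)"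
    unfolding m'(1) by (subst sum.atMost_Suc_shift) simp
  also have "(\<Sum>k\<le>m'. ?c k * ?P (Suc k)) = (\<Sum>k\<le>m. ?c k * ?P (Suc k))"
    using m' by (simp add: q_binomial_eq_0)
  also have "(\<Sum>k\<le>m. ?c k * ?P (Suc k)) + (\<Sum>k\<le>m. of_nat q ^ k * ?c k * ?P k) = x * (\<Sum>k\<le>m. ?c k * ?P k)"
    unfolding sum.distrib[symmetric] sum_distrib_left by (intro sum.cong refl) (simp add: algebra_simps)
  also have "\<dots> = x ^ Suc r" using Suc.IH[of m] Suc.prems by simp
  finally show ?case by simp
qed

lemma prod_power_diff_Suc:
  fixes x :: "'a::comm_ring_1"
  shows "(\<Prod>j<Suc k. x ^ Suc r - x ^ j) = (x ^ Suc r - 1) * x ^ k * (\<Prod>j<k. x ^ r - x ^ j)"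
proof -
  have "(\<Prod>j<Suc k. x ^ Suc r - x ^ j) = (x ^ Suc r - 1) * (\<Prod>j<k. x ^ Suc r - x ^ Suc j)"
    by (subst prod.lessThan_Suc_shift) simp
  also have "(\<Prod>j<k. x ^ Suc r - x ^ Suc j) = (\<Prod>j<k. x * (x ^ r - x ^ j))"
    by (intro prod.cong refl) (simp add: right_diff_distrib)
  also have "\<dots> = x ^ k * (\<Prod>j<k. x ^ r - x ^ j)" by (simp add: prod.distrib)
  finally show ?thesis by (simp add: mult.assoc)
qed

text \<open>The closed form of the Gaussian binomial coefficients, cleared of denominators. With \<open>r\<close> in the
  role of a dimension, both sides count independent \<open>k\<close>-tuples over a field with \<open>q\<close> elements, on
  the left by the subspace that they span.\<close>

lemma q_binomial_mult_prod:
  "(of_nat (q_binomial q r k) :: 'a::comm_ring_1) * (\<Prod>j<k. of_nat q ^ k - of_nat q ^ j) =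
    (\<Prod>j<k. of_nat q ^ r - of_nat q ^ j)"
proof (induction q r k rule: q_binomial.induct)
  case (2 q k)
  have "(\<Prod>j<Suc k. of_nat q ^ 0 - of_nat q ^ j :: 'a) = 0"
    by (rule prod_zero) (auto intro!: bexI[of _ 0])
  then show ?case by simp
next
  case (3 q r k)
  let ?q = "of_nat q :: 'a"
  let ?R = "\<Prod>j<k. ?q ^ r - ?q ^ j"
  have last: "(\<Prod>j<Suc k. ?q ^ r - ?q ^ j) = ?R * (?q ^ r - ?q ^ k)" by simp
  have "of_nat (q_binomial q (Suc r) (Suc k)) * (\<Prod>j<Suc k. ?q ^ Suc k - ?q ^ j) =
      of_nat (q_binomial q r k) * (\<Prod>j<Suc k. ?q ^ Suc k - ?q ^ j) +
      ?q ^ Suc k * (of_nat (q_binomial q r (Suc k)) * (\<Prod>j<Suc k. ?q ^ Suc k - ?q ^ j))"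
    unfolding q_binomial.simps(3) of_nat_add of_nat_mult of_nat_power by (simp only: distrib_right mult.assoc)
  also have "of_nat (q_binomial q r k) * (\<Prod>j<Suc k. ?q ^ Suc k - ?q ^ j) =
      (?q ^ Suc k - 1) * ?q ^ k * (of_nat (q_binomial q r k) * (\<Prod>j<k. ?q ^ k - ?q ^ j))"
    unfolding prod_power_diff_Suc by (simp only: mult_ac)
  also have "\<dots> = (?q ^ Suc k - 1) * ?q ^ k * ?R" by (simp only: 3(1))
  also have "of_nat (q_binomial q r (Suc k)) * (\<Prod>j<Suc k. ?q ^ Suc k - ?q ^ j) = ?R * (?q ^ r - ?q ^ k)"
    by (simp only: 3(2) last)
  also have "(?q ^ Suc k - 1) * ?q ^ k * ?R + ?q ^ Suc k * (?R * (?q ^ r - ?q ^ k)) =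
      (?q ^ Suc r - 1) * ?q ^ k * ?R"
    by (simp add: algebra_simps)
  also have "\<dots> = (\<Prod>j<Suc k. ?q ^ Suc r - ?q ^ j)" by (rule prod_power_diff_Suc[symmetric])
  finally show ?case .
qed simp

text \<open>Span and independence are recursive in the list, as independent lists are to be counted by adding
  one vector at a time.\<close>

fun span_list :: "nat \<Rightarrow> 'f::field vec list \<Rightarrow> 'f vec set" where
  "span_list n [] = {0\<^sub>v n}"
| "span_list n (x # xs) = {c \<cdot>\<^sub>v x + s | c s. s \<in> span_list n xs}"

fun indep_list :: "nat \<Rightarrow> 'f::field vec list \<Rightarrow> bool" where
  "indep_list n [] = True"
| "indep_list n (x # xs) = (x \<notin> span_list n xs \<and> indep_list n xs)"

lemma lin_subspace_span_list: "set xs \<subseteq> carrier_vec n \<Longrightarrow> lin_subspace n (span_list n xs)"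
proof (induction xs)
  case Nil
  show ?case by (auto simp: lin_subspace_def)
next
  case (Cons x xs)
  have x: "x \<in> carrier_vec n" using Cons by simp
  note S = lin_subspaceD[OF Cons.IH]
  have sub: "set xs \<subseteq> carrier_vec n" using Cons by simp
  show ?case
    unfolding lin_subspace_def
  proof (intro conjI ballI allI)
    show "span_list n (x # xs) \<subseteq> carrier_vec n" using x S(1)[OF sub] by auto
    have "0\<^sub>v n = 0 \<cdot>\<^sub>v x + 0\<^sub>v n" using x by (intro eq_vecI) auto
    then show "0\<^sub>v n \<in> span_list n (x # xs)" using S(2)[OF sub] by auto
    fix v w assume "v \<in> span_list n (x # xs)" "w \<in> span_list n (x # xs)"
    then obtain c s d t where v: "v = c \<cdot>\<^sub>v x + s" "s \<in> span_list n xs" and w: "w = d \<cdot>\<^sub>v x + t" "t \<in> span_list n xs"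
      by auto
    have "v + w = (c + d) \<cdot>\<^sub>v x + (s + t)"
      using x S(1)[OF sub v(2)] S(1)[OF sub w(2)] unfolding v w by (intro eq_vecI) (auto simp: distrib_right)
    then show "v + w \<in> span_list n (x # xs)" using S(3)[OF sub v(2) w(2)] by auto
  next
    fix a v assume "v \<in> span_list n (x # xs)"
    then obtain c s where v: "v = c \<cdot>\<^sub>v x + s" "s \<in> span_list n xs" by auto
    have "a \<cdot>\<^sub>v v = (a * c) \<cdot>\<^sub>v x + a \<cdot>\<^sub>v s"
      using x S(1)[OF sub v(2)] unfolding v by (intro eq_vecI) (auto simp: distrib_left)
    then show "a \<cdot>\<^sub>v v \<in> span_list n (x # xs)" using S(4)[OF sub v(2)] by auto
  qed
qed

lemma span_list_subset: "lin_subspace n S \<Longrightarrow> set xs \<subseteq> S \<Longrightarrow> span_list n xs \<subseteq> S"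
proof (induction xs)
  case (Cons x xs)
  then show ?case using lin_subspaceD(3,4)[OF Cons.prems(1)] by auto
qed (auto simp: lin_subspace_def)

lemma card_span_list:
  fixes xs :: "'f::{field,finite} vec list"
  shows "set xs \<subseteq> carrier_vec n \<Longrightarrow> indep_list n xs \<Longrightarrow> card (span_list n xs) = CARD('f) ^ length xs"
proof (induction xs)
  case (Cons x xs)
  have sub: "set xs \<subseteq> carrier_vec n" and x: "x \<in> carrier_vec n" using Cons.prems by auto
  note S = lin_subspaceD[OF lin_subspace_span_list[OF sub]]
  have "inj_on (\<lambda>(c, s). c \<cdot>\<^sub>v x + s) ((UNIV :: 'f set) \<times> span_list n xs)"
  proof (rule inj_onI, clarify)
    fix c s d t assume st: "s \<in> span_list n xs" "t \<in> span_list n xs" and eq: "c \<cdot>\<^sub>v x + s = d \<cdot>\<^sub>v x + t"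
    have sc: "s \<in> carrier_vec n" "t \<in> carrier_vec n" using S(1) st by auto
    have i: "c * x $ i + s $ i = d * x $ i + t $ i" if "i < n" for i
    proof -
      have "(c \<cdot>\<^sub>v x + s) $ i = (d \<cdot>\<^sub>v x + t) $ i" using eq by simp
      then show ?thesis using that sc x by simp
    qed
    have "c = d"
    proof (rule ccontr)
      assume cd: "c \<noteq> d"
      have "x = (1 / (c - d)) \<cdot>\<^sub>v (t - s)"
      proof (rule eq_vecI)
        fix k assume "k < dim_vec ((1 / (c - d)) \<cdot>\<^sub>v (t - s))"
        then have k: "k < n" using sc by simp
        have "(c - d) * x $ k = t $ k - s $ k" using i[OF k] by (simp add: algebra_simps)
        then show "x $ k = ((1 / (c - d)) \<cdot>\<^sub>v (t - s)) $ k" using k sc cd by (simp add: field_simps)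
      qed (use x sc in simp)
      also have "\<dots> \<in> span_list n xs" by (rule S(4)[OF S(5)[OF st(2,1)]])
      finally show False using Cons.prems(2) by simp
    qed
    moreover from this have "s = t" using i sc by (intro eq_vecI) auto
    ultimately show "c = d \<and> s = t" by simp
  qed
  moreover have "span_list n (x # xs) = (\<lambda>(c, s). c \<cdot>\<^sub>v x + s) ` ((UNIV :: 'f set) \<times> span_list n xs)" by auto
  ultimately have "card (span_list n (x # xs)) = card ((UNIV :: 'f set) \<times> span_list n xs)"
    by (simp only: card_image)
  then show ?case using Cons.IH[OF sub] Cons.prems(2) by (simp add: card_cartesian_product)
qed simp

definition indep_lists :: "nat \<Rightarrow> 'f::field vec set \<Rightarrow> nat \<Rightarrow> 'f vec list set" where
  "indep_lists n S k = {xs. set xs \<subseteq> S \<and> length xs = k \<and> indep_list n xs}"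

lemma finite_indep_lists: "finite S \<Longrightarrow> finite (indep_lists n S k)"
  by (rule finite_subset[OF _ finite_lists_length_eq[of S k]]) (auto simp: indep_lists_def)

text \<open>After \<open>k\<close> independent vectors the next one has to avoid the \<open>q\<^sup>k\<close> vectors of their span. For \<open>k >
  d\<close> both sides are zero. The values are taken in a ring, where the differences are not truncated.\<close>

lemma card_indep_lists:
  fixes S :: "'f::{field,finite} vec set"
  assumes S: "lin_subspace n S" and card: "card S = CARD('f) ^ d"
  shows "(of_nat (card (indep_lists n S k)) :: 'a::comm_ring_1) = (\<Prod>j<k. of_nat CARD('f) ^ d - of_nat CARD('f) ^ j)"
proof (induction k)
  case 0
  have "indep_lists n S 0 = {[]}" by (auto simp: indep_lists_def)
  then show ?case by simp
next
  case (Suc k)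
  have Sc: "S \<subseteq> carrier_vec n" using S by (simp add: lin_subspace_def)
  have finS: "finite S" by (rule finite_subset[OF Sc finite_carrier_vec_finite_field])
  have "bij_betw (\<lambda>(xs, x). x # xs) (SIGMA xs:indep_lists n S k. S - span_list n xs) (indep_lists n S (Suc k))"
    by (rule bij_betw_byWitness[of _ "\<lambda>ys. (tl ys, hd ys)"])
      (auto simp: indep_lists_def length_Suc_conv)
  then have "card (indep_lists n S (Suc k)) = card (SIGMA xs:indep_lists n S k. S - span_list n xs)"
    by (rule bij_betw_same_card[symmetric])
  also have "\<dots> = (\<Sum>xs\<in>indep_lists n S k. card (S - span_list n xs))"
    using finS finite_indep_lists[OF finS] by (intro card_SigmaI) auto
  finally have "(of_nat (card (indep_lists n S (Suc k))) :: 'a) =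
      (\<Sum>xs\<in>indep_lists n S k. of_nat (card (S - span_list n xs)))" by simp
  also have "\<dots> = (\<Sum>xs\<in>indep_lists n S k. of_nat CARD('f) ^ d - of_nat CARD('f) ^ k)"
  proof (rule sum.cong[OF refl])
    fix xs assume xs: "xs \<in> indep_lists n S k"
    then have sub: "set xs \<subseteq> S" "length xs = k" "indep_list n xs" by (auto simp: indep_lists_def)
    have sp: "span_list n xs \<subseteq> S" by (rule span_list_subset[OF S sub(1)])
    have cs: "card (span_list n xs) = CARD('f) ^ k" using card_span_list[of xs n] sub Sc by auto
    have "card (span_list n xs) \<le> card S" by (rule card_mono[OF finS sp])
    moreover have "card (S - span_list n xs) = card S - card (span_list n xs)"
      using finite_subset[OF sp finS] sp by (rule card_Diff_subset)
    ultimately show "(of_nat (card (S - span_list n xs)) :: 'a) = of_nat CARD('f) ^ d - of_nat CARD('f) ^ k"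
      by (simp add: of_nat_diff cs card)
  qed
  also have "\<dots> = (\<Prod>j<Suc k. of_nat CARD('f) ^ d - of_nat CARD('f) ^ j)"
    by (simp add: Suc.IH)
  finally show ?case .
qed

section \<open>An irreducible without vectors fixed by stabilizers\<close>

lemma finite_group_GL: "finite_group (GL n :: 'f::{field,finite} mat monoid)"
  by (intro finite_group.intro group_GL) (simp add: finite_group_axioms_def finite_GL)

lemma carrier_GL_mat: "g \<in> carrier (GL n) \<Longrightarrow> g \<in> carrier_mat n n"
  by (simp add: GL_iff)

lemma fixed_dim_one: "fixed_dim n (1\<^sub>m n :: 'f::{field,finite} mat) = n"
proof -
  have "{v \<in> carrier_vec n. 1\<^sub>m n *\<^sub>v v = v} = (carrier_vec n :: 'f vec set)" by auto
  then have "CARD('f) ^ fixed_dim n (1\<^sub>m n :: 'f mat) = CARD('f) ^ n"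
    using card_fixed_vectors[of "1\<^sub>m n :: 'f mat" n] card_carrier_vec[of n, where 'f = 'f] by simp
  moreover have "CARD('f) > 1" using card_field_ge_2[where 'f = 'f] by simp
  ultimately show ?thesis by (simp only: power_inject_exp)
qed

lemma fixed_dim_less:
  fixes g :: "'f::{field,finite} mat"
  assumes g: "g \<in> carrier_mat n n" and "g \<noteq> 1\<^sub>m n"
  shows "fixed_dim n g < n"
proof -
  have "{v \<in> carrier_vec n. g *\<^sub>v v = v} \<noteq> carrier_vec n"
  proof
    assume all: "{v \<in> carrier_vec n. g *\<^sub>v v = v} = carrier_vec n"
    have "g = 1\<^sub>m n"
    proof (rule eq_matI)
      fix i j assume "i < dim_row (1\<^sub>m n :: 'f mat)" "j < dim_col (1\<^sub>m n :: 'f mat)"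
      then have ij: "i < n" "j < n" by auto
      have "g *\<^sub>v unit_vec n j = unit_vec n j" using all unit_vec_carrier by blast
      then have "col g j = unit_vec n j" using mult_unit_vec[OF g ij(2)] by simp
      then have "col g j $ i = unit_vec n j $ i" by simp
      then show "g $$ (i, j) = 1\<^sub>m n $$ (i, j)" using g ij by simp
    qed (use g in auto)
    with assms(2) show False by simp
  qed
  then have "card {v \<in> carrier_vec n. g *\<^sub>v v = v} < card (carrier_vec n :: 'f vec set)"
    by (intro psubset_card_mono finite_carrier_vec_finite_field) auto
  then have "CARD('f) ^ fixed_dim n g < CARD('f) ^ n"
    by (simp only: card_fixed_vectors[OF g] card_carrier_vec)
  then show ?thesis using card_field_ge_2[where 'f = 'f] by (simp add: power_strict_increasing_iff)
qed

definition stabilizer :: "nat \<Rightarrow> 'f::field vec list \<Rightarrow> 'f mat set" where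
  "stabilizer n xs = {g \<in> carrier (GL n). \<forall>x\<in>set xs. g *\<^sub>v x = x}"

lemma subgroup_stabilizer:
  fixes xs :: "'f::field vec list"
  assumes xs: "set xs \<subseteq> carrier_vec n"
  shows "subgroup (stabilizer n xs) (GL n)"
proof -
  interpret G: group "GL n :: 'f mat monoid" by (rule group_GL)
  have xc: "x \<in> carrier_vec n" if "x \<in> set xs" for x using that xs by blast
  show ?thesis
  proof (rule G.subgroupI)
    show "stabilizer n xs \<subseteq> carrier (GL n)" by (auto simp: stabilizer_def)
    have "\<one>\<^bsub>GL n :: 'f mat monoid\<^esub> \<in> stabilizer n xs"
      using xc G.one_closed by (auto simp: stabilizer_def GL_simps)
    then show "stabilizer n xs \<noteq> {}" by blast
    fix g assume g: "g \<in> stabilizer n xs"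
    then have gG: "g \<in> carrier (GL n)" and gx: "\<And>x. x \<in> set xs \<Longrightarrow> g *\<^sub>v x = x" by (auto simp: stabilizer_def)
    let ?i = "inv\<^bsub>GL n\<^esub> g"
    have iG: "?i \<in> carrier (GL n)" using gG by (rule G.inv_closed)
    have "?i * g = 1\<^sub>m n" using G.l_inv[OF gG] by (simp add: GL_simps)
    then have "?i *\<^sub>v x = x" if x: "x \<in> set xs" for x
      using assoc_mult_mat_vec[OF carrier_GL_mat[OF iG] carrier_GL_mat[OF gG] xc[OF x]] gx[OF x] xc[OF x] by simp
    then show "?i \<in> stabilizer n xs" using iG by (simp add: stabilizer_def)
    fix h assume h: "h \<in> stabilizer n xs"
    then have hG: "h \<in> carrier (GL n)" and hx: "\<And>x. x \<in> set xs \<Longrightarrow> h *\<^sub>v x = x" by (auto simp: stabilizer_def)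
    have "(g * h) *\<^sub>v x = x" if x: "x \<in> set xs" for x
      using assoc_mult_mat_vec[OF carrier_GL_mat[OF gG] carrier_GL_mat[OF hG] xc[OF x]] gx[OF x] hx[OF x] by simp
    moreover have "g * h \<in> carrier (GL n)" using gG hG by (rule GL_mult)
    ultimately show "g \<otimes>\<^bsub>GL n\<^esub> h \<in> stabilizer n xs" by (simp add: stabilizer_def GL_simps(2))
  qed
qed

text \<open>Fewer than \<open>n\<close> vectors lie in a hyperplane. The coset \<open>g Stab\<close> consists of all invertible matrices
  with the same values as \<open>g\<close> on the given vectors; sorted by their restriction to the hyperplane,
  they form full sets of extensions.\<close>

lemma sum_cuspidal_fun_stabilizer:
  fixes xs :: "'f::{field,finite} vec list"
  assumes xs: "set xs \<subseteq> carrier_vec n" "length xs < n" and g: "g \<in> carrier (GL n)"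
  shows "(\<Sum>s\<in>stabilizer n xs. cuspidal_fun n (g * s)) = 0"
proof -
  interpret G: group "GL n :: 'f mat monoid" by (rule group_GL)
  have gc: "g \<in> carrier_mat n n" using g by (rule carrier_GL_mat)
  have xc: "x \<in> carrier_vec n" if "x \<in> set xs" for x using that xs by blast
  obtain l where l: "l \<in> carrier_vec n" "l \<noteq> 0\<^sub>v n" "\<And>i. i < length xs \<Longrightarrow> xs ! i \<bullet> l = 0"
    by (rule common_zero[of "length xs" "\<lambda>i. xs ! i" n]) (use xc xs(2) in auto)
  have lx: "x \<in> hyperplane n l" if x: "x \<in> set xs" for x
  proof -
    obtain i where i: "i < length xs" "x = xs ! i" using x by (auto simp: in_set_conv_nth)
    have "l \<bullet> x = x \<bullet> l" by (rule comm_scalar_prod[OF l(1) xc[OF x]])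
    then show ?thesis using l(3)[OF i(1)] i xc[OF x] by (simp add: hyperplane_def)
  qed
  \<comment> \<open>The coset of the stabilizer that contains \<open>g\<close>.\<close>
  define T where "T = {h \<in> carrier (GL n). \<forall>x\<in>set xs. h *\<^sub>v x = g *\<^sub>v x}"
  have finT: "finite T" unfolding T_def by (rule finite_subset[OF _ finite_GL]) auto
  let ?i = "inv\<^bsub>GL n\<^esub> g"
  have iG: "?i \<in> carrier (GL n)" using g by (rule G.inv_closed)
  have ic: "?i \<in> carrier_mat n n" using iG by (rule carrier_GL_mat)
  have ig: "?i * g = 1\<^sub>m n" "g * ?i = 1\<^sub>m n" using G.l_inv[OF g] G.r_inv[OF g] by (simp_all add: GL_simps)
  have "(\<Sum>s\<in>stabilizer n xs. cuspidal_fun n (g * s)) = (\<Sum>h\<in>T. cuspidal_fun n h)"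
  proof (rule sum.reindex_bij_witness[of _ "\<lambda>h. ?i * h" "\<lambda>s. g * s"])
    fix s assume "s \<in> stabilizer n xs"
    then have s: "s \<in> carrier (GL n)" "\<And>x. x \<in> set xs \<Longrightarrow> s *\<^sub>v x = x" by (auto simp: stabilizer_def)
    have sc: "s \<in> carrier_mat n n" using s(1) by (rule carrier_GL_mat)
    show "?i * (g * s) = s"
      by (simp only: assoc_mult_mat[OF ic gc sc, symmetric] ig(1) left_mult_one_mat[OF sc])
    show "g * s \<in> T" unfolding T_def
      using g s GL_mult assoc_mult_mat_vec[OF gc sc] xc by auto
  next
    fix h assume "h \<in> T"
    then have h: "h \<in> carrier (GL n)" "\<And>x. x \<in> set xs \<Longrightarrow> h *\<^sub>v x = g *\<^sub>v x" by (auto simp: T_def)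
    have hc: "h \<in> carrier_mat n n" using h(1) by (rule carrier_GL_mat)
    show "g * (?i * h) = h"
      by (simp only: assoc_mult_mat[OF gc ic hc, symmetric] ig(2) left_mult_one_mat[OF hc])
    have "(?i * h) *\<^sub>v x = x" if x: "x \<in> set xs" for x
    proof -
      have "(?i * h) *\<^sub>v x = ?i *\<^sub>v (g *\<^sub>v x)"
        by (simp only: assoc_mult_mat_vec[OF ic hc xc[OF x]] h(2)[OF x])
      also have "\<dots> = x"
        using xc[OF x] by (simp only: assoc_mult_mat_vec[OF ic gc xc[OF x], symmetric] ig(1) one_mult_mat_vec)
      finally show ?thesis .
    qed
    then show "?i * h \<in> stabilizer n xs" unfolding stabilizer_def using iG h(1) GL_mult by blast
  qed simp
  also have "\<dots> = (\<Sum>y\<in>(\<lambda>h. restrict (\<lambda>w. h *\<^sub>v w) (hyperplane n l)) ` T.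
      \<Sum>h\<in>{h \<in> T. restrict (\<lambda>w. h *\<^sub>v w) (hyperplane n l) = y}. cuspidal_fun n h)"
    by (rule sum.image_gen[OF finT])
  also have "\<dots> = 0"
  proof (rule sum.neutral, clarify)
    fix h assume "h \<in> T"
    then have h: "h \<in> carrier (GL n)" "\<And>x. x \<in> set xs \<Longrightarrow> h *\<^sub>v x = g *\<^sub>v x" by (auto simp: T_def)
    have "{h' \<in> T. restrict (\<lambda>w. h' *\<^sub>v w) (hyperplane n l) = restrict (\<lambda>w. h *\<^sub>v w) (hyperplane n l)} = extensions n l h"
    proof -
      have "restrict (\<lambda>w. h' *\<^sub>v w) (hyperplane n l) = restrict (\<lambda>w. h *\<^sub>v w) (hyperplane n l) \<longleftrightarrow>
          (\<forall>w\<in>hyperplane n l. h' *\<^sub>v w = h *\<^sub>v w)" for h' :: "'f mat"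
        by (auto simp: restrict_def fun_eq_iff)
      then show ?thesis using h lx by (auto simp: T_def extensions_def)
    qed
    then show "(\<Sum>h'\<in>{h' \<in> T. restrict (\<lambda>w. h' *\<^sub>v w) (hyperplane n l) = restrict (\<lambda>w. h *\<^sub>v w) (hyperplane n l)}. cuspidal_fun n h') = 0"
      using sum_cuspidal_fun_extensions[OF l(1,2) carrier_GL_mat[OF h(1)]] by simp
  qed
  finally show ?thesis .
qed

text \<open>The sums of the character over a stabilizer measure the vectors fixed by it, so no stabilizer of
  fewer than \<open>n\<close> vectors fixes a nonzero vector of this irreducible.\<close>

theorem exists_full_rank_irreducible:
  assumes n: "n \<ge> 1" and not: "\<not> (n = 1 \<and> CARD('f::{field,finite}) = 2)"
  obtains \<rho> :: "'f::{field,finite} mat rep" where "irreducible_rep (GL n) \<rho>"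
    "\<And>xs. set xs \<subseteq> carrier_vec n \<Longrightarrow> length xs < n \<Longrightarrow>
      (\<Sum>s\<in>stabilizer n xs. character \<rho> (inv\<^bsub>GL n\<^esub> s)) = 0"
proof -
  interpret G: finite_group "GL n :: 'f mat monoid" by (rule finite_group_GL)
  have class_fun: "cuspidal_fun n (h \<otimes>\<^bsub>GL n\<^esub> g \<otimes>\<^bsub>GL n\<^esub> inv\<^bsub>GL n\<^esub> h) = cuspidal_fun n g"
    if g: "g \<in> carrier (GL n)" and h: "h \<in> carrier (GL n)" for g h :: "'f mat"
    using cuspidal_fun_conj[OF carrier_GL_mat[OF h] carrier_GL_mat[OF G.inv_closed[OF h]] _ _ carrier_GL_mat[OF g]]
      G.r_inv[OF h] G.l_inv[OF h] by (simp add: GL_simps)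
  have one: "\<one>\<^bsub>GL n\<^esub> \<in> carrier (GL n :: 'f mat monoid)" "cuspidal_fun n (\<one>\<^bsub>GL n\<^esub> :: 'f mat) \<noteq> 0"
    using G.one_closed cuspidal_fun_one[OF n not] by (simp_all add: GL_simps)
  obtain \<rho> :: "'f mat rep" where rho: "irreducible_rep (GL n) \<rho>"
    "\<And>S. S \<subseteq> carrier (GL n) \<Longrightarrow> (\<And>g. g \<in> carrier (GL n) \<Longrightarrow> (\<Sum>s\<in>S. cuspidal_fun n (g \<otimes>\<^bsub>GL n\<^esub> s)) = 0) \<Longrightarrow>
      (\<Sum>s\<in>S. character \<rho> (inv\<^bsub>GL n\<^esub> s)) = 0"
    using G.exists_irreducible_annihilated[OF class_fun one] by blast
  show thesis
  proof (rule that[OF rho(1)], rule rho(2))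
    fix xs :: "'f vec list" assume xs: "set xs \<subseteq> carrier_vec n" "length xs < n"
    show "stabilizer n xs \<subseteq> carrier (GL n)" by (auto simp: stabilizer_def)
    show "(\<Sum>s\<in>stabilizer n xs. cuspidal_fun n (g \<otimes>\<^bsub>GL n\<^esub> s)) = 0" if "g \<in> carrier (GL n)" for g
      using sum_cuspidal_fun_stabilizer[OF xs that] by (simp only: GL_simps(2))
  qed
qed

section \<open>The separation distance as a product\<close>

definition stabilizer_sum :: "nat \<Rightarrow> 'f::{field,finite} mat rep \<Rightarrow> nat \<Rightarrow> complex" where
  "stabilizer_sum n \<rho> k = (\<Sum>xs\<in>indep_lists n (carrier_vec n) k. \<Sum>s\<in>stabilizer n xs. character \<rho> (inv\<^bsub>GL n\<^esub> s))"

text \<open>Counting pairs of a group element and an independent list fixed by it: the product is the number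
  of independent lists of length \<open>k\<close> in the fixed space of \<open>g\<close>.\<close>

lemma stabilizer_sum_eq:
  fixes \<rho> :: "'f::{field,finite} mat rep"
  shows "stabilizer_sum n \<rho> k = (\<Sum>g\<in>carrier (GL n). character \<rho> (inv\<^bsub>GL n\<^esub> g) *
    (\<Prod>j<k. of_nat CARD('f) ^ fixed_dim n g - of_nat CARD('f) ^ j))"
proof -
  let ?X = "indep_lists n (carrier_vec n :: 'f vec set) k"
  let ?G = "carrier (GL n :: 'f mat monoid)"
  have finX: "finite ?X" by (rule finite_indep_lists[OF finite_carrier_vec_finite_field])
  have "(\<Prod>j<k. of_nat CARD('f) ^ fixed_dim n g - of_nat CARD('f) ^ j :: complex) =
      (\<Sum>xs\<in>?X. if g \<in> stabilizer n xs then 1 else 0)" if g: "g \<in> ?G" for g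
  proof -
    have gc: "g \<in> carrier_mat n n" by (rule carrier_GL_mat[OF g])
    let ?S = "{v \<in> carrier_vec n. g *\<^sub>v v = v}"
    have S: "lin_subspace n ?S"
      by (auto simp: lin_subspace_def mult_zero_vec[OF gc] mult_add_distrib_mat_vec[OF gc] mult_mat_vec[OF gc])
    have "(\<Prod>j<k. of_nat CARD('f) ^ fixed_dim n g - of_nat CARD('f) ^ j :: complex) = of_nat (card (indep_lists n ?S k))"
      by (rule card_indep_lists[OF S card_fixed_vectors[OF gc], symmetric])
    also have "indep_lists n ?S k = {xs \<in> ?X. g \<in> stabilizer n xs}"
      using g by (auto simp: indep_lists_def stabilizer_def)
    also have "(of_nat (card {xs \<in> ?X. g \<in> stabilizer n xs}) :: complex) = (\<Sum>xs\<in>?X. if g \<in> stabilizer n xs then 1 else 0)"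
      using finX by (simp add: sum.If_cases Int_def)
    finally show ?thesis .
  qed
  then have "(\<Sum>g\<in>?G. character \<rho> (inv\<^bsub>GL n\<^esub> g) * (\<Prod>j<k. of_nat CARD('f) ^ fixed_dim n g - of_nat CARD('f) ^ j)) =
      (\<Sum>g\<in>?G. \<Sum>xs\<in>?X. if g \<in> stabilizer n xs then character \<rho> (inv\<^bsub>GL n\<^esub> g) else 0)"
    by (auto simp: sum_distrib_left intro!: sum.cong)
  also have "\<dots> = (\<Sum>xs\<in>?X. \<Sum>g\<in>?G. if g \<in> stabilizer n xs then character \<rho> (inv\<^bsub>GL n\<^esub> g) else 0)"
    by (rule sum.swap)
  also have "\<dots> = stabilizer_sum n \<rho> k"
    unfolding stabilizer_sum_def
  proof (rule sum.cong[OF refl])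
    fix xs
    have "stabilizer n xs = {g \<in> ?G. g \<in> stabilizer n xs}" by (auto simp: stabilizer_def)
    then show "(\<Sum>g\<in>?G. if g \<in> stabilizer n xs then character \<rho> (inv\<^bsub>GL n\<^esub> g) else 0) =
        (\<Sum>s\<in>stabilizer n xs. character \<rho> (inv\<^bsub>GL n\<^esub> s))"
      by (simp add: sum.inter_filter[OF finite_GL, symmetric])
  qed
  finally show ?thesis ..
qed

text \<open>The only positivity in the argument: up to the order of the stabilizer, each summand is a
  multiplicity.\<close>

lemma stabilizer_sum_nat:
  fixes \<rho> :: "'f::{field,finite} mat rep"
  assumes rho: "representation (GL n) \<rho>"
  shows "\<exists>m::nat. stabilizer_sum n \<rho> k = of_nat m"
proof -
  interpret G: finite_group "GL n :: 'f mat monoid" by (rule finite_group_GL)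
  have "\<forall>xs\<in>indep_lists n (carrier_vec n) k. \<exists>m::nat. (\<Sum>s\<in>stabilizer n xs. character \<rho> (inv\<^bsub>GL n\<^esub> s)) = of_nat m"
  proof
    fix xs :: "'f vec list" assume "xs \<in> indep_lists n (carrier_vec n) k"
    then have "set xs \<subseteq> carrier_vec n" by (simp add: indep_lists_def)
    from G.sum_character_subgroup[OF subgroup_stabilizer[OF this] rho]
    show "\<exists>m::nat. (\<Sum>s\<in>stabilizer n xs. character \<rho> (inv\<^bsub>GL n\<^esub> s)) = of_nat m" by metis
  qed
  then obtain m :: "'f vec list \<Rightarrow> nat" where
    "\<forall>xs\<in>indep_lists n (carrier_vec n) k. (\<Sum>s\<in>stabilizer n xs. character \<rho> (inv\<^bsub>GL n\<^esub> s)) = of_nat (m xs)"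
    by metis
  then have "stabilizer_sum n \<rho> k = of_nat (\<Sum>xs\<in>indep_lists n (carrier_vec n) k. m xs)"
    by (simp add: stabilizer_sum_def)
  then show ?thesis by blast
qed

text \<open>Only the identity fixes \<open>n\<close> independent vectors, so this term is the same multiple of the
  dimension for all representations.\<close>

lemma stabilizer_sum_top:
  fixes \<rho> :: "'f::{field,finite} mat rep"
  assumes rho: "representation (GL n) \<rho>"
  shows "stabilizer_sum n \<rho> n = of_nat (rep_dim (GL n) \<rho>) * (\<Prod>j<n. of_nat CARD('f) ^ n - of_nat CARD('f) ^ j)"
proof -
  interpret G: finite_group "GL n :: 'f mat monoid" by (rule finite_group_GL)
  let ?one = "\<one>\<^bsub>GL n :: 'f mat monoid\<^esub>"
  let ?P = "\<Prod>j<n. of_nat CARD('f) ^ n - of_nat CARD('f) ^ j :: complex"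
  have "stabilizer_sum n \<rho> n = (\<Sum>g\<in>carrier (GL n). if g = ?one then character \<rho> (inv\<^bsub>GL n\<^esub> ?one) * ?P else 0)"
    unfolding stabilizer_sum_eq
  proof (rule sum.cong[OF refl])
    fix g :: "'f mat" assume g: "g \<in> carrier (GL n)"
    show "character \<rho> (inv\<^bsub>GL n\<^esub> g) * (\<Prod>j<n. of_nat CARD('f) ^ fixed_dim n g - of_nat CARD('f) ^ j) =
        (if g = ?one then character \<rho> (inv\<^bsub>GL n\<^esub> ?one) * ?P else 0)"
    proof (cases "g = ?one")
      case True
      have "fixed_dim n ?one = n" by (simp only: GL_simps(3) fixed_dim_one)
      then show ?thesis using True by simp
    next
      case False
      then have "fixed_dim n g < n" using fixed_dim_less[OF carrier_GL_mat[OF g]] by (simp add: GL_simps(3))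
      then have "(\<Prod>j<n. of_nat CARD('f) ^ fixed_dim n g - of_nat CARD('f) ^ j :: complex) = 0"
        by (intro prod_zero) auto
      then show ?thesis using False by simp
    qed
  qed
  also have "\<dots> = character \<rho> (inv\<^bsub>GL n\<^esub> ?one) * ?P" using G.finite_carrier G.one_closed by simp
  finally show ?thesis using G.character_one[OF rho] by simp
qed

lemma stabilizer_sum_above:
  fixes \<rho> :: "'f::{field,finite} mat rep"
  assumes "k > n"
  shows "stabilizer_sum n \<rho> k = 0"
  unfolding stabilizer_sum_eq
proof (rule sum.neutral, rule ballI)
  fix g :: "'f mat" assume g: "g \<in> carrier (GL n)"
  have "fixed_dim n g \<le> n"
    using fixed_dim_less[OF carrier_GL_mat[OF g]] fixed_dim_one[of n, where 'f = 'f] by (cases "g = 1\<^sub>m n") auto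
  then have "(\<Prod>j<k. of_nat CARD('f) ^ fixed_dim n g - of_nat CARD('f) ^ j :: complex) = 0"
    using assms by (intro prod_zero) auto
  then show "character \<rho> (inv\<^bsub>GL n\<^esub> g) * (\<Prod>j<k. of_nat CARD('f) ^ fixed_dim n g - of_nat CARD('f) ^ j) = 0" by simp
qed

text \<open>The contribution of \<open>k = n\<close> is separated from those of \<open>k < n\<close>, which are nonnegative and vanish
  for a suitable irreducible.\<close>

lemma sum_character_power_fixed_dim:
  fixes \<rho> :: "'f::{field,finite} mat rep"
  assumes rho: "representation (GL n) \<rho>"
  shows "(\<Sum>g\<in>carrier (GL n). character \<rho> (inv\<^bsub>GL n\<^esub> g) * of_nat (CARD('f) ^ fixed_dim n g) ^ r) =
    (\<Sum>k<n. of_nat (q_binomial CARD('f) r k) * stabilizer_sum n \<rho> k) +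
    of_nat (rep_dim (GL n) \<rho>) * (\<Prod>j<n. of_nat CARD('f) ^ r - of_nat CARD('f) ^ j)"
proof -
  let ?q = "CARD('f)"
  let ?c = "\<lambda>k. of_nat (q_binomial ?q r k) :: complex"
  have "(\<Sum>g\<in>carrier (GL n). character \<rho> (inv\<^bsub>GL n\<^esub> g) * of_nat (?q ^ fixed_dim n g) ^ r) =
      (\<Sum>g\<in>carrier (GL n). \<Sum>k\<le>r + n. ?c k * (character \<rho> (inv\<^bsub>GL n\<^esub> g) * (\<Prod>j<k. of_nat ?q ^ fixed_dim n g - of_nat ?q ^ j)))"
  proof (rule sum.cong[OF refl])
    fix g :: "'f mat"
    have "(of_nat (?q ^ fixed_dim n g) :: complex) ^ r =
        (\<Sum>k\<le>r + n. ?c k * (\<Prod>j<k. of_nat (?q ^ fixed_dim n g) - of_nat ?q ^ j))"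
      by (rule power_eq_sum_q_binomial) simp
    then show "character \<rho> (inv\<^bsub>GL n\<^esub> g) * of_nat (?q ^ fixed_dim n g) ^ r =
        (\<Sum>k\<le>r + n. ?c k * (character \<rho> (inv\<^bsub>GL n\<^esub> g) * (\<Prod>j<k. of_nat ?q ^ fixed_dim n g - of_nat ?q ^ j)))"
      by (simp only: of_nat_power sum_distrib_left mult.left_commute)
  qed
  also have "\<dots> = (\<Sum>k\<le>r + n. ?c k * stabilizer_sum n \<rho> k)"
    by (subst sum.swap) (simp only: stabilizer_sum_eq sum_distrib_left)
  also have "\<dots> = (\<Sum>k\<le>n. ?c k * stabilizer_sum n \<rho> k)"
    by (rule sum.mono_neutral_right) (auto simp: stabilizer_sum_above)
  also have "\<dots> = (\<Sum>k<n. ?c k * stabilizer_sum n \<rho> k) + ?c n * stabilizer_sum n \<rho> n"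
    by (simp add: lessThan_Suc_atMost[symmetric])
  also have "?c n * stabilizer_sum n \<rho> n =
      of_nat (rep_dim (GL n) \<rho>) * (?c n * (\<Prod>j<n. of_nat ?q ^ n - of_nat ?q ^ j))"
    unfolding stabilizer_sum_top[OF rho] by (rule mult.left_commute)
  also have "\<dots> = of_nat (rep_dim (GL n) \<rho>) * (\<Prod>j<n. of_nat ?q ^ r - of_nat ?q ^ j)"
    by (simp only: q_binomial_mult_prod)
  finally show ?thesis .
qed

text \<open>The quotient of \<open>K\<^sup>r(1,\<Lambda>)\<close> by the Plancherel measure is the product plus a nonnegative term. This
  term vanishes for the class of an irreducible on which no stabilizer of fewer than \<open>n\<close> vectors has
  nonzero fixed vectors, so the maximum is attained there.\<close>

theorem separation_GL:
  fixes \<eta> :: "'f::{field,finite} mat rep"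
  assumes n: "n \<ge> 1" and not: "\<not> (n = 1 \<and> CARD('f) = 2)"
    and eta: "representation (GL n) \<eta>"
    and char: "\<And>g. g \<in> carrier (GL n) \<Longrightarrow> character \<eta> g = of_nat (CARD('f) ^ fixed_dim n g)"
  shows "separation (GL n) \<eta> r = 1 - (\<Prod>j<n. 1 - real CARD('f) ^ j / real CARD('f) ^ r)"
proof -
  interpret G: finite_group "GL n :: 'f mat monoid" by (rule finite_group_GL)
  let ?q = "CARD('f)"
  let ?prod = "\<Prod>j<n. 1 - real ?q ^ j / real ?q ^ r"
  let ?ratio = "\<lambda>\<Lambda>. chain_K_pow (GL n) \<eta> r (trivial_class (GL n)) \<Lambda> / plancherel (GL n) \<Lambda>"
  have q0: "real ?q > 0" by simp
  have dim: "rep_dim (GL n) \<eta> = ?q ^ n"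
  proof -
    have "(of_nat (rep_dim (GL n) \<eta>) :: complex) = of_nat (?q ^ n)"
      using G.character_one[OF eta] char[OF G.one_closed] by (simp add: GL_simps fixed_dim_one)
    then show ?thesis by (simp only: of_nat_eq_iff)
  qed
  have ratio: "?ratio \<Lambda> = real (\<Sum>k<n. q_binomial ?q r k * m k) / (real (class_dim (GL n) \<Lambda>) * real ?q ^ (n * r)) + ?prod"
    if L: "\<Lambda> \<in> Irr (GL n)" and m: "\<And>k. stabilizer_sum n (class_rep \<Lambda>) k = of_nat (m k)" for \<Lambda> and m :: "nat \<Rightarrow> nat"
  proof -
    let ?rho = "class_rep \<Lambda>" and ?d = "class_dim (GL n) \<Lambda>"
    let ?N = "card (carrier (GL n :: 'f mat monoid))"
    note irr = G.class_rep(1)[OF L]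
    note rho = G.irreducible_repD(1)[OF irr]
    have d: "rep_dim (GL n) ?rho = ?d" "?d > 0"
      using G.irreducible_repD(2)[OF irr] by (simp_all add: class_dim_def)
    have N: "?N > 0" by (rule G.card_carrier_pos)
    let ?A = "\<Sum>k<n. q_binomial ?q r k * m k"
    have sum: "(\<Sum>g\<in>carrier (GL n). character ?rho (inv\<^bsub>GL n\<^esub> g) * of_nat (?q ^ fixed_dim n g) ^ r) =
        of_nat ?A + of_nat ?d * (\<Prod>j<n. of_nat ?q ^ r - of_nat ?q ^ j)"
      unfolding sum_character_power_fixed_dim[OF rho] d(1) m by simp
    have "of_real (chain_K_pow (GL n) \<eta> r (trivial_class (GL n)) \<Lambda>) =
        of_nat ?d * G.char_mult ?rho (\<lambda>g. character \<eta> g ^ r) / of_nat (?q ^ n) ^ r"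
      using G.chain_K_pow_eq[OF eta L, of r] by (simp add: dim)
    also have "G.char_mult ?rho (\<lambda>g. character \<eta> g ^ r) =
        (of_nat ?A + of_nat ?d * (\<Prod>j<n. of_nat ?q ^ r - of_nat ?q ^ j)) / of_nat ?N"
      unfolding G.char_mult_def sum[symmetric] using char by (simp cong: sum.cong)
    also have "of_nat ?d * ((of_nat ?A + of_nat ?d * (\<Prod>j<n. of_nat ?q ^ r - of_nat ?q ^ j)) / of_nat ?N) / of_nat (?q ^ n) ^ r =
        complex_of_real (real ?d * ((real ?A + real ?d * (\<Prod>j<n. real ?q ^ r - real ?q ^ j)) / real ?N) / (real ?q ^ n) ^ r)"
      by (simp only: of_real_mult of_real_divide of_real_add of_real_prod of_real_diff of_real_power
          of_real_of_nat_eq of_nat_power)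
    finally have K: "chain_K_pow (GL n) \<eta> r (trivial_class (GL n)) \<Lambda> =
        real ?d * ((real ?A + real ?d * (\<Prod>j<n. real ?q ^ r - real ?q ^ j)) / real ?N) / (real ?q ^ n) ^ r"
      by (simp only: of_real_eq_iff)
    have pr: "(\<Prod>j<n. real ?q ^ r - real ?q ^ j) / (real ?q ^ n) ^ r = ?prod"
    proof -
      have "(\<Prod>j<n. real ?q ^ r - real ?q ^ j) = (\<Prod>j<n. real ?q ^ r * (1 - real ?q ^ j / real ?q ^ r))"
        using q0 by (intro prod.cong refl) (simp add: right_diff_distrib)
      also have "\<dots> = (real ?q ^ n) ^ r * ?prod"
        by (simp add: prod.distrib power_mult[symmetric] mult.commute)
      finally show ?thesis using q0 by simp
    qed
    have "?ratio \<Lambda> = real ?A / (real ?d * (real ?q ^ n) ^ r) + (\<Prod>j<n. real ?q ^ r - real ?q ^ j) / (real ?q ^ n) ^ r"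
      unfolding K plancherel_def Coset.order_def using d(2) N q0 by (simp add: field_simps power2_eq_square)
    then show ?thesis unfolding pr by (simp add: power_mult)
  qed
  have m_ex: "\<exists>m::nat \<Rightarrow> nat. \<forall>k. stabilizer_sum n (class_rep \<Lambda>) k = of_nat (m k)" if "\<Lambda> \<in> Irr (GL n)"
    for \<Lambda> :: "'f mat rep set"
    using stabilizer_sum_nat[OF G.irreducible_repD(1)[OF G.class_rep(1)[OF that]]] by metis
  obtain \<rho> :: "'f mat rep" where rho: "irreducible_rep (GL n) \<rho>"
    "\<And>xs. set xs \<subseteq> carrier_vec n \<Longrightarrow> length xs < n \<Longrightarrow> (\<Sum>s\<in>stabilizer n xs. character \<rho> (inv\<^bsub>GL n\<^esub> s)) = 0"
    by (rule exists_full_rank_irreducible[OF n not]) blast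
  define \<Lambda>0 where "\<Lambda>0 = G.irr_class \<rho>"
  have L0: "\<Lambda>0 \<in> Irr (GL n)" unfolding \<Lambda>0_def by (rule G.irr_class_in_Irr[OF rho(1)])
  have iso: "rep_iso (GL n) (class_rep \<Lambda>0) \<rho>"
    using G.rep_iso_class_rep_iff[OF L0 rho(1)] by (simp add: \<Lambda>0_def)
  have J0: "stabilizer_sum n (class_rep \<Lambda>0) k = 0" if k: "k < n" for k
  proof -
    have "stabilizer_sum n (class_rep \<Lambda>0) k = stabilizer_sum n \<rho> k"
      unfolding stabilizer_sum_eq
      using G.rep_iso_character[OF G.irreducible_repD(1)[OF G.class_rep(1)[OF L0]] G.irreducible_repD(1)[OF rho(1)] iso]
      by (simp cong: sum.cong)
    also have "\<dots> = 0"
      unfolding stabilizer_sum_def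
      by (rule sum.neutral) (use rho(2) k in \<open>auto simp: indep_lists_def\<close>)
    finally show ?thesis .
  qed
  have le: "1 - ?ratio \<Lambda> \<le> 1 - ?prod" if L: "\<Lambda> \<in> Irr (GL n)" for \<Lambda>
  proof -
    obtain m :: "nat \<Rightarrow> nat" where m: "\<And>k. stabilizer_sum n (class_rep \<Lambda>) k = of_nat (m k)" using m_ex[OF L] by blast
    have "real (\<Sum>k<n. q_binomial ?q r k * m k) / (real (class_dim (GL n) \<Lambda>) * real ?q ^ (n * r)) \<ge> 0"
      by (intro divide_nonneg_nonneg mult_nonneg_nonneg zero_le_power of_nat_0_le_iff)
    then show ?thesis using ratio[OF L m] by linarith
  qed
  have eq: "1 - ?ratio \<Lambda>0 = 1 - ?prod"
  proof -
    obtain m :: "nat \<Rightarrow> nat" where m: "\<And>k. stabilizer_sum n (class_rep \<Lambda>0) k = of_nat (m k)" using m_ex[OF L0] by blast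
    have "m k = 0" if "k < n" for k using J0[OF that] m[of k] by simp
    then have zero: "(\<Sum>k<n. q_binomial ?q r k * m k) = 0" by simp
    show ?thesis using ratio[OF L0 m, unfolded zero] by simp
  qed
  show ?thesis
    unfolding separation_def
  proof (rule Max_eqI)
    show "finite ((\<lambda>\<Lambda>. 1 - ?ratio \<Lambda>) ` Irr (GL n))" using G.finite_Irr by simp
    show "y \<le> 1 - ?prod" if "y \<in> (\<lambda>\<Lambda>. 1 - ?ratio \<Lambda>) ` Irr (GL n)" for y using that le by blast
    show "1 - ?prod \<in> (\<lambda>\<Lambda>. 1 - ?ratio \<Lambda>) ` Irr (GL n)" using L0 eq by (intro image_eqI[of _ _ \<Lambda>0]) auto
  qed
qed

section \<open>Bounds and limit of the product\<close>

lemma prod_diff_eq: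
  fixes q :: real
  assumes "q > 0"
  shows "(\<Prod>j<n. 1 - q ^ j / q ^ (n + c)) = (\<Prod>i<n. 1 - 1 / q ^ (c + Suc i))"
proof -
  have "(\<Prod>j<n. 1 - q ^ j / q ^ (n + c)) = (\<Prod>i<n. 1 - q ^ (n - Suc i) / q ^ (n + c))"
    by (rule prod.nat_diff_reindex[symmetric])
  also have "\<dots> = (\<Prod>i<n. 1 - 1 / q ^ (c + Suc i))"
  proof (rule prod.cong[OF refl])
    fix i assume "i \<in> {..<n}"
    then have "n + c = (n - Suc i) + (c + Suc i)" by simp
    then have "q ^ (n + c) = q ^ (n - Suc i) * q ^ (c + Suc i)" by (simp only: power_add)
    then show "1 - q ^ (n - Suc i) / q ^ (n + c) = 1 - 1 / q ^ (c + Suc i)" using assms by simp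
  qed
  finally show ?thesis .
qed

text \<open>For the lower bound all factors except the first are replaced by 1. The upper bound is \<open>1 - \<Prod>(1 -
  a\<^sub>i) \<le> \<Sum>a\<^sub>i\<close> together with a geometric series of ratio at most \<open>1 / 2\<close>.\<close>

lemma prod_geometric_bounds:
  fixes q :: real
  assumes q: "q \<ge> 2" and n: "n \<ge> 1"
  shows "1 / q ^ (c + 1) \<le> 1 - (\<Prod>i<n. 1 - 1 / q ^ (c + Suc i))"
    and "1 - (\<Prod>i<n. 1 - 1 / q ^ (c + Suc i)) \<le> 2 / q ^ (c + 1)"
proof -
  have a01: "0 \<le> 1 / q ^ k" "1 / q ^ k \<le> 1" for k
    using q one_le_power[of q k] by (simp_all add: divide_le_eq_1)
  have f01: "0 \<le> 1 - 1 / q ^ k \<and> 1 - 1 / q ^ k \<le> 1" for k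
    using a01[of k] by linarith
  obtain m where m: "n = Suc m" using n by (cases n) auto
  have "(\<Prod>i<n. 1 - 1 / q ^ (c + Suc i)) = (1 - 1 / q ^ (c + 1)) * (\<Prod>i<m. 1 - 1 / q ^ (c + Suc (Suc i)))"
    unfolding m by (subst prod.lessThan_Suc_shift) simp
  also have "\<dots> \<le> (1 - 1 / q ^ (c + 1)) * 1"
    by (rule mult_left_mono[OF prod_le_1[OF f01] conjunct1[OF f01]])
  finally show "1 / q ^ (c + 1) \<le> 1 - (\<Prod>i<n. 1 - 1 / q ^ (c + Suc i))" by simp
  have "1 - (\<Sum>i<n. 1 / q ^ (c + Suc i)) \<le> (\<Prod>i<n. 1 - 1 / q ^ (c + Suc i))"
  proof (rule Weierstrass_prod_ineq)
    show "1 / q ^ (c + Suc i) \<in> {0..1}" for i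
      unfolding atLeastAtMost_iff using a01[of "c + Suc i"] by blast
  qed
  then have "1 - (\<Prod>i<n. 1 - 1 / q ^ (c + Suc i)) \<le> (\<Sum>i<n. 1 / q ^ (c + Suc i))" by linarith
  also have "\<dots> = 1 / q ^ (c + 1) * (\<Sum>i<n. (1 / q) ^ i)"
    by (simp add: sum_distrib_left power_add power_divide mult_ac)
  also have "\<dots> \<le> 1 / q ^ (c + 1) * 2"
  proof (rule mult_left_mono)
    have "(\<Sum>i<n. (1 / q) ^ i) \<le> (\<Sum>i<n. (1 / 2) ^ i)"
      using q by (intro sum_mono power_mono) (auto simp: field_simps)
    also have "\<dots> = 2 - 2 * (1 / 2) ^ n" by (induction n) auto
    also have "\<dots> \<le> 2" by simp
    finally show "(\<Sum>i<n. (1 / q) ^ i) \<le> 2" .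
  qed (rule a01)
  finally show "1 - (\<Prod>i<n. 1 - 1 / q ^ (c + Suc i)) \<le> 2 / q ^ (c + 1)" by simp
qed

lemma prod_geometric_tendsto:
  fixes q :: real
  assumes q: "q \<ge> 2"
  shows "(\<lambda>n. \<Prod>i<n. 1 - 1 / q ^ (c + Suc i)) \<longlonglongrightarrow> (\<Prod>m. 1 - 1 / q ^ (c + Suc m))"
proof -
  let ?f = "\<lambda>i. 1 - 1 / q ^ (c + Suc i)"
  have "summable (\<lambda>i. 1 / q ^ (c + 1) * (1 / q) ^ i)"
    using q by (intro summable_mult summable_geometric) simp
  moreover have "norm (?f i - 1) = 1 / q ^ (c + 1) * (1 / q) ^ i" for i
    using q by (simp add: power_add power_divide mult_ac)
  ultimately have "summable (\<lambda>i. norm (?f i - 1))" by simp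
  then have "convergent_prod ?f"
    by (intro abs_convergent_prod_imp_convergent_prod summable_imp_abs_convergent_prod)
  then have "(\<lambda>n. \<Prod>i\<le>n. ?f i) \<longlonglongrightarrow> prodinf ?f" by (rule convergent_prod_LIMSEQ)
  then have "(\<lambda>n. \<Prod>i<Suc n. ?f i) \<longlonglongrightarrow> prodinf ?f" by (simp only: lessThan_Suc_atMost)
  then show ?thesis by (rule LIMSEQ_imp_Suc)
qed

theorem theorem4p5:
  fixes \<eta> :: "nat \<Rightarrow> ('f::{field,finite} mat) rep" and q :: nat
  assumes q: "q = CARD('f)"
    and eta_rep: "\<And>n. n \<ge> 1 \<Longrightarrow> representation (GL n) (\<eta> n)"
    and eta_char: "\<And>n g. n \<ge> 1 \<Longrightarrow> g \<in> carrier (GL n) \<Longrightarrow>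
                     character (\<eta> n) g = of_nat (q ^ fixed_dim n g)"
  shows "(\<forall>n \<ge> 1. \<not> (n = 1 \<and> q = 2) \<longrightarrow>
            (\<forall>r < n. separation (GL n) (\<eta> n) r = 1) \<and>
            (\<forall>c::nat. 1 / real q ^ (c + 1) - 4 / real q ^ (2 * c + 3)
                        \<le> separation (GL n) (\<eta> n) (n + c) \<and>
                      separation (GL n) (\<eta> n) (n + c) \<le> 2 / real q ^ (c + 1)))
       \<and> (\<forall>c::nat. (\<lambda>n. separation (GL n) (\<eta> n) (n + c))
            \<longlonglongrightarrow> 1 - (\<Prod>m. 1 - 1 / real q ^ (c + Suc m)))"
proof -
  have q2: "real q \<ge> 2" using card_field_ge_2[where 'f = 'f] by (simp add: q)
  have sep: "separation (GL n) (\<eta> n) r = 1 - (\<Prod>j<n. 1 - real q ^ j / real q ^ r)"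
    if "n \<ge> 1" "\<not> (n = 1 \<and> q = 2)" for n r
    unfolding q by (rule separation_GL) (use that eta_rep eta_char in \<open>auto simp: q\<close>)
  have sep': "separation (GL n) (\<eta> n) (n + c) = 1 - (\<Prod>i<n. 1 - 1 / real q ^ (c + Suc i))"
    if "n \<ge> 1" "\<not> (n = 1 \<and> q = 2)" for n c
    using sep[OF that, of "n + c"] prod_diff_eq[of "real q" n c] q2 by simp
  show ?thesis
  proof (intro conjI allI impI)
    fix n r :: nat assume n: "1 \<le> n" "\<not> (n = 1 \<and> q = 2)" and r: "r < n"
    \<comment> \<open>The factor with \<open>j = r\<close> vanishes.\<close>
    have "(\<Prod>j<n. 1 - real q ^ j / real q ^ r) = 0"
      using r q2 by (intro prod_zero) (auto intro!: bexI[of _ r])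
    then show "separation (GL n) (\<eta> n) r = 1" using sep[OF n] by simp
  next
    fix n c :: nat assume n: "1 \<le> n" "\<not> (n = 1 \<and> q = 2)"
    have "1 / real q ^ (c + 1) - 4 / real q ^ (2 * c + 3) \<le> 1 / real q ^ (c + 1)" by simp
    also have "\<dots> \<le> separation (GL n) (\<eta> n) (n + c)"
      unfolding sep'[OF n] by (rule prod_geometric_bounds(1)[OF q2 n(1)])
    finally show "1 / real q ^ (c + 1) - 4 / real q ^ (2 * c + 3) \<le> separation (GL n) (\<eta> n) (n + c)" .
    show "separation (GL n) (\<eta> n) (n + c) \<le> 2 / real q ^ (c + 1)"
      unfolding sep'[OF n] by (rule prod_geometric_bounds(2)[OF q2 n(1)])
  next
    fix c :: nat
    have "(\<lambda>n. 1 - (\<Prod>i<n. 1 - 1 / real q ^ (c + Suc i))) \<longlonglongrightarrow> 1 - (\<Prod>m. 1 - 1 / real q ^ (c + Suc m))"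
      by (intro tendsto_intros prod_geometric_tendsto[OF q2])
    moreover have "eventually (\<lambda>n. 1 - (\<Prod>i<n. 1 - 1 / real q ^ (c + Suc i)) = separation (GL n) (\<eta> n) (n + c)) sequentially"
      using eventually_ge_at_top[of 2] by eventually_elim (rule sep'[symmetric], auto)
    ultimately show "(\<lambda>n. separation (GL n) (\<eta> n) (n + c)) \<longlonglongrightarrow> 1 - (\<Prod>m. 1 - 1 / real q ^ (c + Suc m))"
      by (rule Lim_transform_eventually)
  qed
qed

end
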